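(* For every $c>0$ there exist positive real numbers $\alpha_c$ and $\beta$ such that, whenever $N=N(n)$ is a sequence of positive integers with $\lim_{n\to\infty}\sqrt{n}/N=c$, $$\lim_{n\to\infty}\mathbb{P}_N^n\left\{\lambda\in\mathbb{Y}_N^n:\ \alpha_c<-\frac{1}{\sqrt{n}}\ln\frac{\dim E_\lambda}{N^n}<\beta\right\}=1.$$
   Context: For positive integers $N,n$, the symmetric group $S_n$ acts on $(\mathbb{C}^N)^{\otimes n}$ by permuting tensor factors. $\mathbb{Y}_N^n$ denotes the set of Young diagrams with $n$ cells and at most $N$ rows; these index exactly the irreducible $S_n$-representations $V_\lambda$ occurring in $(\mathbb{C}^N)^{\otimes n}$. For $\lambda\in\mathbb{Y}_N^n$, $E_\lambda$ is the isotypic component of $(\mathbb{C}^N)^{\otimes n}$ corresponding to $V_\lambda$. The probability measure $\mathbb{P}_N^n$ on $\mathbb{Y}_N^n$ is $\mathbb{P}_N^n(\lambda)=\dim E_\lambda/N^n$. *)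

theory Defs
  imports Complex_Main "HOL-Library.Function_Algebras" "HOL-Combinatorics.Permutations"
begin

definition Sym :: "nat \<Rightarrow> (nat \<Rightarrow> nat) set" where
  "Sym n = {p. p permutes {0..<n}}"

definition galg :: "nat \<Rightarrow> ((nat \<Rightarrow> nat) \<Rightarrow> complex) set" where
  "galg n = {a. \<forall>s. s \<notin> Sym n \<longrightarrow> a s = 0}"

definition galg_mult :: "nat \<Rightarrow> ((nat \<Rightarrow> nat) \<Rightarrow> complex) \<Rightarrow> ((nat \<Rightarrow> nat) \<Rightarrow> complex)
    \<Rightarrow> ((nat \<Rightarrow> nat) \<Rightarrow> complex)" where
  "galg_mult n a b = (\<lambda>s. if s \<in> Sym n then (\<Sum>t\<in>Sym n. a t * b (inv t \<circ> s)) else 0)"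

definition delta :: "(nat \<Rightarrow> nat) \<Rightarrow> (nat \<Rightarrow> nat) \<Rightarrow> complex" where
  "delta s = (\<lambda>t. if t = s then 1 else 0)"

definition cscale :: "complex \<Rightarrow> ('a \<Rightarrow> complex) \<Rightarrow> ('a \<Rightarrow> complex)" where
  "cscale c f = (\<lambda>x. c * f x)"

definition young_diagrams :: "nat \<Rightarrow> nat \<Rightarrow> nat list set" where
  "young_diagrams N n = {lam. sorted_wrt (\<ge>) lam \<and> 0 \<notin> set lam \<and> sum_list lam = n \<and> length lam \<le> N}"

text \<open>Canonical (row reading) tableau: the cell (i,j) contains sum(take i lam) + j, entries 0..n-1.\<close>
definition row_of :: "nat list \<Rightarrow> nat \<Rightarrow> nat" where
  "row_of lam k = (LEAST i. k < sum_list (take (Suc i) lam))"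

definition col_of :: "nat list \<Rightarrow> nat \<Rightarrow> nat" where
  "col_of lam k = k - sum_list (take (row_of lam k) lam)"

definition row_group :: "nat list \<Rightarrow> (nat \<Rightarrow> nat) set" where
  "row_group lam = {p \<in> Sym (sum_list lam). \<forall>k < sum_list lam. row_of lam (p k) = row_of lam k}"

definition col_group :: "nat list \<Rightarrow> (nat \<Rightarrow> nat) set" where
  "col_group lam = {p \<in> Sym (sum_list lam). \<forall>k < sum_list lam. col_of lam (p k) = col_of lam k}"

text \<open>Young symmetrizer c_lam = a_lam b_lam (Fulton--Harris).\<close>
definition young_sym :: "nat list \<Rightarrow> (nat \<Rightarrow> nat) \<Rightarrow> complex" where
  "young_sym lam = galg_mult (sum_list lam)
     (\<lambda>s. if s \<in> row_group lam then 1 else 0)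
     (\<lambda>s. if s \<in> col_group lam then of_int (sign s) else 0)"

text \<open>The irreducible representation V_lam = C[S_n] c_lam (left ideal), with S_n acting
  by left multiplication.\<close>
definition specht :: "nat list \<Rightarrow> ((nat \<Rightarrow> nat) \<Rightarrow> complex) set" where
  "specht lam = {galg_mult (sum_list lam) x (young_sym lam) | x. x \<in> galg (sum_list lam)}"

text \<open>Coordinates with respect to the basis e_{w_1} \<otimes> ... \<otimes> e_{w_n}, w a word of
  length n over {0..<N}.\<close>
definition words :: "nat \<Rightarrow> nat \<Rightarrow> nat list set" where
  "words N n = {w. length w = n \<and> set w \<subseteq> {..<N}}"

definition tensors :: "nat \<Rightarrow> nat \<Rightarrow> (nat list \<Rightarrow> complex) set" where
  "tensors N n = {f. \<forall>w. w \<notin> words N n \<longrightarrow> f w = 0}"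

text \<open>Left action of S_n permuting tensor factors.\<close>
definition tact :: "nat \<Rightarrow> (nat \<Rightarrow> nat) \<Rightarrow> (nat list \<Rightarrow> complex) \<Rightarrow> (nat list \<Rightarrow> complex)" where
  "tact n s f = (\<lambda>w. if length w = n then f (map (\<lambda>i. w ! s i) [0..<n]) else 0)"

definition equiv_maps :: "nat list \<Rightarrow> nat \<Rightarrow>
    (((nat \<Rightarrow> nat) \<Rightarrow> complex) \<Rightarrow> (nat list \<Rightarrow> complex)) set" where
  "equiv_maps lam N = {phi.
     (\<forall>x\<in>specht lam. phi x \<in> tensors N (sum_list lam)) \<and>
     (\<forall>x\<in>specht lam. \<forall>y\<in>specht lam. phi (x + y) = phi x + phi y) \<and>
     (\<forall>x\<in>specht lam. \<forall>c. phi (cscale c x) = cscale c (phi x)) \<and>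
     (\<forall>s\<in>Sym (sum_list lam). \<forall>x\<in>specht lam.
        phi (galg_mult (sum_list lam) (delta s) x) = tact (sum_list lam) s (phi x))}"

definition isotypic :: "nat list \<Rightarrow> nat \<Rightarrow> (nat list \<Rightarrow> complex) set" where
  "isotypic lam N = module.span cscale {phi x | phi x. phi \<in> equiv_maps lam N \<and> x \<in> specht lam}"

definition dimE :: "nat list \<Rightarrow> nat \<Rightarrow> nat" where
  "dimE lam N = vector_space.dim cscale (isotypic lam N)"

definition PN :: "nat \<Rightarrow> nat \<Rightarrow> nat list \<Rightarrow> real" where
  "PN N n lam = real (dimE lam N) / real N ^ n"

end

theory Submission
  imports Defs "HOL-Library.FuncSet"
begin

text \<open>Let \<open>f(L)\<close> be the number of standard tableaux of shape \<open>L\<close>. The Young symmetrizer \<open>c\<close> of shape \<open>L\<close>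
  satisfies \<open>c c = kappa c\<close>, and \<open>e = kappa^-2 \<Sum>\<^sub>g g c g^-1\<close> is a central idempotent whose image in the tensor
  power is the isotypic component. Idempotents for different shapes are orthogonal, so the
  coefficients \<open>n! / kappa\<^sup>2\<close> of the identity in them sum to at most 1; a triangular family indexed by
  standard tableaux gives \<open>f(L) \<le> n! / kappa\<close>; since \<open>\<Sum> f(L)\<^sup>2 = n!\<close>, equality holds throughout.
  Tracing \<open>e\<close> on the tensor power yields \<open>P(L) = f(L)\<^sup>2 / n! \<cdot> \<Prod> (1 + content / N)\<close>.

  Upper bound for \<open>P\<close>: the Cauchy-Schwarz inequality with weights \<open>1 + content / N\<close>, applied to
  \<open>f(L) = \<Sum> f(L - box)\<close>, bounds \<open>P(L)\<close> by \<open>N/n + 1/N\<close> times the sum of \<open>P\<close> over the diagrams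
  with one box less. The weights of the removable boxes are summable without any bound on the first
  row, because the lengths of the rows add up to \<open>n\<close>. Iterating about \<open>sqrt n\<close> times gives exponential
  decay. Diagrams with too small a probability are negligible because there are only
  \<open>exp (O (sqrt n))\<close> diagrams with at most \<open>N\<close> rows.\<close>

subsection \<open>Traces of idempotents\<close>

text \<open>No module is ever decomposed here; nonnegativity of dimensions does that work. For an
  idempotent, \<open>n! tau\<close> is a dimension. Applied to the complement of the sum of all
  central idempotents, this gives the bound 1 for the sum of \<open>n! / kappa^2\<close>; applied to
  one central idempotent minus the triangular idempotent below it, it gives the bound for
  \<open>f(L)\<close>. Both bounds must be sharp because the numbers \<open>f(L)^2\<close> already
  add up to \<open>n!\<close>. The outcome \<open>kappa = n! / f(L)\<close> takes the place of the
  hook formula, and no later estimate looks at hooks.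

  In the decay estimate, one step costs a factor \<open>A\<close> of order
  \<open>1 / sqrt n\<close>, and \<open>m\<close> steps pass through at most \<open>m!\<close>
  chains of diagrams, so the bound is \<open>(A m)^m\<close>. It is smallest for \<open>m\<close> of
  order \<open>sqrt n\<close>, which explains the scale in the theorem. The bound is uniform over
  all diagrams, so no limit shape is needed: the exceptional set consists only of diagrams whose
  probability is too small, and these are handled by counting.\<close>

lemma vector_space_cscale: "vector_space (cscale :: complex \<Rightarrow> ('a \<Rightarrow> complex) \<Rightarrow> _)"
  by unfold_locales (auto simp: cscale_def fun_eq_iff algebra_simps)

interpretation cs: vector_space "cscale :: complex \<Rightarrow> ('a \<Rightarrow> complex) \<Rightarrow> _"
  by (rule vector_space_cscale)

lemma sum_fun_apply: "(\<Sum>i\<in>I. f i) x = (\<Sum>i\<in>I. f i (x :: 'a) :: complex)"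
  by (induction I rule: infinite_finite_induct) auto

definition unit_fun :: "'a \<Rightarrow> 'a \<Rightarrow> complex" where
  "unit_fun x = (\<lambda>y. if y = x then 1 else 0)"

lemma unit_fun_expansion:
  assumes "finite X" "\<And>x. x \<notin> X \<Longrightarrow> f x = 0"
  shows "f = (\<Sum>x\<in>X. cscale (f x) (unit_fun x))"
proof
  fix y
  have "(\<Sum>x\<in>X. cscale (f x) (unit_fun x)) y = (\<Sum>x\<in>X. if x = y then f x else 0)"
    by (auto simp: sum_fun_apply cscale_def unit_fun_def intro!: sum.cong)
  also have "\<dots> = f y"
    using assms by simp
  finally show "f y = (\<Sum>x\<in>X. cscale (f x) (unit_fun x)) y" ..
qed

text \<open>For a basis \<open>B\<close> of the image, the diagonal sum regroups by basis vectors,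
  and the part that belongs to \<open>b\<close> is the \<open>b\<close>-coordinate of
  \<open>P b = b\<close>, which is 1.\<close>

lemma dim_range_idempotent:
  fixes P :: "('a \<Rightarrow> complex) \<Rightarrow> ('a \<Rightarrow> complex)"
  assumes X: "finite X" and V: "V = {f. \<forall>x. x \<notin> X \<longrightarrow> f x = 0}"
    and add: "\<And>f g. P (f + g) = P f + P g" and scale: "\<And>c f. P (cscale c f) = cscale c (P f)"
    and closed: "\<And>f. f \<in> V \<Longrightarrow> P f \<in> V" and idem: "\<And>f. f \<in> V \<Longrightarrow> P (P f) = P f"
  shows "of_nat (cs.dim (P ` V)) = (\<Sum>x\<in>X. P (unit_fun x) x)"
proof -
  have zero: "P 0 = 0" using scale[of 0 0] by (simp add: cs.scale_zero_left)
  have P_sum: "P (\<Sum>i\<in>I. g i) = (\<Sum>i\<in>I. P (g i))" for I :: "'a set" and g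
    by (induction I rule: infinite_finite_induct) (simp_all only: sum.infinite sum.empty sum.insert add zero not_False_eq_True)
  obtain B where B: "B \<subseteq> P ` V" "cs.independent B" "P ` V \<subseteq> cs.span B" "card B = cs.dim (P ` V)"
    using cs.basis_exists[of "P ` V"] by blast
  have unit_V: "unit_fun x \<in> V" if "x \<in> X" for x
    using that by (auto simp: V unit_fun_def)
  have "V \<subseteq> cs.span (unit_fun ` X)"
  proof
    fix f assume "f \<in> V"
    then have "f = (\<Sum>x\<in>X. cscale (f x) (unit_fun x))"
      using unit_fun_expansion[OF X] by (auto simp: V)
    also have "\<dots> \<in> cs.span (unit_fun ` X)"
      by (intro cs.span_sum cs.span_scale cs.span_base) auto
    finally show "f \<in> cs.span (unit_fun ` X)" .
  qed
  then have finB: "finite B"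
    using B closed X cs.independent_span_bound[of "unit_fun ` X" B] by blast
  let ?r = "cs.representation B"
  have rep: "P f x = (\<Sum>b\<in>B. ?r (P f) b * b x)" if "f \<in> V" for f x
  proof -
    have "P f = (\<Sum>b\<in>B. cscale (?r (P f) b) b)"
      using cs.sum_representation_eq[OF B(2) _ finB, of "P f"] B(3) that by auto
    then have "P f x = (\<Sum>b\<in>B. cscale (?r (P f) b) b) x" by simp
    also have "\<dots> = (\<Sum>b\<in>B. ?r (P f) b * b x)"
      by (simp only: sum_fun_apply cscale_def)
    finally show ?thesis .
  qed
  have spanP: "P (unit_fun x) \<in> cs.span B" if "x \<in> X" for x
    using B(3) unit_V[OF that] by blast
  have diag: "(\<Sum>x\<in>X. b x * ?r (P (unit_fun x)) b) = 1" if b: "b \<in> B" for b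
  proof -
    obtain f where f: "f \<in> V" "b = P f" using B(1) b by blast
    have bV: "b \<in> V" using f closed by simp
    have "b = (\<Sum>x\<in>X. cscale (b x) (unit_fun x))"
      using bV unit_fun_expansion[OF X, of b] by (auto simp: V)
    then have "P b = P (\<Sum>x\<in>X. cscale (b x) (unit_fun x))" by (rule arg_cong)
    moreover have "P b = b" using f idem by simp
    ultimately have "b = P (\<Sum>x\<in>X. cscale (b x) (unit_fun x))" by simp
    also have "\<dots> = (\<Sum>x\<in>X. cscale (b x) (P (unit_fun x)))"
      by (simp add: P_sum scale)
    finally have "?r b b = ?r (\<Sum>x\<in>X. cscale (b x) (P (unit_fun x))) b" by simp
    also have "\<dots> = (\<Sum>x\<in>X. ?r (cscale (b x) (P (unit_fun x))) b)"
      using spanP by (subst cs.representation_sum[OF B(2)]) (auto intro: cs.span_scale simp: sum_fun_apply)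
    also have "\<dots> = (\<Sum>x\<in>X. b x * ?r (P (unit_fun x)) b)"
      using spanP by (intro sum.cong) (auto simp: cs.representation_scale[OF B(2)])
    finally show ?thesis
      using cs.representation_basis[OF B(2) b] by simp
  qed
  have "(\<Sum>x\<in>X. P (unit_fun x) x) = (\<Sum>x\<in>X. \<Sum>b\<in>B. ?r (P (unit_fun x)) b * b x)"
    using unit_V rep by (intro sum.cong) auto
  also have "\<dots> = (\<Sum>b\<in>B. \<Sum>x\<in>X. b x * ?r (P (unit_fun x)) b)"
    by (subst sum.swap) (simp add: mult.commute)
  also have "\<dots> = of_nat (card B)"
    using diag by simp
  finally show ?thesis using B(4) by simp
qed

subsection \<open>The group algebra of the symmetric group\<close>

lemma Sym_id [simp]: "id \<in> Sym n"
  by (simp add: Sym_def permutes_id)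

lemma Sym_comp [simp]: "g \<in> Sym n \<Longrightarrow> h \<in> Sym n \<Longrightarrow> g \<circ> h \<in> Sym n"
  by (simp add: Sym_def permutes_compose)

lemma Sym_inv [simp]: "g \<in> Sym n \<Longrightarrow> inv g \<in> Sym n"
  by (simp add: Sym_def permutes_inv)

lemma Sym_bij: "g \<in> Sym n \<Longrightarrow> bij g"
  by (auto simp: Sym_def permutes_bij)

lemma Sym_inv_inv [simp]: "g \<in> Sym n \<Longrightarrow> inv (inv g) = g"
  by (simp add: Sym_bij inv_inv_eq)

lemma Sym_inv_comp [simp]: "g \<in> Sym n \<Longrightarrow> inv g \<circ> g = id"
  by (simp add: Sym_bij bij_is_inj)

lemma Sym_comp_inv [simp]: "g \<in> Sym n \<Longrightarrow> g \<circ> inv g = id"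
  by (meson Sym_bij bij_is_surj surj_iff)

lemma Sym_inv_comp' [simp]: "g \<in> Sym n \<Longrightarrow> inv g \<circ> (g \<circ> h) = h"
  by (simp flip: comp_assoc)

lemma Sym_comp_inv' [simp]: "g \<in> Sym n \<Longrightarrow> g \<circ> (inv g \<circ> h) = h"
  by (simp flip: comp_assoc)

lemma inv_id_eq [simp]: "inv id = id"
  by (fact inv_id)

lemma Sym_inv_distrib: "g \<in> Sym n \<Longrightarrow> h \<in> Sym n \<Longrightarrow> inv (g \<circ> h) = inv h \<circ> inv g"
  by (simp add: Sym_bij o_inv_distrib)

lemma Sym_lt [simp]: "g \<in> Sym n \<Longrightarrow> k < n \<Longrightarrow> g k < n"
  using permutes_in_image[of g "{0..<n}" k] by (auto simp: Sym_def)

lemma Sym_ge: "g \<in> Sym n \<Longrightarrow> \<not> k < n \<Longrightarrow> g k = k"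
  by (auto simp: Sym_def permutes_not_in)

lemma Sym_inv_apply [simp]: "g \<in> Sym n \<Longrightarrow> g (inv g k) = k" "g \<in> Sym n \<Longrightarrow> inv g (g k) = k"
  by (auto simp: Sym_def permutes_inverses)

lemma finite_Sym [simp]: "finite (Sym n)"
  by (simp add: Sym_def finite_permutations)

lemma card_Sym: "card (Sym n) = fact n"
  by (simp add: Sym_def card_permutations)

lemma Sym_permutation: "g \<in> Sym n \<Longrightarrow> permutation g"
  by (auto simp: Sym_def permutation_permutes)

lemma Sym_sign_comp: "g \<in> Sym n \<Longrightarrow> h \<in> Sym n \<Longrightarrow> sign (g \<circ> h) = sign g * sign h"
  by (simp add: Sym_permutation sign_compose)

lemma Sym_sign_inv [simp]: "g \<in> Sym n \<Longrightarrow> sign (inv g) = sign g"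
  by (simp add: Sym_permutation sign_inverse)

lemma Sym_transpose [simp]: "x < n \<Longrightarrow> y < n \<Longrightarrow> transpose x y \<in> Sym n"
  by (simp add: Sym_def permutes_swap_id)

lemma Sym_ext: "g \<in> Sym n \<Longrightarrow> h \<in> Sym n \<Longrightarrow> (\<And>k. k < n \<Longrightarrow> g k = h k) \<Longrightarrow> g = h"
  by (metis Sym_ge ext)

lemma sum_Sym_left: "g \<in> Sym n \<Longrightarrow> (\<Sum>t\<in>Sym n. f (g \<circ> t)) = (\<Sum>t\<in>Sym n. f t)"
  by (rule sum.reindex_bij_witness[of _ "\<lambda>t. inv g \<circ> t" "\<lambda>t. g \<circ> t"]) auto

lemma sum_Sym_right: "g \<in> Sym n \<Longrightarrow> (\<Sum>t\<in>Sym n. f (t \<circ> g)) = (\<Sum>t\<in>Sym n. f t)"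
  by (rule sum.reindex_bij_witness[of _ "\<lambda>t. t \<circ> inv g" "\<lambda>t. t \<circ> g"]) (auto simp: comp_assoc)

lemma sum_Sym_inv: "(\<Sum>t\<in>Sym n. f (inv t)) = (\<Sum>t\<in>Sym n. f t)"
  by (rule sum.reindex_bij_witness[of _ inv inv]) auto

lemma delta_eq_unit_fun: "delta = unit_fun"
  by (simp add: fun_eq_iff delta_def unit_fun_def)

locale group_algebra =
  fixes n :: nat
begin

abbreviation mult (infixl "\<star>" 70) where "a \<star> b \<equiv> galg_mult n a b"
abbreviation tau :: "((nat \<Rightarrow> nat) \<Rightarrow> complex) \<Rightarrow> complex" where "tau a \<equiv> a id"

lemma mult_apply: "(a \<star> b) s = (if s \<in> Sym n then \<Sum>t\<in>Sym n. a t * b (inv t \<circ> s) else 0)"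
  by (simp add: galg_mult_def)

lemma mult_galg [simp]: "a \<star> b \<in> galg n"
  by (simp add: galg_def mult_apply)

lemma galg_ext: "a \<in> galg n \<Longrightarrow> b \<in> galg n \<Longrightarrow> (\<And>s. s \<in> Sym n \<Longrightarrow> a s = b s) \<Longrightarrow> a = b"
  by (force simp: galg_def)

lemma mult_assoc: "(a \<star> b) \<star> c = a \<star> (b \<star> c)"
proof (rule galg_ext)
  fix s assume s: "s \<in> Sym n"
  have "((a \<star> b) \<star> c) s = (\<Sum>t\<in>Sym n. \<Sum>u\<in>Sym n. a u * b (inv u \<circ> t) * c (inv t \<circ> s))"
    using s by (auto simp: mult_apply sum_distrib_right intro!: sum.cong)
  also have "\<dots> = (\<Sum>u\<in>Sym n. \<Sum>t\<in>Sym n. a u * b (inv u \<circ> t) * c (inv t \<circ> s))"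
    by (rule sum.swap)
  also have "\<dots> = (\<Sum>u\<in>Sym n. \<Sum>t\<in>Sym n. a u * b (inv u \<circ> (u \<circ> t)) * c (inv (u \<circ> t) \<circ> s))"
    by (intro sum.cong refl sum_Sym_left[symmetric])
  also have "\<dots> = (a \<star> (b \<star> c)) s"
    using s by (auto simp: mult_apply sum_distrib_left Sym_inv_distrib comp_assoc mult.assoc intro!: sum.cong)
  finally show "((a \<star> b) \<star> c) s = (a \<star> (b \<star> c)) s" .
qed simp_all

lemma mult_add_left: "(a + b) \<star> c = a \<star> c + b \<star> c"
  by (simp add: fun_eq_iff mult_apply distrib_right sum.distrib)

lemma mult_add_right: "a \<star> (b + c) = a \<star> b + a \<star> c"
  by (simp add: fun_eq_iff mult_apply distrib_left sum.distrib)

lemma mult_diff_left: "(a - b) \<star> c = a \<star> c - b \<star> c"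
  by (simp add: fun_eq_iff mult_apply left_diff_distrib sum_subtractf)

lemma mult_diff_right: "a \<star> (b - c) = a \<star> b - a \<star> c"
  by (simp add: fun_eq_iff mult_apply right_diff_distrib sum_subtractf)

lemma mult_scale_left: "cscale r a \<star> b = cscale r (a \<star> b)"
  by (simp add: fun_eq_iff mult_apply cscale_def sum_distrib_left mult.assoc)

lemma mult_scale_right: "a \<star> cscale r b = cscale r (a \<star> b)"
  by (simp add: fun_eq_iff mult_apply cscale_def sum_distrib_left mult.left_commute)

lemma mult_zero_left [simp]: "0 \<star> a = 0"
  by (simp add: fun_eq_iff mult_apply)

lemma mult_zero_right [simp]: "a \<star> 0 = 0"
  by (simp add: fun_eq_iff mult_apply)

lemma mult_sum_left: "(\<Sum>i\<in>I. f i) \<star> a = (\<Sum>i\<in>I. f i \<star> a)"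
  by (induction I rule: infinite_finite_induct)
    (simp_all only: sum.infinite sum.empty sum.insert mult_add_left mult_zero_left not_False_eq_True)

lemma mult_sum_right: "a \<star> (\<Sum>i\<in>I. f i) = (\<Sum>i\<in>I. a \<star> f i)"
  by (induction I rule: infinite_finite_induct)
    (simp_all only: sum.infinite sum.empty sum.insert mult_add_right mult_zero_right not_False_eq_True)

lemma delta_galg [simp]: "g \<in> Sym n \<Longrightarrow> delta g \<in> galg n"
  by (auto simp: galg_def delta_def)

lemma delta_mult: "g \<in> Sym n \<Longrightarrow> (delta g \<star> x) s = (if s \<in> Sym n then x (inv g \<circ> s) else 0)"
  by (simp add: mult_apply delta_def if_distrib[of "\<lambda>z. z * _"] sum.delta cong: if_cong)

lemma mult_delta: "g \<in> Sym n \<Longrightarrow> (x \<star> delta g) s = (if s \<in> Sym n then x (s \<circ> inv g) else 0)"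
proof -
  assume g: "g \<in> Sym n"
  have eq: "inv t \<circ> s = g \<longleftrightarrow> t = s \<circ> inv g" if "s \<in> Sym n" "t \<in> Sym n" for t
  proof
    assume "inv t \<circ> s = g"
    then have "t \<circ> (inv t \<circ> s) \<circ> inv g = t \<circ> g \<circ> inv g" by simp
    then show "t = s \<circ> inv g" using that g by (simp add: comp_assoc)
  next
    assume "t = s \<circ> inv g"
    then show "inv t \<circ> s = g" using that g by (simp add: Sym_inv_distrib comp_assoc)
  qed
  have "(\<Sum>t\<in>Sym n. x t * delta g (inv t \<circ> s)) = (\<Sum>t\<in>Sym n. if t = s \<circ> inv g then x t else 0)"
    if "s \<in> Sym n"
    using eq[OF that] by (intro sum.cong) (auto simp: delta_def)
  then show ?thesis using g by (auto simp: mult_apply)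
qed

lemma delta_delta: "g \<in> Sym n \<Longrightarrow> h \<in> Sym n \<Longrightarrow> delta g \<star> delta h = delta (g \<circ> h)"
proof (rule galg_ext)
  fix s assume *: "g \<in> Sym n" "h \<in> Sym n" "s \<in> Sym n"
  then have "s \<circ> inv h = g \<longleftrightarrow> s = g \<circ> h"
    by (metis Sym_comp_inv Sym_inv_comp comp_assoc comp_id)
  then show "(delta g \<star> delta h) s = delta (g \<circ> h) s"
    using * by (simp only: mult_delta if_True) (simp add: delta_def)
qed simp_all

lemma delta_id_left: "x \<in> galg n \<Longrightarrow> delta id \<star> x = x"
  by (rule galg_ext) (auto simp: delta_mult)

lemma delta_id_right: "x \<in> galg n \<Longrightarrow> x \<star> delta id = x"
  by (rule galg_ext) (auto simp: mult_delta)

lemma tau_mult: "tau (a \<star> b) = (\<Sum>t\<in>Sym n. a t * b (inv t))"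
  by (simp add: mult_apply)

lemma tau_mult_comm: "tau (a \<star> b) = tau (b \<star> a)"
  unfolding tau_mult by (subst sum_Sym_inv[symmetric]) (auto simp: mult.commute intro!: sum.cong)

lemma galg_expansion: "x \<in> galg n \<Longrightarrow> x = (\<Sum>g\<in>Sym n. cscale (x g) (delta g))"
  unfolding delta_eq_unit_fun by (rule unit_fun_expansion) (auto simp: galg_def)

lemma galg_add [simp]: "a \<in> galg n \<Longrightarrow> b \<in> galg n \<Longrightarrow> a + b \<in> galg n"
  and galg_diff [simp]: "a \<in> galg n \<Longrightarrow> b \<in> galg n \<Longrightarrow> a - b \<in> galg n"
  and galg_uminus [simp]: "a \<in> galg n \<Longrightarrow> - a \<in> galg n"
  and galg_zero [simp]: "0 \<in> galg n"
  and galg_scale [simp]: "a \<in> galg n \<Longrightarrow> cscale r a \<in> galg n"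
  by (auto simp: galg_def cscale_def)

lemma galg_sum [simp]: "(\<And>i. i \<in> I \<Longrightarrow> f i \<in> galg n) \<Longrightarrow> (\<Sum>i\<in>I. f i) \<in> galg n"
  by (auto simp: galg_def sum_fun_apply)

text \<open>The trace of left multiplication by \<open>x\<close> on the group algebra is \<open>n! tau x\<close>, so for an
  idempotent it is the dimension of the right ideal that \<open>x\<close> generates.\<close>
lemma tau_idempotent:
  assumes "x \<star> x = x"
  shows "\<exists>d::nat. fact n * tau x = of_nat d"
proof -
  have "of_nat (cs.dim (galg_mult n x ` galg n)) = (\<Sum>g\<in>Sym n. (x \<star> unit_fun g) g)"
    by (rule dim_range_idempotent)
      (auto simp: galg_def[of n] mult_add_right mult_scale_right mult_assoc[symmetric] assms mult_apply)
  also have "\<dots> = (\<Sum>g\<in>Sym n. tau x)"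
    by (intro sum.cong refl) (simp flip: delta_eq_unit_fun add: mult_delta)
  also have "\<dots> = fact n * tau x"
    by (simp add: card_Sym)
  finally show ?thesis by metis
qed

end

subsection \<open>Tableaux and Young symmetrizers\<close>

text \<open>Diagrams are given by row-length functions padded with zeros, so that adding or removing
  a box is a function update. A tableau is a map from entries to cells, the inverse of a filling;
  permutations of the entries act on it by composition on the right.\<close>

definition diag :: "(nat \<Rightarrow> nat) \<Rightarrow> (nat \<times> nat) set" where
  "diag L = {(i, j). j < L i}"

lemma relabel:
  assumes "bij_betw T {..<n} D" "bij_betw T' {..<n} D"
  obtains g where "g \<in> Sym n" "\<And>k. k < n \<Longrightarrow> T (g k) = T' k"
proof
  define g where "g = (\<lambda>k. if k < n then inv_into {..<n} T (T' k) else k)"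
  have "bij_betw (inv_into {..<n} T \<circ> T') {..<n} {..<n}"
    using assms by (auto intro: bij_betw_trans bij_betw_inv_into)
  then have "bij_betw g {..<n} {..<n}"
    by (rule bij_betw_cong[THEN iffD1, rotated]) (simp add: g_def)
  then have "g permutes {..<n}"
    by (rule bij_imp_permutes) (simp add: g_def)
  then show "g \<in> Sym n" by (simp add: Sym_def atLeast0LessThan)
  show "T (g k) = T' k" if "k < n" for k
    using assms that by (auto simp: g_def bij_betw_def intro!: f_inv_into_f)
qed

text \<open>The transposition of two such entries lies both in the row group of \<open>T\<close> and
  in the column group of \<open>T'\<close>, where it has sign -1. Every vanishing statement about
  symmetrizers below comes from such a pair.\<close>

definition row_col_clash :: "nat \<Rightarrow> (nat \<Rightarrow> nat \<times> nat) \<Rightarrow> (nat \<Rightarrow> nat \<times> nat) \<Rightarrow> bool" where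
  "row_col_clash n T T' \<longleftrightarrow>
    (\<exists>x<n. \<exists>y<n. x \<noteq> y \<and> fst (T x) = fst (T y) \<and> snd (T' x) = snd (T' y))"

lemma row_card:
  assumes T: "bij_betw T {..<n} (diag L)"
  shows "card {x. x < n \<and> fst (T x) = i} = L i"
proof -
  have "T ` {x. x < n \<and> fst (T x) = i} = {c \<in> T ` {..<n}. fst c = i}" by auto
  also have "\<dots> = {i} \<times> {..<L i}" using T by (auto simp: bij_betw_def diag_def)
  finally have "bij_betw T {x. x < n \<and> fst (T x) = i} ({i} \<times> {..<L i})"
    by (intro bij_betw_subset[OF T]) auto
  then show ?thesis by (simp add: bij_betw_same_card)
qed

text \<open>Without a clash the cells \<open>(row in T, column in T')\<close> are distinct; comparing columns shows
  that each row of this configuration fits below the corresponding row of \<open>M\<close>.\<close>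
lemma no_clash_row:
  assumes T: "bij_betw T {..<n} (diag L)" and T': "bij_betw T' {..<n} (diag M)" and M: "decseq M"
    and nc: "\<not> row_col_clash n T T'"
  shows "(\<And>i'. i' < i \<Longrightarrow> L i' = M i') \<Longrightarrow>
    (\<lambda>x. snd (T' x)) ` {x. x < n \<and> fst (T x) = i} \<subseteq> {..<M i} \<and>
    card ((\<lambda>x. snd (T' x)) ` {x. x < n \<and> fst (T x) = i}) = L i"
proof (induction i rule: less_induct)
  case (less i)
  define S where "S = (\<lambda>i. (\<lambda>x. snd (T' x)) ` {x. x < n \<and> fst (T x) = i})"
  have card_S: "card (S i) = L i" for i
  proof -
    have "inj_on (\<lambda>x. snd (T' x)) {x. x < n \<and> fst (T x) = i}"
    proof (rule inj_onI, rule ccontr)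
      fix x y assume "x \<in> {x. x < n \<and> fst (T x) = i}" "y \<in> {x. x < n \<and> fst (T x) = i}"
        "snd (T' x) = snd (T' y)" "x \<noteq> y"
      then have "x < n \<and> y < n \<and> x \<noteq> y \<and> fst (T x) = fst (T y) \<and> snd (T' x) = snd (T' y)"
        by simp
      with nc show False unfolding row_col_clash_def by blast
    qed
    then show ?thesis unfolding S_def using row_card[OF T, of i] by (simp add: card_image)
  qed
  have S_eq: "S i' = {..<M i'}" if "i' < i" for i'
  proof (rule card_subset_eq)
    have "\<And>i''. i'' < i' \<Longrightarrow> L i'' = M i''" using less.prems that by simp
    then show "S i' \<subseteq> {..<M i'}" using less.IH[OF that] unfolding S_def by blast
    show "card (S i') = card {..<M i'}" using card_S less.prems[OF that] by simp
  qed simp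
  \<comment> \<open>A column index \<open>j\<close> outside \<open>{..<M i}\<close> would overfill
    column \<open>j\<close> of \<open>T'\<close>: each earlier row \<open>i'\<close> with
    \<open>j < M i'\<close> contains an entry of that column, because \<open>S i'\<close> is all of
    \<open>{..<M i'}\<close>, and row \<open>i\<close> contains one more. The column has only as
    many cells as there are rows with \<open>j < M i'\<close>.\<close>
  have "S i \<subseteq> {..<M i}"
  proof (rule ccontr)
    assume "\<not> S i \<subseteq> {..<M i}"
    then obtain x where x: "x < n" "fst (T x) = i" "\<not> snd (T' x) < M i"
      unfolding S_def by auto
    define j where "j = snd (T' x)"
    define C where "C = {y. y < n \<and> snd (T' y) = j}"
    have rows_lt: "i' < i" if "j < M i'" for i'
    proof (rule ccontr)
      assume "\<not> i' < i"
      then have "M i' \<le> M i" by (intro decseqD[OF M]) simp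
      with x that show False by (simp add: j_def)
    qed
    have "(fst \<circ> T') ` C \<subseteq> {i'. j < M i'}"
    proof clarify
      fix y assume "y \<in> C"
      then have "T' y \<in> diag M" "snd (T' y) = j" using T' by (auto simp: C_def bij_betw_def)
      then show "j < M ((fst \<circ> T') y)" by (auto simp: diag_def)
    qed
    moreover have "inj_on (fst \<circ> T') C"
    proof (rule inj_onI)
      fix y z assume "y \<in> C" "z \<in> C" "(fst \<circ> T') y = (fst \<circ> T') z"
      then have "T' y = T' z" "y < n" "z < n" by (auto simp: C_def prod_eq_iff)
      then show "y = z" using T' by (auto simp: bij_betw_def dest: inj_onD)
    qed
    moreover have fin: "finite {i'. j < M i'}"
      using rows_lt by (auto intro: finite_subset[of _ "{..<i}"])
    ultimately have "card C \<le> card {i'. j < M i'}"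
      by (intro card_inj_on_le[of "fst \<circ> T'"])
    also have "\<dots> < card (insert i {i'. j < M i'})"
      using fin rows_lt[of i] by (subst card_insert_disjoint) auto
    also have "\<dots> \<le> card ((fst \<circ> T) ` C)"
    proof (rule card_mono)
      show "insert i {i'. j < M i'} \<subseteq> (fst \<circ> T) ` C"
      proof
        fix i' assume "i' \<in> insert i {i'. j < M i'}"
        then consider "i' = i" | "j < M i'" by blast
        then have "j \<in> S i'"
        proof cases
          case 1
          then show ?thesis using x(1,2) unfolding S_def j_def by blast
        next
          case 2
          then show ?thesis using S_eq[OF rows_lt[OF 2]] by simp
        qed
        then obtain y where "y < n" "fst (T y) = i'" "snd (T' y) = j" unfolding S_def by blast
        then show "i' \<in> (fst \<circ> T) ` C" unfolding C_def by force
      qed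
    qed (simp add: C_def)
    also have "\<dots> \<le> card C" by (rule card_image_le) (simp add: C_def)
    finally show False by simp
  qed
  with card_S show ?case by (simp add: S_def)
qed

text \<open>Without a clash, row \<open>i\<close> of \<open>T\<close> would supply
  \<open>L i\<close> distinct columns inside the smaller set \<open>{..<M i}\<close>.\<close>

lemma clash_if_lex_greater:
  assumes "bij_betw T {..<n} (diag L)" "bij_betw T' {..<n} (diag M)" "decseq M"
    and "\<And>i'. i' < i \<Longrightarrow> L i' = M i'" "M i < L i"
  shows "row_col_clash n T T'"
proof (rule ccontr)
  assume "\<not> row_col_clash n T T'"
  from no_clash_row[OF assms(1-3) this assms(4), of i] assms(5) show False
    by (metis card_lessThan card_mono finite_lessThan not_le)
qed

text \<open>This is the intermediate tableau of the combinatorial lemma behind Young symmetrizers: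
  it is reached from \<open>T\<close> by moving entries within rows, and from \<open>T'\<close> by
  moving them within columns.\<close>

lemma no_clash_bij:
  assumes T: "bij_betw T {..<n} (diag L)" and T': "bij_betw T' {..<n} (diag L)" and L: "decseq L"
    and nc: "\<not> row_col_clash n T T'"
  shows "bij_betw (\<lambda>x. (fst (T x), snd (T' x))) {..<n} (diag L)"
proof -
  let ?U = "\<lambda>x. (fst (T x), snd (T' x))"
  have inj: "inj_on ?U {..<n}" using nc by (auto simp: inj_on_def row_col_clash_def)
  have "?U ` {..<n} \<subseteq> diag L"
    using no_clash_row[OF T T' L nc] by (auto simp: diag_def)
  moreover have "finite (diag L)" using T bij_betw_finite by blast
  moreover have "card (?U ` {..<n}) = card (diag L)"
    using bij_betw_same_card[OF T] card_image[OF inj] by simp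
  ultimately have "?U ` {..<n} = diag L" by (metis card_subset_eq)
  with inj show ?thesis by (simp add: bij_betw_def)
qed

section \<open>Row and column groups and their signed sums\<close>

context group_algebra
begin

definition row_grp :: "(nat \<Rightarrow> nat \<times> nat) \<Rightarrow> (nat \<Rightarrow> nat) set" where
  "row_grp T = {s \<in> Sym n. \<forall>k<n. fst (T (s k)) = fst (T k)}"

definition col_grp :: "(nat \<Rightarrow> nat \<times> nat) \<Rightarrow> (nat \<Rightarrow> nat) set" where
  "col_grp T = {s \<in> Sym n. \<forall>k<n. snd (T (s k)) = snd (T k)}"

definition row_sum :: "(nat \<Rightarrow> nat \<times> nat) \<Rightarrow> (nat \<Rightarrow> nat) \<Rightarrow> complex" where
  "row_sum T s = (if s \<in> row_grp T then 1 else 0)"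

definition col_sum :: "(nat \<Rightarrow> nat \<times> nat) \<Rightarrow> (nat \<Rightarrow> nat) \<Rightarrow> complex" where
  "col_sum T s = (if s \<in> col_grp T then of_int (sign s) else 0)"

definition csym :: "(nat \<Rightarrow> nat \<times> nat) \<Rightarrow> (nat \<Rightarrow> nat) \<Rightarrow> complex" where
  "csym T = row_sum T \<star> col_sum T"

lemma row_grp_Sym: "s \<in> row_grp T \<Longrightarrow> s \<in> Sym n"
  and col_grp_Sym: "s \<in> col_grp T \<Longrightarrow> s \<in> Sym n"
  by (simp_all add: row_grp_def col_grp_def)

lemma row_grp_id [simp]: "id \<in> row_grp T"
  and row_grp_comp: "s \<in> row_grp T \<Longrightarrow> t \<in> row_grp T \<Longrightarrow> s \<circ> t \<in> row_grp T"
  and row_grp_inv: "s \<in> row_grp T \<Longrightarrow> inv s \<in> row_grp T"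
  by (auto simp: row_grp_def) (metis Sym_inv Sym_inv_apply(1) Sym_lt)

lemma col_grp_id [simp]: "id \<in> col_grp T"
  and col_grp_comp: "s \<in> col_grp T \<Longrightarrow> t \<in> col_grp T \<Longrightarrow> s \<circ> t \<in> col_grp T"
  and col_grp_inv: "s \<in> col_grp T \<Longrightarrow> inv s \<in> col_grp T"
  by (auto simp: col_grp_def) (metis Sym_inv Sym_inv_apply(1) Sym_lt)

lemma row_sum_galg [simp]: "row_sum T \<in> galg n"
  and col_sum_galg [simp]: "col_sum T \<in> galg n"
  and csym_galg [simp]: "csym T \<in> galg n"
  by (auto simp: galg_def row_sum_def col_sum_def csym_def row_grp_Sym col_grp_Sym mult_apply)

lemma finite_row_grp [simp]: "finite (row_grp T)" and finite_col_grp [simp]: "finite (col_grp T)"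
  by (simp_all add: row_grp_def col_grp_def)

lemma row_grp_comp_iff:
  assumes "p \<in> row_grp T" "s \<in> Sym n"
  shows "p \<circ> s \<in> row_grp T \<longleftrightarrow> s \<in> row_grp T" "s \<circ> p \<in> row_grp T \<longleftrightarrow> s \<in> row_grp T"
proof -
  have p: "p \<in> Sym n" using assms row_grp_Sym by blast
  show "p \<circ> s \<in> row_grp T \<longleftrightarrow> s \<in> row_grp T"
    using row_grp_comp[OF assms(1), of s] row_grp_comp[OF row_grp_inv[OF assms(1)], of "p \<circ> s"] p by auto
  show "s \<circ> p \<in> row_grp T \<longleftrightarrow> s \<in> row_grp T"
    using row_grp_comp[OF _ assms(1), of s] row_grp_comp[OF _ row_grp_inv[OF assms(1)], of "s \<circ> p"] p
    by (auto simp: comp_assoc)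
qed

lemma col_grp_comp_iff:
  assumes "p \<in> col_grp T" "s \<in> Sym n"
  shows "p \<circ> s \<in> col_grp T \<longleftrightarrow> s \<in> col_grp T"
proof -
  have p: "p \<in> Sym n" using assms col_grp_Sym by blast
  show ?thesis
    using col_grp_comp[OF assms(1), of s] col_grp_comp[OF col_grp_inv[OF assms(1)], of "p \<circ> s"] p by auto
qed

lemma delta_row_sum: "p \<in> row_grp T \<Longrightarrow> delta p \<star> row_sum T = row_sum T"
  by (rule galg_ext)
    (auto simp: delta_mult row_grp_Sym row_sum_def row_grp_comp_iff row_grp_inv)

lemma row_sum_delta: "p \<in> row_grp T \<Longrightarrow> row_sum T \<star> delta p = row_sum T"
  by (rule galg_ext)
    (auto simp: mult_delta row_grp_Sym row_sum_def row_grp_comp_iff row_grp_inv)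

lemma delta_col_sum: "q \<in> col_grp T \<Longrightarrow> delta q \<star> col_sum T = cscale (of_int (sign q)) (col_sum T)"
proof (rule galg_ext)
  fix s assume q: "q \<in> col_grp T" and s: "s \<in> Sym n"
  note q' = col_grp_Sym[OF q]
  have "sign (inv q \<circ> s) = sign q * sign s"
    using Sym_sign_comp[OF Sym_inv[OF q'] s] Sym_sign_inv[OF q'] by simp
  then show "(delta q \<star> col_sum T) s = cscale (of_int (sign q)) (col_sum T) s"
    using s q' col_grp_comp_iff[OF col_grp_inv[OF q] s]
    by (simp add: delta_mult col_sum_def cscale_def)
qed simp_all

lemma conj_row_sum:
  assumes g: "g \<in> Sym n"
  shows "delta g \<star> row_sum T \<star> delta (inv g) = row_sum (T \<circ> inv g)"
proof (rule galg_ext)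
  fix s assume s: "s \<in> Sym n"
  have "(inv g \<circ> (s \<circ> g) \<in> row_grp T) \<longleftrightarrow> (s \<in> row_grp (T \<circ> inv g))"
    using g s by (auto simp: row_grp_def) (metis Sym_inv Sym_inv_apply(1) Sym_lt)
  then show "(delta g \<star> row_sum T \<star> delta (inv g)) s = row_sum (T \<circ> inv g) s"
    using g s by (simp add: mult_delta delta_mult row_sum_def)
qed simp_all

lemma conj_col_sum:
  assumes g: "g \<in> Sym n"
  shows "delta g \<star> col_sum T \<star> delta (inv g) = col_sum (T \<circ> inv g)"
proof (rule galg_ext)
  fix s assume s: "s \<in> Sym n"
  have "(inv g \<circ> (s \<circ> g) \<in> col_grp T) \<longleftrightarrow> (s \<in> col_grp (T \<circ> inv g))"
    using g s by (auto simp: col_grp_def) (metis Sym_inv Sym_inv_apply(1) Sym_lt)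
  moreover have "sign (inv g \<circ> (s \<circ> g)) = sign s"
  proof -
    have "sign (inv g \<circ> (s \<circ> g)) = sign g * (sign s * sign g)"
      by (simp only: Sym_sign_comp[OF Sym_inv[OF g] Sym_comp[OF s g]] Sym_sign_comp[OF s g] Sym_sign_inv[OF g])
    also have "\<dots> = sign s * (sign g * sign g)" by (simp only: ac_simps)
    finally show ?thesis by (simp add: sign_idempotent)
  qed
  ultimately show "(delta g \<star> col_sum T \<star> delta (inv g)) s = col_sum (T \<circ> inv g) s"
    using g s by (simp add: mult_delta delta_mult col_sum_def)
qed simp_all

lemma delta_inv_delta: "g \<in> Sym n \<Longrightarrow> x \<in> galg n \<Longrightarrow> delta (inv g) \<star> (delta g \<star> x) = x"
  by (simp add: mult_assoc[symmetric] delta_delta delta_id_left)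

lemma conj_csym:
  assumes g: "g \<in> Sym n"
  shows "delta g \<star> csym T \<star> delta (inv g) = csym (T \<circ> inv g)"
proof -
  have "csym (T \<circ> inv g) = delta g \<star> (row_sum T \<star> (delta (inv g) \<star> (delta g \<star> (col_sum T \<star> delta (inv g)))))"
    using g by (simp add: csym_def mult_assoc flip: conj_row_sum conj_col_sum)
  then show ?thesis
    using g by (simp add: delta_inv_delta csym_def mult_assoc)
qed

lemma csym_cong:
  assumes "\<And>k. k < n \<Longrightarrow> T k = T' k"
  shows "csym T = csym T'" "row_sum T = row_sum T'" "col_sum T = col_sum T'"
proof -
  have "row_grp T = row_grp T'" "col_grp T = col_grp T'"
    using assms by (auto simp: row_grp_def col_grp_def)
  then show "csym T = csym T'" "row_sum T = row_sum T'" "col_sum T = col_sum T'"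
    by (simp_all add: csym_def row_sum_def[abs_def] col_sum_def[abs_def])
qed

lemma clash_transposition:
  assumes "row_col_clash n T T'"
  obtains t where "t \<in> row_grp T" "t \<in> col_grp T'" "sign t = -1"
proof -
  obtain x y where *: "x < n" "y < n" "x \<noteq> y" "fst (T x) = fst (T y)" "snd (T' x) = snd (T' y)"
    using assms by (auto simp: row_col_clash_def)
  show thesis
    by (rule that[of "transpose x y"])
      (use * in \<open>auto simp: row_grp_def col_grp_def transpose_def sign_swap_id\<close>)
qed

lemma eq_neg_imp_zero:
  fixes u :: "'a \<Rightarrow> complex"
  assumes "u = cscale (-1) u"
  shows "u = 0"
proof
  fix x show "u x = 0 x" using fun_cong[OF assms, of x] by (simp add: cscale_def)
qed

text \<open>The common odd transposition can be inserted between the two factors: the row sum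
  absorbs it, the column sum changes sign, and the product equals its own negative.\<close>

lemma clash_zero:
  assumes "row_col_clash n T T'"
  shows "row_sum T \<star> col_sum T' = 0" "col_sum T' \<star> row_sum T = 0"
proof -
  obtain t where t: "t \<in> row_grp T" "t \<in> col_grp T'" "sign t = -1"
    using clash_transposition[OF assms] .
  have "row_sum T \<star> col_sum T' = row_sum T \<star> delta t \<star> col_sum T'"
    using t by (simp add: row_sum_delta)
  also have "\<dots> = cscale (-1) (row_sum T \<star> col_sum T')"
    by (simp only: mult_assoc delta_col_sum[OF t(2)] t(3) mult_scale_right of_int_minus of_int_1)
  finally show "row_sum T \<star> col_sum T' = 0" by (rule eq_neg_imp_zero)
  have "col_sum T' \<star> delta t = cscale (-1) (col_sum T')"
  proof (rule galg_ext)
    fix s assume s: "s \<in> Sym n"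
    have "s \<circ> inv t \<in> col_grp T' \<longleftrightarrow> s \<in> col_grp T'"
    proof -
      have "s \<circ> inv t \<circ> t = s" using col_grp_Sym[OF t(2)] by (simp add: comp_assoc)
      then show ?thesis
        using t(2) col_grp_comp[of s T' "inv t"] col_grp_comp[of "s \<circ> inv t" T' t] col_grp_inv[OF t(2)]
        by auto
    qed
    moreover have "sign (s \<circ> inv t) = - sign s"
      using Sym_sign_comp[OF s Sym_inv[OF col_grp_Sym[OF t(2)]]] Sym_sign_inv[OF col_grp_Sym[OF t(2)]] t(3)
      by simp
    ultimately show "(col_sum T' \<star> delta t) s = cscale (-1) (col_sum T') s"
      using s col_grp_Sym[OF t(2)] by (simp add: mult_delta col_sum_def cscale_def)
  qed simp_all
  then have "col_sum T' \<star> (delta t \<star> row_sum T) = cscale (-1) (col_sum T' \<star> row_sum T)"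
    by (simp only: mult_assoc[symmetric] mult_scale_left)
  then show "col_sum T' \<star> row_sum T = 0"
    using t by (intro eq_neg_imp_zero) (simp add: delta_row_sum)
qed

text \<open>A permutation that preserves both the row and the column of every entry fixes every
  cell, hence is the identity by injectivity of \<open>T\<close>. So only one pair of factors
  multiplies to \<open>id\<close>.\<close>

lemma tau_csym:
  assumes "inj_on T {..<n}"
  shows "tau (csym T) = 1"
proof -
  have "t = id" if "t \<in> row_grp T" "inv t \<in> col_grp T" for t
  proof (rule Sym_ext[of _ n])
    have t: "t \<in> col_grp T" "t \<in> Sym n" using that row_grp_Sym[of t T] col_grp_inv[of "inv t" T] by auto
    show "t k = id k" if "k < n" for k
      using that t \<open>t \<in> row_grp T\<close> assms
      by (intro inj_onD[OF assms]) (auto simp: row_grp_def col_grp_def prod_eq_iff)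
  qed (use that row_grp_Sym in auto)
  then have "tau (csym T) = (\<Sum>t\<in>Sym n. if t = id then 1 else 0)"
    unfolding csym_def tau_mult by (intro sum.cong) (auto simp: row_sum_def col_sum_def sign_id)
  then show ?thesis by (simp add: sum.delta)
qed

end

subsection \<open>Central idempotents\<close>

context group_algebra
begin

text \<open>Compare \<open>T\<close> with its relabelling by \<open>g\<close>. A clash kills the
  product; otherwise \<open>g\<close> is a row permutation times a column permutation of
  \<open>T\<close>, and these are absorbed up to a sign.\<close>

lemma row_delta_col:
  assumes T: "bij_betw T {..<n} (diag L)" and L: "decseq L" and g: "g \<in> Sym n"
  shows "\<exists>l. row_sum T \<star> delta g \<star> col_sum T = cscale l (csym T)"
proof -
  define T' where "T' = T \<circ> inv g"
  have T': "bij_betw T' {..<n} (diag L)"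
    unfolding T'_def
    by (rule bij_betw_trans[OF permutes_imp_bij T])
      (use g in \<open>simp add: Sym_def permutes_inv flip: atLeast0LessThan\<close>)
  show ?thesis
  proof (cases "row_col_clash n T T'")
    case True
    have "delta g \<star> col_sum T = col_sum T' \<star> delta g"
      unfolding T'_def conj_col_sum[OF g, symmetric]
      using g by (simp add: mult_assoc delta_delta delta_id_right)
    then have "row_sum T \<star> delta g \<star> col_sum T = row_sum T \<star> col_sum T' \<star> delta g"
      by (simp add: mult_assoc)
    then have "row_sum T \<star> delta g \<star> col_sum T = cscale 0 (csym T)"
      by (simp only: clash_zero(1)[OF True] mult_zero_left cs.scale_zero_left)
    then show ?thesis ..
  next
    case False
    note U = no_clash_bij[OF T T' L False]
    \<comment> \<open>Both \<open>T \<circ> p\<close> and \<open>T' \<circ> q\<close> are the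
      intermediate tableau, so \<open>p = inv g \<circ> q\<close>. Here \<open>p\<close> preserves
      the rows of \<open>T\<close> and \<open>q\<close> the columns of \<open>T'\<close>;
      conjugating \<open>q\<close> by \<open>g\<close> gives a column permutation of
      \<open>T\<close>, and \<open>g = inv p \<circ> (inv g \<circ> q \<circ> g)\<close> is the
      wanted factorization.\<close>
    obtain p where p: "p \<in> Sym n" "\<And>k. k < n \<Longrightarrow> T (p k) = (fst (T k), snd (T' k))"
      using relabel[OF T U] by metis
    obtain q where q: "q \<in> Sym n" "\<And>k. k < n \<Longrightarrow> T' (q k) = (fst (T k), snd (T' k))"
      using relabel[OF T' U] by metis
    have pq: "p = inv g \<circ> q"
    proof (rule Sym_ext[of _ n])
      show "p k = (inv g \<circ> q) k" if "k < n" for k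
      proof (rule inj_onD[OF bij_betw_imp_inj_on[OF T]])
        show "T (p k) = T ((inv g \<circ> q) k)" using p(2)[OF that] q(2)[OF that] by (simp add: T'_def)
      qed (use p q g that in auto)
    qed (use p q g in auto)
    have p_row: "p \<in> row_grp T" using p by (simp add: row_grp_def)
    have "snd (T' (q k)) = snd (T' k)" if "k < n" for k using q(2) that by simp
    then have "snd (T' (q (g k))) = snd (T' (g k))" if "k < n" for k using that g by simp
    then have "inv g \<circ> q \<circ> g \<in> col_grp T"
      using g q by (simp add: col_grp_def T'_def)
    moreover have "g = inv p \<circ> (inv g \<circ> q \<circ> g)"
      using g q by (simp add: pq Sym_inv_distrib[OF Sym_inv[OF g] q(1)] comp_assoc)
    ultimately obtain c where c: "c \<in> col_grp T" "g = inv p \<circ> c" by blast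
    have "row_sum T \<star> delta g \<star> col_sum T = row_sum T \<star> delta (inv p) \<star> (delta c \<star> col_sum T)"
      using c p by (simp add: mult_assoc col_grp_Sym flip: delta_delta)
    also have "\<dots> = cscale (of_int (sign c)) (csym T)"
      by (simp only: row_sum_delta[OF row_grp_inv[OF p_row]] delta_col_sum[OF c(1)] mult_scale_right csym_def)
    finally show ?thesis ..
  qed
qed

text \<open>By linearity it suffices to treat group elements. Since \<open>tau (csym T) = 1\<close>,
  the scalar can be read off by applying \<open>tau\<close>.\<close>

lemma row_x_col:
  assumes T: "bij_betw T {..<n} (diag L)" and L: "decseq L" and x: "x \<in> galg n"
  shows "row_sum T \<star> x \<star> col_sum T = cscale (tau (row_sum T \<star> x \<star> col_sum T)) (csym T)"
proof -
  obtain l where l: "row_sum T \<star> delta g \<star> col_sum T = cscale (l g) (csym T)" if "g \<in> Sym n" for g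
    using row_delta_col[OF T L] by metis
  have "row_sum T \<star> x \<star> col_sum T = (\<Sum>g\<in>Sym n. cscale (x g) (row_sum T \<star> delta g \<star> col_sum T))"
    by (subst galg_expansion[OF x])
      (simp only: mult_sum_left mult_sum_right mult_scale_left mult_scale_right)
  also have "\<dots> = (\<Sum>g\<in>Sym n. cscale (x g * l g) (csym T))"
    by (intro sum.cong refl) (simp only: l cs.scale_scale)
  also have "\<dots> = cscale (\<Sum>g\<in>Sym n. x g * l g) (csym T)"
    by (rule cs.scale_sum_left[symmetric])
  finally have *: "row_sum T \<star> x \<star> col_sum T = cscale (\<Sum>g\<in>Sym n. x g * l g) (csym T)" .
  then have "tau (row_sum T \<star> x \<star> col_sum T) = (\<Sum>g\<in>Sym n. x g * l g)"
    using tau_csym T by (simp add: cscale_def bij_betw_def)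
  with * show ?thesis by simp
qed

lemma csym_x_csym:
  assumes T: "bij_betw T {..<n} (diag L)" and L: "decseq L"
  shows "csym T \<star> x \<star> csym T = cscale (tau (csym T \<star> x \<star> csym T)) (csym T)"
proof -
  have "csym T \<star> x \<star> csym T = row_sum T \<star> (col_sum T \<star> x \<star> row_sum T) \<star> col_sum T"
    by (simp add: csym_def mult_assoc)
  then show ?thesis using row_x_col[OF T L, of "col_sum T \<star> x \<star> row_sum T"] by simp
qed

text \<open>Classically this is the product of the hook lengths. Here it is only the scalar in
  \<open>csym_csym\<close>, until \<open>fd_eq\<close> expresses it through the number of standard
  tableaux.\<close>

definition kappa :: "(nat \<Rightarrow> nat \<times> nat) \<Rightarrow> complex" where
  "kappa T = tau (csym T \<star> csym T)"

lemma csym_csym: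
  assumes T: "bij_betw T {..<n} (diag L)" and L: "decseq L"
  shows "csym T \<star> csym T = cscale (kappa T) (csym T)"
  using row_x_col[OF T L, of "col_sum T \<star> row_sum T"] by (simp add: csym_def mult_assoc kappa_def)

lemma row_sum_sq: "row_sum T \<star> row_sum T = cscale (of_nat (card (row_grp T))) (row_sum T)"
proof (rule galg_ext)
  fix s assume s: "s \<in> Sym n"
  have "(\<Sum>t\<in>Sym n. row_sum T t * row_sum T (inv t \<circ> s)) = (\<Sum>t\<in>Sym n. if t \<in> row_grp T then row_sum T s else 0)"
    using s row_grp_comp_iff(1)[OF row_grp_inv]
    by (intro sum.cong) (auto simp: row_sum_def)
  also have "\<dots> = of_nat (card (row_grp T)) * row_sum T s"
    by (simp add: sum.If_cases Int_def row_grp_def)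
  finally show "(row_sum T \<star> row_sum T) s = cscale (of_nat (card (row_grp T))) (row_sum T) s"
    using s by (simp add: mult_apply cscale_def)
qed simp_all

text \<open>The anti-automorphism induced by inversion. It fixes row sums and column sums, hence
  every palindromic product of them, such as \<open>a b a\<close>.\<close>

definition flip :: "((nat \<Rightarrow> nat) \<Rightarrow> complex) \<Rightarrow> (nat \<Rightarrow> nat) \<Rightarrow> complex" where
  "flip x s = (if s \<in> Sym n then x (inv s) else 0)"

lemma flip_mult: "flip (x \<star> y) = flip y \<star> flip x"
proof
  fix s
  show "flip (x \<star> y) s = (flip y \<star> flip x) s"
  proof (cases "s \<in> Sym n")
    case s: True
    have "(x \<star> y) (inv s) = (\<Sum>t\<in>Sym n. x (inv s \<circ> t) * y (inv (inv s \<circ> t) \<circ> inv s))"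
      using s by (simp only: mult_apply Sym_inv if_True) (rule sum_Sym_left[symmetric], simp)
    also have "\<dots> = (\<Sum>t\<in>Sym n. flip y t * flip x (inv t \<circ> s))"
      using s by (intro sum.cong refl) (simp add: flip_def Sym_inv_distrib[where n = n] comp_assoc)
    finally show ?thesis using s by (simp add: flip_def mult_apply)
  qed (simp add: flip_def mult_apply)
qed

lemma flip_row_sum: "flip (row_sum T) = row_sum T" and flip_col_sum: "flip (col_sum T) = col_sum T"
proof -
  have "inv s \<in> row_grp T \<longleftrightarrow> s \<in> row_grp T" "inv s \<in> col_grp T \<longleftrightarrow> s \<in> col_grp T"
    if "s \<in> Sym n" for s
    using row_grp_inv[of s T] row_grp_inv[of "inv s" T] col_grp_inv[of s T] col_grp_inv[of "inv s" T] that
    by auto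
  moreover have "sign (inv s) = sign s" if "s \<in> Sym n" for s using that by simp
  ultimately show "flip (row_sum T) = row_sum T" "flip (col_sum T) = col_sum T"
    by (auto simp: flip_def row_sum_def col_sum_def fun_eq_iff row_grp_Sym col_grp_Sym)
qed

text \<open>The element \<open>y = a b a\<close> is real and invariant under inversion, so \<open>tau (y y)\<close> is a sum of
  squares; on the other hand \<open>y y\<close> is a multiple of \<open>kappa T\<close>.\<close>
lemma kappa_ge_1:
  assumes T: "bij_betw T {..<n} (diag L)" and L: "decseq L"
  obtains r :: real where "r \<ge> 1" "kappa T = of_real r"
proof -
  define a b where "a = row_sum T" and "b = col_sum T"
  define y where "y = a \<star> b \<star> a"
  define R where "R = card (row_grp T)"
  have "R > 0" unfolding R_def card_gt_0_iff using row_grp_id finite_row_grp by blast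
  have flip_y: "flip y = y"
    by (simp add: y_def a_def b_def flip_mult flip_row_sum flip_col_sum mult_assoc)
  have real_y: "y s \<in> \<real>" for s
  proof -
    have "a s \<in> \<real>" "b s \<in> \<real>" for s by (auto simp: a_def b_def row_sum_def col_sum_def)
    then show ?thesis by (auto simp: y_def mult_apply intro!: sum_in_Reals Reals_mult)
  qed
  have tau_ab: "tau (a \<star> b) = 1"
    using tau_csym[of T] T by (simp add: a_def b_def csym_def bij_betw_def)
  have aa: "a \<star> a = cscale (of_nat R) a" by (simp add: a_def R_def row_sum_sq)
  have tau_y: "y id = of_nat R"
  proof -
    have "tau y = tau (a \<star> (a \<star> b))" unfolding y_def by (rule tau_mult_comm)
    also have "\<dots> = tau (cscale (of_nat R) (a \<star> b))"
      by (simp only: mult_assoc[symmetric] aa mult_scale_left)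
    finally show ?thesis using tau_ab by (simp add: cscale_def)
  qed
  have abab: "a \<star> b \<star> (a \<star> b) = cscale (kappa T) (a \<star> b)"
    using csym_csym[OF T L] by (simp add: a_def b_def csym_def)
  have "y \<star> y = a \<star> b \<star> (a \<star> a) \<star> b \<star> a" by (simp add: y_def mult_assoc)
  also have "\<dots> = cscale (of_nat R) (a \<star> b \<star> (a \<star> b) \<star> a)"
    by (simp only: aa mult_scale_left mult_scale_right mult_assoc)
  also have "\<dots> = cscale (of_nat R) (cscale (kappa T) y)"
    by (simp only: abab mult_scale_left y_def)
  finally have "tau (y \<star> y) = of_nat R * (kappa T * of_nat R)"
    using tau_y by (simp add: cscale_def)
  moreover have "tau (y \<star> y) = (\<Sum>s\<in>Sym n. of_real ((Re (y s))\<^sup>2))"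
    unfolding tau_mult
  proof (intro sum.cong refl)
    fix s assume s: "s \<in> Sym n"
    have "y (inv s) = y s" using fun_cong[OF flip_y, of s] s by (simp add: flip_def)
    moreover have "y s = of_real (Re (y s))" using real_y[of s] by simp
    ultimately show "y s * y (inv s) = of_real ((Re (y s))\<^sup>2)"
      by (metis of_real_mult power2_eq_square)
  qed
  ultimately have eq: "of_nat R * (kappa T * of_nat R) = complex_of_real (\<Sum>s\<in>Sym n. (Re (y s))\<^sup>2)"
    by simp
  \<comment> \<open>Since \<open>y id = R\<close>, the identity term alone contributes
    \<open>R^2\<close> to the sum of squares; this yields \<open>r \<ge> 1\<close>.\<close>
  define r where "r = (\<Sum>s\<in>Sym n. (Re (y s))\<^sup>2) / (real R)\<^sup>2"
  have "(Re (y id))\<^sup>2 \<le> (\<Sum>s\<in>Sym n. (Re (y s))\<^sup>2)"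
    by (rule member_le_sum[OF Sym_id]) simp_all
  then have "r \<ge> 1" using tau_y \<open>R > 0\<close> by (simp add: r_def)
  moreover have "kappa T = of_real r"
    using eq \<open>R > 0\<close> by (simp add: r_def field_simps power2_eq_square)
  ultimately show thesis by (rule that)
qed

lemma kappa_nonzero:
  assumes "bij_betw T {..<n} (diag L)" "decseq L"
  shows "kappa T \<noteq> 0"
  using kappa_ge_1[OF assms] by (metis of_real_eq_0_iff not_one_le_zero)

definition central :: "((nat \<Rightarrow> nat) \<Rightarrow> complex) \<Rightarrow> bool" where
  "central z \<longleftrightarrow> (\<forall>x\<in>galg n. x \<star> z = z \<star> x)"

definition zsym :: "(nat \<Rightarrow> nat \<times> nat) \<Rightarrow> (nat \<Rightarrow> nat) \<Rightarrow> complex" where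
  "zsym T = (\<Sum>g\<in>Sym n. delta g \<star> csym T \<star> delta (inv g))"

definition cidem :: "(nat \<Rightarrow> nat \<times> nat) \<Rightarrow> (nat \<Rightarrow> nat) \<Rightarrow> complex" where
  "cidem T = cscale (1 / (kappa T)\<^sup>2) (zsym T)"

lemma zsym_galg [simp]: "zsym T \<in> galg n" and cidem_galg [simp]: "cidem T \<in> galg n"
  by (simp_all add: zsym_def cidem_def)

lemma zsym_delta: 
  assumes h: "h \<in> Sym n"
  shows "delta h \<star> zsym T = zsym T \<star> delta h"
proof -
  have "delta h \<star> zsym T = (\<Sum>g\<in>Sym n. delta (h \<circ> g) \<star> csym T \<star> delta (inv g))"
    unfolding zsym_def mult_sum_right using h
    by (intro sum.cong refl) (simp add: mult_assoc flip: delta_delta)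
  also have "\<dots> = (\<Sum>g\<in>Sym n. delta (h \<circ> g) \<star> csym T \<star> delta (inv (h \<circ> g)) \<star> delta h)"
    using h by (intro sum.cong refl) (simp add: mult_assoc Sym_inv_distrib[where n = n] delta_delta comp_assoc)
  also have "\<dots> = (\<Sum>g\<in>Sym n. delta g \<star> csym T \<star> delta (inv g) \<star> delta h)"
    by (rule sum_Sym_left[OF h])
  finally show ?thesis by (simp only: zsym_def mult_sum_left)
qed

lemma central_if_commute_delta:
  assumes "\<And>h. h \<in> Sym n \<Longrightarrow> delta h \<star> z = z \<star> delta h"
  shows "central z"
  unfolding central_def
proof
  fix x assume x: "x \<in> galg n"
  have "x \<star> z = (\<Sum>g\<in>Sym n. cscale (x g) (delta g \<star> z))"
    by (subst galg_expansion[OF x]) (simp only: mult_sum_left mult_scale_left)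
  also have "\<dots> = (\<Sum>g\<in>Sym n. cscale (x g) (z \<star> delta g))"
    using assms by simp
  also have "\<dots> = z \<star> x"
    by (subst (2) galg_expansion[OF x]) (simp only: mult_sum_right mult_scale_right)
  finally show "x \<star> z = z \<star> x" .
qed

lemma central_zsym: "central (zsym T)"
  using zsym_delta by (intro central_if_commute_delta)

lemma central_cidem: "central (cidem T)"
  using central_zsym[of T] by (simp add: central_def cidem_def mult_scale_left mult_scale_right)

text \<open>By cyclicity of \<open>tau\<close>, the product \<open>c g^-1 c\<close> is
  \<open>kappa\<close> times the coefficient \<open>c g\<close>, times \<open>c\<close>. Summing
  over \<open>g\<close> therefore reassembles \<open>c\<close> from its own coefficients, and what
  remains is \<open>kappa c c\<close>.\<close>

lemma zsym_csym:
  assumes T: "bij_betw T {..<n} (diag L)" and L: "decseq L"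
  shows "zsym T \<star> csym T = cscale ((kappa T)\<^sup>2) (csym T)"
proof -
  let ?c = "csym T"
  have "?c \<star> delta (inv g) \<star> ?c = cscale (kappa T * ?c g) ?c" if g: "g \<in> Sym n" for g
  proof -
    have "tau (?c \<star> delta (inv g) \<star> ?c) = tau (?c \<star> (?c \<star> delta (inv g)))"
      by (rule tau_mult_comm)
    also have "\<dots> = tau (cscale (kappa T) (?c \<star> delta (inv g)))"
      by (simp only: mult_assoc[symmetric] csym_csym[OF T L] mult_scale_left)
    also have "\<dots> = kappa T * ?c g" using g by (simp add: cscale_def mult_delta)
    finally show ?thesis using csym_x_csym[OF T L, of "delta (inv g)"] by simp
  qed
  then have "zsym T \<star> ?c = (\<Sum>g\<in>Sym n. delta g \<star> cscale (kappa T * ?c g) ?c)"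
    unfolding zsym_def mult_sum_left by (intro sum.cong refl) (simp add: mult_assoc)
  also have "\<dots> = (\<Sum>g\<in>Sym n. cscale (kappa T) (cscale (?c g) (delta g) \<star> ?c))"
    by (intro sum.cong refl) (simp only: mult_scale_left mult_scale_right cs.scale_scale)
  also have "\<dots> = cscale (kappa T) ((\<Sum>g\<in>Sym n. cscale (?c g) (delta g)) \<star> ?c)"
    by (simp only: mult_sum_left cs.scale_sum_right)
  also have "\<dots> = cscale (kappa T) (?c \<star> ?c)"
    using galg_expansion[of ?c] by simp
  also have "\<dots> = cscale ((kappa T)\<^sup>2) ?c"
    by (simp only: csym_csym[OF T L] cs.scale_scale power2_eq_square)
  finally show ?thesis .
qed

lemma cidem_csym:
  assumes "bij_betw T {..<n} (diag L)" "decseq L"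
  shows "cidem T \<star> csym T = csym T"
  using kappa_nonzero[OF assms]
  by (simp add: cidem_def mult_scale_left zsym_csym[OF assms] del: cs.scale_scale)
    (simp add: cscale_def)

lemma cidem_conj:
  assumes T: "bij_betw T {..<n} (diag L)" and L: "decseq L" and g: "g \<in> Sym n"
  shows "cidem T \<star> (delta g \<star> csym T \<star> x) = delta g \<star> csym T \<star> x"
proof -
  have "cidem T \<star> delta g = delta g \<star> cidem T" using central_cidem g by (simp add: central_def)
  then have "cidem T \<star> (delta g \<star> csym T \<star> x) = delta g \<star> (cidem T \<star> csym T) \<star> x"
    by (simp add: mult_assoc[symmetric])
  then show ?thesis using cidem_csym[OF T L] by simp
qed

lemma cidem_idem:
  assumes T: "bij_betw T {..<n} (diag L)" and L: "decseq L"
  shows "cidem T \<star> cidem T = cidem T"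
proof -
  have "cidem T \<star> zsym T = zsym T"
    unfolding zsym_def mult_sum_right by (intro sum.cong refl cidem_conj[OF T L])
  then show ?thesis
    using mult_scale_right[of "cidem T" "1 / (kappa T)\<^sup>2" "zsym T"] by (metis cidem_def)
qed

lemma tau_cidem:
  assumes T: "bij_betw T {..<n} (diag L)"
  shows "tau (cidem T) = fact n / (kappa T)\<^sup>2"
proof -
  have "tau (zsym T) = (\<Sum>g\<in>Sym n. tau (csym T))"
    unfolding zsym_def sum_fun_apply by (intro sum.cong refl) (simp add: mult_delta delta_mult)
  also have "\<dots> = fact n"
    using tau_csym[of T] T by (simp add: bij_betw_def card_Sym)
  finally show ?thesis by (simp add: cidem_def cscale_def)
qed

text \<open>A group element between the inner column and row sums only relabels the tableau
  \<open>T\<close>. Its shape stays lexicographically greater than that of \<open>T'\<close>, so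
  there is always a clash.\<close>

lemma csym_x_csym_zero:
  assumes T: "bij_betw T {..<n} (diag L)" and T': "bij_betw T' {..<n} (diag M)" and M: "decseq M"
    and less: "\<And>i'. i' < i \<Longrightarrow> L i' = M i'" "M i < L i" and x: "x \<in> galg n"
  shows "csym T' \<star> x \<star> csym T = 0"
proof -
  have "col_sum T' \<star> delta g \<star> row_sum T = 0" if g: "g \<in> Sym n" for g
  proof -
    have bij: "bij_betw (T \<circ> inv g) {..<n} (diag L)"
      by (rule bij_betw_trans[OF permutes_imp_bij T])
        (use g in \<open>simp add: Sym_def permutes_inv flip: atLeast0LessThan\<close>)
    have "delta g \<star> row_sum T = row_sum (T \<circ> inv g) \<star> delta g"
      using g by (simp add: mult_assoc delta_delta delta_id_right flip: conj_row_sum)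
    then have "col_sum T' \<star> delta g \<star> row_sum T = col_sum T' \<star> row_sum (T \<circ> inv g) \<star> delta g"
      by (simp add: mult_assoc)
    then show ?thesis
      using clash_zero(2)[OF clash_if_lex_greater[OF bij T' M less]] by simp
  qed
  then have "(\<Sum>g\<in>Sym n. cscale (x g) (col_sum T' \<star> delta g \<star> row_sum T)) = 0"
    by (intro sum.neutral) (simp add: cs.scale_zero_right)
  then have "col_sum T' \<star> x \<star> row_sum T = 0"
    by (subst galg_expansion[OF x])
      (simp only: mult_sum_left mult_sum_right mult_scale_left mult_scale_right)
  moreover have "csym T' \<star> x \<star> csym T = row_sum T' \<star> (col_sum T' \<star> x \<star> row_sum T) \<star> col_sum T"
    by (simp add: csym_def mult_assoc)
  ultimately show ?thesis by simp
qed

lemma cidem_orthogonal: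
  assumes T: "bij_betw T {..<n} (diag L)" and T': "bij_betw T' {..<n} (diag M)"
    and L: "decseq L" and M: "decseq M" and "L \<noteq> M"
  shows "cidem T' \<star> cidem T = 0"
proof -
  have *: "cidem T' \<star> cidem T = 0"
    if T: "bij_betw T {..<n} (diag L)" and T': "bij_betw T' {..<n} (diag M)" and M: "decseq M"
      and less: "\<And>i'. i' < i \<Longrightarrow> L i' = M i'" "M i < L i" for T T' L M i
  proof -
    have "zsym T' \<star> zsym T =
      (\<Sum>g\<in>Sym n. \<Sum>h\<in>Sym n. delta g \<star> (csym T' \<star> (delta (inv g) \<star> delta h) \<star> csym T) \<star> delta (inv h))"
      by (simp only: zsym_def[of T'] mult_sum_left) (simp only: zsym_def[of T] mult_sum_right mult_assoc)
    also have "\<dots> = 0"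
      by (intro sum.neutral ballI) (simp add: csym_x_csym_zero[OF that])
    finally show ?thesis
      by (simp only: cidem_def mult_scale_left mult_scale_right cs.scale_zero_right)
  qed
  \<comment> \<open>The first row in which the shapes differ decides which product the previous
    claim covers; centrality transfers the result to the other order.\<close>
  define i where "i = (LEAST i. L i \<noteq> M i)"
  have "\<exists>i. L i \<noteq> M i" using \<open>L \<noteq> M\<close> by auto
  then have i: "L i \<noteq> M i" unfolding i_def by (rule LeastI_ex)
  have lt: "L i' = M i'" if "i' < i" for i' using not_less_Least that unfolding i_def by blast
  show ?thesis
  proof (cases "M i < L i")
    case True
    show ?thesis by (rule *[OF T T' M lt True])
  next
    case False
    have "cidem T \<star> cidem T' = 0"
      by (rule *[OF T' T L lt[symmetric]]) (use False i in auto)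
    then show ?thesis using central_cidem[of T] by (simp add: central_def)
  qed
qed

end

subsection \<open>Counting standard tableaux\<close>

definition par :: "nat \<Rightarrow> (nat \<Rightarrow> nat) \<Rightarrow> bool" where
  "par n L \<longleftrightarrow> decseq L \<and> (\<forall>i\<ge>n. L i = 0) \<and> sum L {..<n} = n"

definition removable :: "(nat \<Rightarrow> nat) \<Rightarrow> nat set" where
  "removable L = {i. L (Suc i) < L i}"

text \<open>A box fits into row \<open>Suc i\<close> exactly when row \<open>i\<close> can lose one.
  Stating addability through this pairing makes the sum in \<open>content_balance\<close>
  telescope.\<close>

definition addable :: "(nat \<Rightarrow> nat) \<Rightarrow> nat set" where
  "addable L = insert 0 (Suc ` removable L)"

definition rem_box :: "(nat \<Rightarrow> nat) \<Rightarrow> nat \<Rightarrow> nat \<Rightarrow> nat" where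
  "rem_box L i = L(i := L i - 1)"

definition add_box :: "(nat \<Rightarrow> nat) \<Rightarrow> nat \<Rightarrow> nat \<Rightarrow> nat" where
  "add_box L i = L(i := Suc (L i))"

text \<open>The number of standard tableaux of shape \<open>L\<close>, by the position of the largest entry.\<close>
primrec fd :: "nat \<Rightarrow> (nat \<Rightarrow> nat) \<Rightarrow> nat" where
  "fd 0 L = 1"
| "fd (Suc n) L = (\<Sum>i\<in>removable L. fd n (rem_box L i))"

lemma addable_iff: "i \<in> addable L \<longleftrightarrow> i = 0 \<or> L i < L (i - 1)"
  by (cases i) (auto simp: addable_def removable_def)

lemma sum_vanish:
  fixes L :: "nat \<Rightarrow> nat"
  assumes "\<And>i. i \<ge> m \<Longrightarrow> L i = 0" "m \<le> K"
  shows "sum L {..<K} = sum L {..<m}"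
  by (rule sum.mono_neutral_right) (use assms in auto)

text \<open>A nonzero row \<open>i\<close> forces at least \<open>i + 1\<close> boxes, so rows from
  \<open>n\<close> on are empty and an arbitrary cutoff \<open>K\<close> can be exchanged for the
  cutoff \<open>n\<close> in \<open>par\<close>.\<close>

lemma parI:
  assumes L: "decseq L" and zero: "\<And>i. i \<ge> K \<Longrightarrow> L i = 0" and sum: "sum L {..<K} = n"
  shows "par n L"
proof -
  have zn: "L i = 0" if "i \<ge> n" for i
  proof (rule ccontr)
    assume "L i \<noteq> 0"
    then have "i < K" using zero not_less by blast
    have "i < (\<Sum>j\<le>i. 1)" by simp
    also have "\<dots> \<le> sum L {..i}"
      using \<open>L i \<noteq> 0\<close> decseqD[OF L] by (intro sum_mono) (metis atMost_iff le_zero_eq less_one not_le)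
    also have "\<dots> \<le> sum L {..<K}" using \<open>i < K\<close> by (intro sum_mono2) auto
    finally show False using sum that by simp
  qed
  have "sum L {..<n} = sum L {..<max n K}" by (rule sum_vanish[OF zn, symmetric]) auto
  also have "\<dots> = sum L {..<K}" by (rule sum_vanish[OF zero]) auto
  finally show ?thesis using assms zn by (simp add: par_def)
qed

lemma par_sum: "par n L \<Longrightarrow> n \<le> K \<Longrightarrow> sum L {..<K} = n"
  using sum_vanish[of n L K] by (simp add: par_def)

lemma par_decseq: "par n L \<Longrightarrow> decseq L"
  by (simp add: par_def)

lemma removable_lt: "par n L \<Longrightarrow> i \<in> removable L \<Longrightarrow> i < n"
  by (rule ccontr) (simp add: par_def removable_def)

lemma finite_removable [simp]: "par n L \<Longrightarrow> finite (removable L)"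
  by (rule finite_subset[of _ "{..<n}"]) (auto dest: removable_lt)

lemma finite_addable [simp]: "par n L \<Longrightarrow> finite (addable L)"
  by (simp add: addable_def)

lemma addable_le: "par n L \<Longrightarrow> i \<in> addable L \<Longrightarrow> i \<le> n"
  by (auto simp: addable_def Suc_le_eq dest: removable_lt)

lemma par_add_box:
  assumes L: "par n L" and i: "i \<in> addable L"
  shows "par (Suc n) (add_box L i)"
proof (rule parI[of _ "Suc n"])
  have "add_box L i (Suc j) \<le> add_box L i j" for j
    using i decseq_SucD[OF par_decseq[OF L], of j] by (auto simp: add_box_def addable_iff)
  then show "decseq (add_box L i)" by (simp add: decseq_Suc_iff)
  show "add_box L i j = 0" if "Suc n \<le> j" for j
    using that addable_le[OF L i] L by (auto simp: add_box_def par_def)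
  have "sum (add_box L i) {..<Suc n} = sum (\<lambda>j. L j + (if j = i then 1 else 0)) {..<Suc n}"
    by (intro sum.cong) (auto simp: add_box_def)
  then show "sum (add_box L i) {..<Suc n} = Suc n"
    using addable_le[OF L i] par_sum[OF L, of "Suc n"] by (simp only: sum.distrib) auto
qed

lemma par_rem_box:
  assumes L: "par (Suc n) L" and i: "i \<in> removable L"
  shows "par n (rem_box L i)"
proof (rule parI[of _ "Suc n"])
  have "rem_box L i (Suc j) \<le> rem_box L i j" for j
    using i decseq_SucD[OF par_decseq[OF L], of j] by (auto simp: rem_box_def removable_def)
  then show "decseq (rem_box L i)" by (simp add: decseq_Suc_iff)
  show "rem_box L i j = 0" if "Suc n \<le> j" for j
    using that removable_lt[OF L i] L by (auto simp: rem_box_def par_def)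
  have "Suc n = sum L {..<Suc n}" using L par_sum by force
  also have "\<dots> = sum (\<lambda>j. rem_box L i j + (if j = i then 1 else 0)) {..<Suc n}"
    using i by (intro sum.cong) (auto simp: rem_box_def removable_def)
  also have "\<dots> = sum (rem_box L i) {..<Suc n} + 1"
    using removable_lt[OF L i] by (simp only: sum.distrib) auto
  finally show "sum (rem_box L i) {..<Suc n} = n" by simp
qed

lemma add_rem_box [simp]: "i \<in> removable L \<Longrightarrow> add_box (rem_box L i) i = L"
  by (auto simp: add_box_def rem_box_def removable_def)

lemma rem_add_box [simp]: "rem_box (add_box L i) i = L"
  by (auto simp: add_box_def rem_box_def)

lemma removable_add_box: "decseq L \<Longrightarrow> i \<in> removable (add_box L i)"
  using decseq_SucD[of L i] by (auto simp: removable_def add_box_def)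

lemma addable_rem_box: "decseq L \<Longrightarrow> i \<in> removable L \<Longrightarrow> i \<in> addable (rem_box L i)"
  using decseq_SucD[of L "i - 1"] by (cases i) (auto simp: removable_def addable_iff rem_box_def)

text \<open>Moves in different rows commute, including their admissibility. For equal rows the two
  orders require different things, addability and removability respectively, and this difference is
  what \<open>content_balance\<close> measures.\<close>

lemma exchange_boxes:
  assumes "i \<noteq> j"
  shows "i \<in> addable L \<and> j \<in> removable (add_box L i) \<longleftrightarrow> j \<in> removable L \<and> i \<in> addable (rem_box L j)"
    and "rem_box (add_box L i) j = add_box (rem_box L j) i"
proof -
  show "i \<in> addable L \<and> j \<in> removable (add_box L i) \<longleftrightarrow> j \<in> removable L \<and> i \<in> addable (rem_box L j)"
    using assms by (cases i) (auto simp: addable_iff removable_def add_box_def rem_box_def)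
  show "rem_box (add_box L i) j = add_box (rem_box L j) i"
    using assms by (simp add: add_box_def rem_box_def fun_upd_twist)
qed

section \<open>Content weights on Young's lattice\<close>

definition content_wt :: "real \<Rightarrow> real \<Rightarrow> (nat \<Rightarrow> nat) \<Rightarrow> nat \<Rightarrow> real" where
  "content_wt x y L i = x + y * (real (L i) - real i)"

text \<open>The content of the cell gained by row \<open>Suc i\<close> exceeds that of the cell lost
  by row \<open>i\<close> by \<open>L (Suc i) - L i\<close>. These differences telescope to
  \<open>- L 0\<close> and cancel the content of the cell that row 0 can gain.\<close>

lemma content_balance:
  assumes L: "par n L"
  shows "(\<Sum>i\<in>addable L. content_wt x y L i) - (\<Sum>i\<in>removable L. content_wt x y (rem_box L i) i) = x"
proof -
  have "(\<Sum>i\<in>addable L. content_wt x y L i) =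
      content_wt x y L 0 + (\<Sum>i\<in>removable L. content_wt x y L (Suc i))"
    using L by (simp add: addable_def sum.reindex)
  moreover have "(\<Sum>i\<in>removable L. content_wt x y L (Suc i)) - (\<Sum>i\<in>removable L. content_wt x y (rem_box L i) i)
      = (\<Sum>i\<in>removable L. y * (real (L (Suc i)) - real (L i)))"
    unfolding sum_subtractf[symmetric]
    by (intro sum.cong) (auto simp: content_wt_def rem_box_def removable_def algebra_simps of_nat_diff)
  moreover have "\<dots> = (\<Sum>i<n. y * (real (L (Suc i)) - real (L i)))"
    using removable_lt[OF L] decseq_SucD[OF par_decseq[OF L]]
    by (intro sum.mono_neutral_left) (auto simp: removable_def le_antisym not_less)
  moreover have "\<dots> = y * (real (L n) - real (L 0))"
    by (simp add: sum_lessThan_telescope[of "\<lambda>i. real (L i)"] flip: sum_distrib_left)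
  moreover have "L n = 0" using L by (simp add: par_def)
  ultimately show ?thesis by (simp add: content_wt_def algebra_simps)
qed

text \<open>This is the commutation relation of adding and removing boxes, weighted by contents.
  Removing the box just added returns \<open>L\<close>; all other pairs of moves are exchanged and
  summed by the induction hypothesis, whose own diagonal term has to be subtracted.
  \<open>content_balance\<close> evaluates the difference of the two diagonal contributions.\<close>

lemma up_identity:
  assumes "par n L"
  shows "(\<Sum>i\<in>addable L. content_wt x y L i * real (fd (Suc n) (add_box L i))) = x * real (Suc n) * real (fd n L)"
  using assms
proof (induction n arbitrary: L)
  case 0
  then have L: "L = (\<lambda>_. 0)" by (auto simp: par_def)
  have "removable (add_box L 0) = {0}" "addable L = {0}"
    by (auto simp: L removable_def addable_def add_box_def)
  then show ?case by (simp add: content_wt_def L)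
next
  case (Suc m)
  note L = Suc.prems
  note dec = par_decseq[OF L]
  have fin: "finite (addable L)" "finite (removable L)" using L by simp_all
  have finr: "finite (removable (add_box L i))" if "i \<in> addable L" for i
    using par_add_box[OF L that] by simp
  have fina: "finite (addable (rem_box L j))" if "j \<in> removable L" for j
    using par_rem_box[OF L that] by simp
  have "(\<Sum>i\<in>addable L. content_wt x y L i * real (fd (Suc (Suc m)) (add_box L i))) =
    (\<Sum>i\<in>addable L. content_wt x y L i * real (fd (Suc m) L) +
      (\<Sum>j\<in>removable (add_box L i) - {i}. content_wt x y L i * real (fd (Suc m) (rem_box (add_box L i) j))))"
  proof (intro sum.cong refl)
    fix i assume i: "i \<in> addable L"
    have "real (fd (Suc (Suc m)) (add_box L i)) = real (fd (Suc m) L) +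
        (\<Sum>j\<in>removable (add_box L i) - {i}. real (fd (Suc m) (rem_box (add_box L i) j)))"
      unfolding fd.simps(2)[of "Suc m"] of_nat_sum
      using sum.remove[OF finr[OF i] removable_add_box[OF dec], of "\<lambda>j. real (fd (Suc m) (rem_box (add_box L i) j))"]
      by (simp del: fd.simps)
    then show "content_wt x y L i * real (fd (Suc (Suc m)) (add_box L i)) =
      content_wt x y L i * real (fd (Suc m) L) +
      (\<Sum>j\<in>removable (add_box L i) - {i}. content_wt x y L i * real (fd (Suc m) (rem_box (add_box L i) j)))"
      by (simp add: distrib_left sum_distrib_left del: fd.simps)
  qed
  also have "\<dots> = (\<Sum>i\<in>addable L. content_wt x y L i) * real (fd (Suc m) L) +
      (\<Sum>i\<in>addable L. \<Sum>j\<in>removable (add_box L i) - {i}. content_wt x y L i * real (fd (Suc m) (rem_box (add_box L i) j)))"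
    by (simp only: sum.distrib sum_distrib_right)
  also have "(\<Sum>i\<in>addable L. \<Sum>j\<in>removable (add_box L i) - {i}. content_wt x y L i * real (fd (Suc m) (rem_box (add_box L i) j)))
    = (\<Sum>j\<in>removable L. \<Sum>i\<in>addable (rem_box L j) - {j}.
        content_wt x y (rem_box L j) i * real (fd (Suc m) (add_box (rem_box L j) i)))"
  proof -
    have "(\<Sum>(i,j)\<in>(SIGMA i:addable L. removable (add_box L i) - {i}). content_wt x y L i * real (fd (Suc m) (rem_box (add_box L i) j)))
      = (\<Sum>(j,i)\<in>(SIGMA j:removable L. addable (rem_box L j) - {j}).
        content_wt x y (rem_box L j) i * real (fd (Suc m) (add_box (rem_box L j) i)))"
    proof (rule sum.reindex_bij_witness[of _ prod.swap prod.swap])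
      fix a assume a: "a \<in> (SIGMA i:addable L. removable (add_box L i) - {i})"
      obtain i j where ij: "a = (i, j)" "i \<in> addable L" "j \<in> removable (add_box L i)" "i \<noteq> j"
        using a by auto
      have j: "j \<in> removable L \<and> i \<in> addable (rem_box L j)"
        using exchange_boxes(1)[OF ij(4)] ij by blast
      show "prod.swap a \<in> (SIGMA j:removable L. addable (rem_box L j) - {j})"
        using ij j by auto
      show "(case prod.swap a of (j, i) \<Rightarrow> content_wt x y (rem_box L j) i * real (fd (Suc m) (add_box (rem_box L j) i)))
        = (case a of (i, j) \<Rightarrow> content_wt x y L i * real (fd (Suc m) (rem_box (add_box L i) j)))"
        using ij j exchange_boxes(2)[OF ij(4)] by (simp add: content_wt_def rem_box_def[of L] del: fd.simps)
    next
      fix b assume b: "b \<in> (SIGMA j:removable L. addable (rem_box L j) - {j})"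
      then obtain i j where "b = (j, i)" "j \<in> removable L" "i \<in> addable (rem_box L j)" "i \<noteq> j"
        by auto
      then show "prod.swap b \<in> (SIGMA i:addable L. removable (add_box L i) - {i})"
        using exchange_boxes(1)[of i j L] by simp
    qed auto
    then show ?thesis using fin finr fina by (simp add: sum.Sigma del: fd.simps)
  qed
  also have "\<dots> = (\<Sum>j\<in>removable L. x * real (Suc m) * real (fd m (rem_box L j)) - content_wt x y (rem_box L j) j * real (fd (Suc m) L))"
  proof (intro sum.cong refl)
    fix j assume j: "j \<in> removable L"
    have "(\<Sum>i\<in>addable (rem_box L j). content_wt x y (rem_box L j) i * real (fd (Suc m) (add_box (rem_box L j) i)))
        = x * real (Suc m) * real (fd m (rem_box L j))"
      by (rule Suc.IH[OF par_rem_box[OF L j]])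
    then show "(\<Sum>i\<in>addable (rem_box L j) - {j}. content_wt x y (rem_box L j) i * real (fd (Suc m) (add_box (rem_box L j) i)))
      = x * real (Suc m) * real (fd m (rem_box L j)) - content_wt x y (rem_box L j) j * real (fd (Suc m) L)"
      using sum.remove[OF fina[OF j] addable_rem_box[OF dec j],
          of "\<lambda>i. content_wt x y (rem_box L j) i * real (fd (Suc m) (add_box (rem_box L j) i))"] j
      by (simp del: fd.simps)
  qed
  also have "\<dots> = x * real (Suc m) * real (fd (Suc m) L) - (\<Sum>j\<in>removable L. content_wt x y (rem_box L j) j) * real (fd (Suc m) L)"
    by (simp only: sum_subtractf sum_distrib_right[symmetric] sum_distrib_left[symmetric] fd.simps of_nat_sum)
  finally have "(\<Sum>i\<in>addable L. content_wt x y L i * real (fd (Suc (Suc m)) (add_box L i))) =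
    ((\<Sum>i\<in>addable L. content_wt x y L i) - (\<Sum>j\<in>removable L. content_wt x y (rem_box L j) j)) * real (fd (Suc m) L)
     + x * real (Suc m) * real (fd (Suc m) L)"
    by (simp only: algebra_simps)
  then show ?case
    by (simp only: content_balance[OF L]) (simp add: algebra_simps del: fd.simps)
qed

text \<open>Three pairs \<open>(x, y)\<close> occur: \<open>(N, 1)\<close> for traces on the tensor
  power, \<open>(1, 1 / N)\<close> for probabilities, and \<open>(1, 0)\<close>, where the product
  is 1, for the sum of squares of \<open>fd\<close>.\<close>

definition content_prod :: "real \<Rightarrow> real \<Rightarrow> nat \<Rightarrow> (nat \<Rightarrow> nat) \<Rightarrow> real" where
  "content_prod x y n L = (\<Prod>i<n. \<Prod>j<L i. x + y * (real j - real i))"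

lemma content_prod_add_box:
  assumes L: "par n L" and i: "i \<in> addable L"
  shows "content_prod x y (Suc n) (add_box L i) = content_prod x y n L * content_wt x y L i"
proof -
  have "content_prod x y (Suc n) (add_box L i) =
    (\<Prod>k<Suc n. (\<Prod>j<L k. x + y * (real j - real k)) * (if k = i then content_wt x y L i else 1))"
    unfolding content_prod_def by (intro prod.cong) (auto simp: add_box_def content_wt_def)
  also have "\<dots> = (\<Prod>k<Suc n. \<Prod>j<L k. x + y * (real j - real k)) * content_wt x y L i"
    using addable_le[OF L i] by (simp only: prod.distrib) auto
  also have "(\<Prod>k<Suc n. \<Prod>j<L k. x + y * (real j - real k)) = content_prod x y n L"
    using L by (simp add: content_prod_def par_def)
  finally show ?thesis .
qed

lemma finite_par [simp]: "finite {L. par n L}"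
proof (rule finite_subset)
  show "{L. par n L} \<subseteq> {L. \<forall>i. (i \<in> {..<n} \<longrightarrow> L i \<in> {..n}) \<and> (i \<notin> {..<n} \<longrightarrow> L i = 0)}"
  proof clarify
    fix L i assume L: "par n L"
    have "L i \<le> n" if "i < n"
      using member_le_sum[of i "{..<n}" L] that L by (simp add: par_def)
    then show "(i \<in> {..<n} \<longrightarrow> L i \<in> {..n}) \<and> (i \<notin> {..<n} \<longrightarrow> L i = 0)"
      using L by (auto simp: par_def)
  qed
qed (intro finite_set_of_finite_funs finite_lessThan finite_atMost)

lemma sum_par_Suc:
  "(\<Sum>L | par (Suc n) L. \<Sum>i\<in>removable L. f L (rem_box L i) i) =
   (\<Sum>M | par n M. \<Sum>i\<in>addable M. (f (add_box M i) M i :: real))"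
proof -
  have "(\<Sum>(L,i)\<in>(SIGMA L:{L. par (Suc n) L}. removable L). f L (rem_box L i) i) =
    (\<Sum>(M,i)\<in>(SIGMA M:{M. par n M}. addable M). f (add_box M i) M i)"
    by (rule sum.reindex_bij_witness[of _ "\<lambda>(M, i). (add_box M i, i)" "\<lambda>(L, i). (rem_box L i, i)"])
      (auto simp: par_rem_box par_add_box par_decseq addable_rem_box removable_add_box)
  then show ?thesis by (subst (1 2) sum.Sigma) auto
qed

text \<open>One of the two factors \<open>fd\<close> is expanded over removable boxes; reading the
  resulting sum over edges of Young's lattice from the smaller diagram upwards leaves exactly the
  sum in \<open>up_identity\<close>.\<close>

lemma sum_fd_content_prod:
  "(\<Sum>L | par n L. (real (fd n L))\<^sup>2 * content_prod x y n L) = fact n * x ^ n"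
proof (induction n)
  case 0
  have "{L. par 0 L} = {\<lambda>_. 0}" by (auto simp: par_def decseq_def)
  then show ?case by (simp only: content_prod_def) simp
next
  case (Suc n)
  have "(\<Sum>L | par (Suc n) L. (real (fd (Suc n) L))\<^sup>2 * content_prod x y (Suc n) L) =
    (\<Sum>L | par (Suc n) L. \<Sum>i\<in>removable L. real (fd n (rem_box L i)) * (real (fd (Suc n) L) * content_prod x y (Suc n) L))"
    by (simp add: power2_eq_square sum_distrib_right mult.assoc)
  also have "\<dots> = (\<Sum>M | par n M. \<Sum>i\<in>addable M. real (fd n M) * (real (fd (Suc n) (add_box M i)) * content_prod x y (Suc n) (add_box M i)))"
    by (rule sum_par_Suc)
  also have "\<dots> = (\<Sum>M | par n M. real (fd n M) * content_prod x y n M *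
      (\<Sum>i\<in>addable M. content_wt x y M i * real (fd (Suc n) (add_box M i))))"
    by (intro sum.cong refl) (simp add: sum_distrib_left content_prod_add_box mult_ac del: fd.simps)
  also have "\<dots> = (\<Sum>M | par n M. x * real (Suc n) * ((real (fd n M))\<^sup>2 * content_prod x y n M))"
    by (intro sum.cong refl) (simp only: mem_Collect_eq up_identity, simp add: power2_eq_square)
  also have "\<dots> = x * real (Suc n) * (fact n * x ^ n)"
    by (simp only: sum_distrib_left[symmetric] Suc)
  finally show ?case by (simp add: algebra_simps)
qed

lemma sum_fd_squared: "(\<Sum>L | par n L. (real (fd n L))\<^sup>2) = fact n"
  using sum_fd_content_prod[of n 1 0] by (simp add: content_prod_def)

subsection \<open>The triangular family of standard tableaux\<close>

text \<open>The order of the list matters: tableaux are sorted by the row of the largest entry, then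
  recursively. This is what makes the family triangular in \<open>tabs_clash\<close>.\<close>

primrec tabs :: "nat \<Rightarrow> (nat \<Rightarrow> nat) \<Rightarrow> (nat \<Rightarrow> nat \<times> nat) list" where
  "tabs 0 L = [\<lambda>_. (0, 0)]"
| "tabs (Suc n) L = concat (map (\<lambda>i. map (\<lambda>T. T(n := (i, L i - 1))) (tabs n (rem_box L i)))
     (filter (\<lambda>i. i \<in> removable L) [0..<Suc n]))"

lemma length_tabs: "par n L \<Longrightarrow> length (tabs n L) = fd n L"
proof (induction n arbitrary: L)
  case (Suc n)
  have "set (filter (\<lambda>i. i \<in> removable L) [0..<Suc n]) = removable L"
    using removable_lt[OF Suc.prems] unfolding set_filter set_upt atLeast0LessThan by blast
  moreover have "distinct (filter (\<lambda>i. i \<in> removable L) [0..<Suc n])" by simp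
  ultimately have "length (tabs (Suc n) L) = (\<Sum>i\<in>removable L. length (tabs n (rem_box L i)))"
    by (simp only: tabs.simps length_concat map_map comp_def length_map sum_list_distinct_conv_sum_set)
  also have "\<dots> = fd (Suc n) L"
    using Suc.IH par_rem_box[OF Suc.prems] by simp
  finally show ?case .
qed simp

lemma diag_rem_box:
  assumes "i \<in> removable L"
  shows "diag L = insert (i, L i - 1) (diag (rem_box L i))" "(i, L i - 1) \<notin> diag (rem_box L i)"
  using assms by (auto simp: diag_def rem_box_def removable_def split: if_splits)

lemma bij_betw_extend_box:
  assumes i: "i \<in> removable L" and T: "bij_betw T {..<n} (diag (rem_box L i))"
  shows "bij_betw (T(n := (i, L i - 1))) {..<Suc n} (diag L)"
proof -
  have "bij_betw (T(n := (i, L i - 1))) {..<n} (diag (rem_box L i))"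
    using T by (subst bij_betw_cong[of _ _ T]) auto
  then have "bij_betw (T(n := (i, L i - 1))) ({..<n} \<union> {n}) (diag (rem_box L i) \<union> {(T(n := (i, L i - 1))) n})"
    by (intro notIn_Un_bij_betw) (use diag_rem_box[OF i] in auto)
  then show ?thesis using diag_rem_box[OF i] by (simp add: lessThan_Suc)
qed

lemma tabs_bij: "par n L \<Longrightarrow> T \<in> set (tabs n L) \<Longrightarrow> bij_betw T {..<n} (diag L)"
proof (induction n arbitrary: L T)
  case 0
  then show ?case by (auto simp: par_def diag_def bij_betw_def)
next
  case (Suc n)
  then obtain i T' where i: "i \<in> removable L" and T': "T' \<in> set (tabs n (rem_box L i))"
    and T: "T = T'(n := (i, L i - 1))" by (auto simp del: upt_Suc)
  show ?case unfolding T
    by (rule bij_betw_extend_box[OF i Suc.IH[OF par_rem_box[OF Suc.prems(1) i] T']])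
qed

lemma sorted_wrt_concat:
  assumes "\<And>xs. xs \<in> set xss \<Longrightarrow> sorted_wrt P xs"
    and "sorted_wrt (\<lambda>xs ys. \<forall>x\<in>set xs. \<forall>y\<in>set ys. P x y) xss"
  shows "sorted_wrt P (concat xss)"
  using assms by (induction xss) (auto simp: sorted_wrt_append)

lemma row_col_clash_extend:
  "row_col_clash n T T' \<Longrightarrow> row_col_clash (Suc n) (T(n := c)) (T'(n := c'))"
  unfolding row_col_clash_def by (elim exE conjE) (metis fun_upd_other less_Suc_eq less_irrefl)

text \<open>At the largest entry where two tableaux differ, the later one has it in a lower row.
  Without that entry its shape still has the full row from which the earlier one lost a box, so it
  is lexicographically greater and a clash follows; larger entries do not destroy it.\<close>

lemma tabs_clash: "par n L \<Longrightarrow> sorted_wrt (\<lambda>T T'. row_col_clash n T' T) (tabs n L)"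
proof (induction n arbitrary: L)
  case (Suc n)
  let ?ext = "\<lambda>i T. T(n := (i, L i - 1))"
  let ?xss = "map (\<lambda>i. map (?ext i) (tabs n (rem_box L i))) (filter (\<lambda>i. i \<in> removable L) [0..<Suc n])"
  have "sorted_wrt (\<lambda>T T'. row_col_clash (Suc n) T' T) (concat ?xss)"
  proof (rule sorted_wrt_concat)
    fix xs assume "xs \<in> set ?xss"
    then obtain i where i: "i \<in> removable L" and xs: "xs = map (?ext i) (tabs n (rem_box L i))"
      unfolding set_map set_filter by blast
    show "sorted_wrt (\<lambda>T T'. row_col_clash (Suc n) T' T) xs"
      unfolding xs sorted_wrt_map
      by (rule sorted_wrt_mono_rel[OF _ Suc.IH[OF par_rem_box[OF Suc.prems i]]])
        (rule row_col_clash_extend)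
  next
    show "sorted_wrt (\<lambda>xs ys. \<forall>x\<in>set xs. \<forall>y\<in>set ys. row_col_clash (Suc n) y x) ?xss"
      unfolding sorted_wrt_map
    proof (rule sorted_wrt_mono_rel)
      show "sorted_wrt (<) (filter (\<lambda>i. i \<in> removable L) [0..<Suc n])"
        by (intro sorted_wrt_filter sorted_wrt_upt)
    next
      fix i i' assume "i \<in> set (filter (\<lambda>i. i \<in> removable L) [0..<Suc n])"
        "i' \<in> set (filter (\<lambda>i. i \<in> removable L) [0..<Suc n])" and less: "i < i'"
      then have i: "i \<in> removable L" "i' \<in> removable L" unfolding set_filter by blast+
      show "\<forall>x\<in>set (map (?ext i) (tabs n (rem_box L i))).
          \<forall>y\<in>set (map (?ext i') (tabs n (rem_box L i'))). row_col_clash (Suc n) y x"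
      proof (intro ballI)
        fix x y assume "x \<in> set (map (?ext i) (tabs n (rem_box L i)))"
          "y \<in> set (map (?ext i') (tabs n (rem_box L i')))"
        then obtain T T' where T: "T \<in> set (tabs n (rem_box L i))" "x = ?ext i T"
          and T': "T' \<in> set (tabs n (rem_box L i'))" "y = ?ext i' T'"
          unfolding set_map by blast
        note p = par_rem_box[OF Suc.prems i(1)] par_rem_box[OF Suc.prems i(2)]
        have "row_col_clash n T' T"
          by (rule clash_if_lex_greater[OF tabs_bij[OF p(2) T'(1)] tabs_bij[OF p(1) T(1)] par_decseq[OF p(1)], of i])
            (use less i in \<open>auto simp: rem_box_def removable_def\<close>)
        then show "row_col_clash (Suc n) y x" unfolding T(2) T'(2) by (rule row_col_clash_extend)
      qed
    qed
  qed
  then show ?case by simp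
qed simp

lemma ex_tableau:
  assumes L: "par n L"
  shows "\<exists>T. bij_betw T {..<n} (diag L)"
proof -
  have diag: "diag L = (SIGMA i:{..<n}. {..<L i})"
  proof (intro set_eqI)
    fix c
    have "fst c < n" if "snd c < L (fst c)" using that L by (rule_tac ccontr) (simp add: par_def)
    then show "c \<in> diag L \<longleftrightarrow> c \<in> (SIGMA i:{..<n}. {..<L i})" by (cases c) (auto simp: diag_def)
  qed
  then have "finite (diag L)" by simp
  moreover have "card (diag L) = n" unfolding diag using L by (simp add: par_def)
  ultimately show ?thesis using ex_bij_betw_nat_finite[of "diag L"] by (simp add: atLeast0LessThan)
qed

section \<open>Comparison of \<open>kappa\<close> with the number of standard tableaux\<close>

context group_algebra
begin

lemma csym_same_shape:
  assumes "bij_betw T0 {..<n} (diag L)" "bij_betw T {..<n} (diag L)"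
  obtains g where "g \<in> Sym n" "csym T = delta g \<star> csym T0 \<star> delta (inv g)"
proof -
  obtain h where h: "h \<in> Sym n" "\<And>k. k < n \<Longrightarrow> T0 (h k) = T k"
    using relabel[OF assms] by metis
  have "csym T = csym (T0 \<circ> inv (inv h))"
    by (rule csym_cong) (use h in simp)
  also have "\<dots> = delta (inv h) \<star> csym T0 \<star> delta (inv (inv h))"
    using h conj_csym[of "inv h" T0] by simp
  finally show thesis using h that[of "inv h"] by simp
qed

lemma conj_mult:
  assumes g: "g \<in> Sym n" and y: "y \<in> galg n"
  shows "(delta g \<star> x \<star> delta (inv g)) \<star> (delta g \<star> y \<star> delta (inv g)) = delta g \<star> (x \<star> y) \<star> delta (inv g)"
proof -
  have "delta (inv g) \<star> (delta g \<star> (y \<star> delta (inv g))) = y \<star> delta (inv g)"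
    by (rule delta_inv_delta[OF g]) simp
  then show ?thesis by (simp add: mult_assoc)
qed

lemma tau_conj:
  assumes g: "g \<in> Sym n"
  shows "tau (delta g \<star> x \<star> delta (inv g)) = tau x"
  using g by (simp add: mult_delta delta_mult)

lemma kappa_same_shape:
  assumes "bij_betw T0 {..<n} (diag L)" "bij_betw T {..<n} (diag L)"
  shows "kappa T = kappa T0"
proof -
  obtain g where "g \<in> Sym n" "csym T = delta g \<star> csym T0 \<star> delta (inv g)"
    using csym_same_shape[OF assms] .
  then show ?thesis by (simp add: kappa_def conj_mult tau_conj)
qed

text \<open>A triangular family of quasi-idempotents: the idempotent is built by adding one tableau at a
  time, and its trace counts the tableaux.\<close>
lemma triangular_idempotent:
  assumes T0: "bij_betw T0 {..<n} (diag L)" and L: "decseq L"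
    and "\<And>T. T \<in> set Ts \<Longrightarrow> bij_betw T {..<n} (diag L)"
    and "sorted_wrt (\<lambda>T T'. row_col_clash n T' T) Ts"
  shows "\<exists>r\<in>galg n. r \<star> r = r \<and> tau r = of_nat (length Ts) / kappa T0 \<and> cidem T0 \<star> r = r \<and>
    (\<forall>x. (\<forall>T\<in>set Ts. x \<star> csym T = 0) \<longrightarrow> x \<star> r = 0)"
  using assms(3,4)
proof (induction Ts)
  case Nil
  show ?case
    by (intro bexI[of _ 0] conjI allI impI mult_zero_left mult_zero_right) simp_all
next
  case (Cons T Ts)
  have "\<exists>r\<in>galg n. r \<star> r = r \<and> tau r = of_nat (length Ts) / kappa T0 \<and> cidem T0 \<star> r = r \<and>
    (\<forall>x. (\<forall>T\<in>set Ts. x \<star> csym T = 0) \<longrightarrow> x \<star> r = 0)"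
    by (rule Cons.IH) (use Cons.prems in auto)
  then obtain r where r: "r \<in> galg n" "r \<star> r = r" "tau r = of_nat (length Ts) / kappa T0"
    "cidem T0 \<star> r = r" "\<And>x. (\<And>T. T \<in> set Ts \<Longrightarrow> x \<star> csym T = 0) \<Longrightarrow> x \<star> r = 0"
    by blast
  have T: "bij_betw T {..<n} (diag L)" using Cons.prems by simp
  have k: "kappa T0 \<noteq> 0" by (rule kappa_nonzero[OF T0 L])
  define p where "p = cscale (1 / kappa T0) (csym T)"
  have p_galg: "p \<in> galg n" by (simp add: p_def)
  have pp: "p \<star> p = p"
  proof -
    have "p \<star> p = cscale (1 / kappa T0 * (1 / kappa T0) * kappa T0) (csym T)"
      by (simp only: p_def mult_scale_left mult_scale_right csym_csym[OF T L] kappa_same_shape[OF T0 T] cs.scale_scale)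
        (simp only: mult_ac)
    then show ?thesis using k by (simp add: p_def)
  qed
  have tau_p: "tau p = 1 / kappa T0"
    using tau_csym[of T] T by (simp add: p_def cscale_def bij_betw_def)
  have ep: "cidem T0 \<star> p = p"
  proof -
    obtain g where g: "g \<in> Sym n" "csym T = delta g \<star> csym T0 \<star> delta (inv g)"
      using csym_same_shape[OF T0 T] .
    have "cidem T0 \<star> csym T = csym T"
      unfolding g(2) by (rule cidem_conj[OF T0 L g(1)])
    then show ?thesis by (simp add: p_def mult_scale_right)
  qed
  have pr: "p \<star> r = 0"
  proof (rule r(5))
    fix T' assume T': "T' \<in> set Ts"
    have "csym T \<star> csym T' = row_sum T \<star> (col_sum T \<star> row_sum T') \<star> col_sum T'"
      by (simp add: csym_def mult_assoc)
    moreover have "col_sum T \<star> row_sum T' = 0"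
      using Cons.prems T' by (intro clash_zero(2)) auto
    ultimately have "csym T \<star> csym T' = 0"
      by (simp only: mult_zero_left mult_zero_right)
    then show "p \<star> csym T' = 0" by (simp only: p_def mult_scale_left cs.scale_zero_right)
  qed
  \<comment> \<open>Since \<open>p r = 0\<close>, subtracting \<open>r p\<close> makes the sum
    idempotent, and \<open>tau (r p) = tau (p r) = 0\<close> makes the traces add. The clause on
    annihilators is carried along in the induction precisely to obtain \<open>p r = 0\<close> from
    the clashes.\<close>
  define r' where "r' = p + r - r \<star> p"
  have prx: "p \<star> (r \<star> x) = 0" for x using pr by (simp flip: mult_assoc)
  have ppx: "p \<star> (p \<star> x) = p \<star> x" for x using pp by (simp flip: mult_assoc)
  have rrx: "r \<star> (r \<star> x) = r \<star> x" for x using r(2) by (simp flip: mult_assoc)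
  have "r' \<star> r' = r'"
    unfolding r'_def
    by (simp add: mult_diff_left mult_diff_right mult_add_left mult_add_right mult_assoc pp pr prx rrx r(2))
  moreover have "tau r' = of_nat (length (T # Ts)) / kappa T0"
    using tau_mult_comm[of r p] pr by (simp add: r'_def tau_p r(3) add_divide_distrib)
  moreover have "cidem T0 \<star> r' = r'"
    unfolding r'_def using r(4) ep by (simp add: mult_diff_right mult_add_right flip: mult_assoc)
  moreover have "x \<star> r' = 0" if x: "\<And>T'. T' \<in> set (T # Ts) \<Longrightarrow> x \<star> csym T' = 0" for x
  proof -
    have "x \<star> p = 0" using x[OF list.set_intros(1)] by (simp only: p_def mult_scale_right cs.scale_zero_right)
    moreover have "x \<star> r = 0" using x by (intro r(5)) simp
    ultimately show ?thesis
      by (simp add: r'_def mult_diff_right mult_add_right flip: mult_assoc)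
  qed
  moreover have "r' \<in> galg n" using p_galg r(1) by (simp add: r'_def)
  ultimately show ?case by blast
qed

text \<open>The triangular idempotent \<open>r\<close> lies below \<open>cidem T\<close>, so their
  difference is idempotent and has nonnegative trace:
  \<open>n! / k^2 - f / k \<ge> 0\<close>.\<close>

lemma fd_le:
  assumes L: "par n L" and T: "bij_betw T {..<n} (diag L)" and k: "kappa T = of_real k" "k \<ge> 1"
  shows "real (fd n L) \<le> fact n / k"
proof -
  note dec = par_decseq[OF L]
  obtain r where r: "r \<in> galg n" "r \<star> r = r" "tau r = of_nat (length (tabs n L)) / kappa T"
    "cidem T \<star> r = r"
    using triangular_idempotent[OF T dec tabs_bij[OF L] tabs_clash[OF L]] by blast
  have "r \<star> cidem T = r" using r central_cidem[of T] by (simp add: central_def)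
  then have "(cidem T - r) \<star> (cidem T - r) = cidem T - r"
    using r by (simp add: mult_diff_left mult_diff_right cidem_idem[OF T dec])
  then obtain d :: nat where "fact n * tau (cidem T - r) = of_nat d"
    using tau_idempotent by blast
  moreover have "fact n * tau (cidem T - r) = of_real (fact n * (fact n / k\<^sup>2 - real (fd n L) / k))"
    using r(3) by (simp add: tau_cidem[OF T] length_tabs[OF L] k(1))
  ultimately have "fact n * (fact n / k\<^sup>2 - real (fd n L) / k) = real d"
    by (metis of_real_eq_iff of_real_of_nat_eq)
  then have "fact n * (fact n / k\<^sup>2 - real (fd n L) / k) \<ge> 0" by simp
  then have "real (fd n L) / k \<le> fact n / k\<^sup>2"
    using fact_gt_zero[where 'a = real, of n] by (auto simp: zero_le_mult_iff)
  then show ?thesis using k(2) by (simp add: field_simps power2_eq_square)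
qed

lemma fd_eq:
  assumes L: "par n L" and T: "bij_betw T {..<n} (diag L)"
  shows "kappa T = of_real (fact n / real (fd n L))" "fd n L > 0"
proof -
  define Tb where "Tb L = (SOME T. bij_betw T {..<n} (diag L))" for L
  have Tb: "bij_betw (Tb L) {..<n} (diag L)" if "par n L" for L
    unfolding Tb_def using someI_ex[OF ex_tableau[OF that]] .
  define k where "k L = Re (kappa (Tb L))" for L
  have k: "kappa (Tb L) = of_real (k L)" "k L \<ge> 1" if p: "par n L" for L
  proof -
    obtain r where "r \<ge> 1" "kappa (Tb L) = of_real r"
      using kappa_ge_1[OF Tb[OF p] par_decseq[OF p]] .
    then show "kappa (Tb L) = of_real (k L)" "k L \<ge> 1" by (simp_all add: k_def)
  qed
  define E where "E = (\<Sum>L | par n L. cidem (Tb L))"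
  have orth: "cidem (Tb L) \<star> cidem (Tb M) = (if L = M then cidem (Tb L) else 0)"
    if "par n L" "par n M" for L M
    using cidem_idem[OF Tb[OF that(1)] par_decseq[OF that(1)]]
      cidem_orthogonal[OF Tb[OF that(2)] Tb[OF that(1)] par_decseq[OF that(2)] par_decseq[OF that(1)]]
    by (cases "L = M") simp_all
  have "E \<star> E = (\<Sum>L | par n L. \<Sum>M | par n M. cidem (Tb L) \<star> cidem (Tb M))"
    by (simp only: E_def mult_sum_left) (simp only: mult_sum_right)
  also have "\<dots> = (\<Sum>L | par n L. \<Sum>M | par n M. if L = M then cidem (Tb L) else 0)"
    by (intro sum.cong refl) (simp add: orth)
  also have "\<dots> = E"
    unfolding E_def by (intro sum.cong refl) (simp only: sum.delta' finite_par if_True)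
  finally have EE: "E \<star> E = E" .
  have E_galg: "E \<in> galg n" by (simp add: E_def)
  have "(delta id - E) \<star> (delta id - E) = delta id - E"
    using EE E_galg by (simp add: mult_diff_left mult_diff_right delta_id_left delta_id_right)
  then obtain d :: nat where d: "fact n * tau (delta id - E) = of_nat d"
    using tau_idempotent by blast
  have "tau E = (\<Sum>L | par n L. of_real (fact n / (k L)\<^sup>2))"
    unfolding E_def sum_fun_apply
    by (intro sum.cong refl) (simp add: tau_cidem[OF Tb] k)
  then have "tau (delta id - E) = of_real (1 - (\<Sum>L | par n L. fact n / (k L)\<^sup>2))"
    by (simp add: delta_def)
  then have "of_real (fact n * (1 - (\<Sum>L | par n L. fact n / (k L)\<^sup>2))) = complex_of_real (real d)"
    using d by simp
  then have "fact n * (1 - (\<Sum>L | par n L. fact n / (k L)\<^sup>2)) = real d"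
    by (simp only: of_real_eq_iff)
  then have "(\<Sum>L | par n L. fact n / (k L)\<^sup>2) \<le> 1"
  proof -
    assume "fact n * (1 - (\<Sum>L | par n L. fact n / (k L)\<^sup>2)) = real d"
    then have "0 \<le> fact n * (1 - (\<Sum>L | par n L. fact n / (k L)\<^sup>2))" by simp
    then show ?thesis using fact_gt_zero[where 'a = real, of n] by (auto simp: zero_le_mult_iff)
  qed
  then have "fact n * (\<Sum>L | par n L. fact n / (k L)\<^sup>2) \<le> fact n"
    by simp
  then have le1: "(\<Sum>L | par n L. (fact n / k L)\<^sup>2) \<le> fact n"
    by (simp add: sum_distrib_left power_divide power2_eq_square)
  have le: "(real (fd n L))\<^sup>2 \<le> (fact n / k L)\<^sup>2" if "par n L" for L
    using fd_le[OF that Tb[OF that] k[OF that]] by (intro power_mono) auto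
  have sq: "(real (fd n L))\<^sup>2 = (fact n / k L)\<^sup>2" if "par n L" for L
  proof (rule ccontr)
    assume "(real (fd n L))\<^sup>2 \<noteq> (fact n / k L)\<^sup>2"
    then have "(real (fd n L))\<^sup>2 < (fact n / k L)\<^sup>2" using le[OF that] by simp
    then have "(\<Sum>L | par n L. (real (fd n L))\<^sup>2) < (\<Sum>L | par n L. (fact n / k L)\<^sup>2)"
      using le that by (intro sum_strict_mono_ex1[OF finite_par]) blast+
    then show False using le1 sum_fd_squared[of n] by simp
  qed
  have eq: "real (fd n L) = fact n / k L"
    by (rule power2_eq_imp_eq[OF sq[OF L]]) (use k(2)[OF L] in auto)
  then have pos: "real (fd n L) > 0" using k(2)[OF L] by simp
  then show "fd n L > 0" by simp
  show "kappa T = of_real (fact n / real (fd n L))"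
  proof -
    have "k L = fact n / real (fd n L)" using eq pos k(2)[OF L] by (simp add: field_simps)
    then show ?thesis using kappa_same_shape[OF Tb[OF L] T] k(1)[OF L] by simp
  qed
qed

end

subsection \<open>Traces of permutations on the tensor power\<close>

lemma words_Suc: "words N (Suc n) = (\<lambda>(u, x). u @ [x]) ` (words N n \<times> {..<N})"
proof (intro equalityI subsetI)
  fix w assume w: "w \<in> words N (Suc n)"
  then have "w \<noteq> []" by (auto simp: words_def)
  then have "w = butlast w @ [last w]" by simp
  moreover have "last w \<in> set w" "set (butlast w) \<subseteq> set w" using \<open>w \<noteq> []\<close> by (auto dest: in_set_butlastD)
  moreover have "butlast w \<in> words N n" "last w \<in> {..<N}"
    using w calculation(2,3) by (auto simp: words_def)
  ultimately show "w \<in> (\<lambda>(u, x). u @ [x]) ` (words N n \<times> {..<N})"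
    by (intro image_eqI[of _ _ "(butlast w, last w)"]) auto
qed (auto simp: words_def)

lemma finite_words [simp]: "finite (words N n)"
proof -
  have "words N n = {w. set w \<subseteq> {..<N} \<and> length w = n}" by (auto simp: words_def)
  then show ?thesis by (simp add: finite_lists_length_eq)
qed

text \<open>The trace of the permutation \<open>s\<close> acting on the tensor power.\<close>
definition chi :: "nat \<Rightarrow> nat \<Rightarrow> (nat \<Rightarrow> nat) \<Rightarrow> nat" where
  "chi N n s = card {w \<in> words N n. \<forall>i<n. w ! s i = w ! i}"

text \<open>The new position is a fixed point, hence a cycle of its own with a free letter.\<close>

lemma chi_Suc:
  assumes "s \<in> Sym n"
  shows "chi N (Suc n) s = N * chi N n s"
proof -
  have "{w \<in> words N (Suc n). \<forall>i<Suc n. w ! s i = w ! i} =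
    (\<lambda>(u, x). u @ [x]) ` ({w \<in> words N n. \<forall>i<n. w ! s i = w ! i} \<times> {..<N})"
    (is "?A = ?B")
  proof (intro equalityI subsetI)
    fix w assume "w \<in> ?A"
    then obtain u x where u: "u \<in> words N n" "x < N" "w = u @ [x]"
      and *: "\<And>i. i < Suc n \<Longrightarrow> w ! s i = w ! i"
      by (auto simp: words_Suc)
    have "length u = n" using u by (simp add: words_def)
    then have "u ! s i = u ! i" if "i < n" for i
      using *[of i] that u assms by (simp add: nth_append)
    then show "w \<in> ?B" using u by force
  next
    fix w assume "w \<in> ?B"
    then obtain u x where u: "u \<in> words N n" "x < N" "w = u @ [x]" "\<And>i. i < n \<Longrightarrow> u ! s i = u ! i"
      by auto
    have "length u = n" using u by (simp add: words_def)
    then have "w ! s i = w ! i" if "i < Suc n" for i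
      using that u assms Sym_ge[OF assms, of n] by (cases "i = n") (auto simp: nth_append)
    moreover have "w \<in> words N (Suc n)" using u by (auto simp: words_Suc)
    ultimately show "w \<in> ?A" by simp
  qed
  moreover have "inj_on (\<lambda>(u, x). u @ [x]) A" for A :: "(nat list \<times> nat) set"
    by (auto simp: inj_on_def)
  ultimately show ?thesis by (simp add: chi_def card_image card_cartesian_product)
qed

text \<open>The transposition inserts \<open>n\<close> into the cycle of \<open>x\<close>, so the
  last letter of a fixed word is forced to be its letter at \<open>x\<close>.\<close>

lemma chi_Suc_transpose:
  assumes s: "s \<in> Sym n" and x: "x < n"
  shows "chi N (Suc n) (s \<circ> transpose x n) = chi N n s"
proof -
  have "s n = n" using Sym_ge[OF s, of n] by simp
  moreover have "s i < n \<longleftrightarrow> i < n" for i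
    using Sym_ge[OF s, of i] Sym_lt[OF s, of i] by (cases "i < n") auto
  ultimately have sx: "s i < n \<longleftrightarrow> i < n" "s n = n" for i by blast+
  have "{w \<in> words N (Suc n). \<forall>i<Suc n. w ! (s \<circ> transpose x n) i = w ! i} =
    (\<lambda>u. u @ [u ! x]) ` {w \<in> words N n. \<forall>i<n. w ! s i = w ! i}" (is "?A = ?B")
  proof (intro equalityI subsetI)
    fix w assume "w \<in> ?A"
    then obtain u y where u: "u \<in> words N n" "y < N" "w = u @ [y]"
      and *: "\<And>i. i < Suc n \<Longrightarrow> w ! s (transpose x n i) = w ! i"
      by (auto simp: words_Suc)
    have len: "length u = n" using u by (simp add: words_def)
    have y: "y = u ! x" using *[of x] x len u sx by (simp add: nth_append)
    have "u ! s i = u ! i" if "i < n" for i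
    proof (cases "i = x")
      case True
      then show ?thesis using *[of n] x len u sx y by (simp add: nth_append)
    next
      case False
      then show ?thesis using *[of i] that len u sx by (simp add: nth_append transpose_def)
    qed
    then show "w \<in> ?B" using u y by auto
  next
    fix w assume "w \<in> ?B"
    then obtain u where u: "u \<in> words N n" "\<And>i. i < n \<Longrightarrow> u ! s i = u ! i" "w = u @ [u ! x]" by auto
    have len: "length u = n" using u by (simp add: words_def)
    have "u ! x \<in> set u" using x len by simp
    moreover have "set u \<subseteq> {..<N}" using u(1) by (simp add: words_def)
    ultimately have "u ! x < N" by blast
    then have "w \<in> words N (Suc n)" using u by (auto simp: words_Suc)
    moreover have "w ! s (transpose x n i) = w ! i" if "i < Suc n" for i
      using that u(2) x len sx by (auto simp: u(3) nth_append transpose_def)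
    ultimately show "w \<in> ?A" by simp
  qed
  moreover have "inj_on (\<lambda>u. u @ [u ! x]) A" for A :: "nat list set"
    by (auto simp: inj_on_def)
  ultimately show ?thesis by (simp add: chi_def card_image)
qed

lemma chi_comm:
  assumes s: "s \<in> Sym n" and t: "t \<in> Sym n"
  shows "chi N n (s \<circ> t) = chi N n (t \<circ> s)"
proof -
  define act where "act s w = map (\<lambda>i. w ! s i) [0..<n]" for s and w :: "nat list"
  have act_words: "act s w \<in> words N n" if "s \<in> Sym n" "w \<in> words N n" for s w
    using that by (auto simp: act_def words_def subset_iff)
  have act_act: "act s (act s' w) = w" if "s \<in> Sym n" "w \<in> words N n" "s' \<circ> s = id" for s s' w
    using that by (auto simp: act_def words_def list_eq_iff_nth_eq fun_eq_iff)
  have "bij_betw (act s) {w \<in> words N n. \<forall>i<n. w ! (s \<circ> t) i = w ! i} {w \<in> words N n. \<forall>i<n. w ! (t \<circ> s) i = w ! i}"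
  proof (rule bij_betw_byWitness[where f' = "act (inv s)"])
    show "\<forall>a\<in>{w \<in> words N n. \<forall>i<n. w ! (s \<circ> t) i = w ! i}. act (inv s) (act s a) = a"
      using s by (auto intro: act_act)
    show "\<forall>a\<in>{w \<in> words N n. \<forall>i<n. w ! (t \<circ> s) i = w ! i}. act s (act (inv s) a) = a"
      using s by (auto intro: act_act)
    show "act s ` {w \<in> words N n. \<forall>i<n. w ! (s \<circ> t) i = w ! i} \<subseteq> {w \<in> words N n. \<forall>i<n. w ! (t \<circ> s) i = w ! i}"
      using s t by (auto simp: act_words) (simp add: act_def)
    show "act (inv s) ` {w \<in> words N n. \<forall>i<n. w ! (t \<circ> s) i = w ! i} \<subseteq> {w \<in> words N n. \<forall>i<n. w ! (s \<circ> t) i = w ! i}"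
    proof clarify
      fix w assume w: "w \<in> words N n" "\<forall>i<n. w ! (t \<circ> s) i = w ! i"
      have "act (inv s) w ! s (t i) = act (inv s) w ! i" if "i < n" for i
        using that s t w(2)[rule_format, of "inv s i"] by (simp add: act_def)
      then show "act (inv s) w \<in> words N n \<and> (\<forall>i<n. act (inv s) w ! (s \<circ> t) i = act (inv s) w ! i)"
        using act_words s w(1) by simp
    qed
  qed
  then show ?thesis unfolding chi_def by (rule bij_betw_same_card)
qed

section \<open>Coset decompositions of row and column groups\<close>

lemma Sym_Suc_fix:
  assumes "p \<in> Sym (Suc n)" "p n = n"
  shows "p \<in> Sym n"
  using assms unfolding Sym_def
  by (auto intro!: permutes_superset[where S = "{0..<Suc n}"] simp: less_Suc_eq)

lemma Sym_Suc: "p \<in> Sym n \<Longrightarrow> p \<in> Sym (Suc n)"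
  unfolding Sym_def by (auto intro: permutes_subset)

abbreviation row_grp where "row_grp \<equiv> group_algebra.row_grp"
abbreviation col_grp where "col_grp \<equiv> group_algebra.col_grp"

lemma row_grp_iff: "p \<in> row_grp n T \<longleftrightarrow> p \<in> Sym n \<and> (\<forall>k<n. fst (T (p k)) = fst (T k))"
  by (simp add: group_algebra.row_grp_def)

lemma col_grp_iff: "p \<in> col_grp n T \<longleftrightarrow> p \<in> Sym n \<and> (\<forall>k<n. snd (T (p k)) = snd (T k))"
  by (simp add: group_algebra.col_grp_def)

lemma row_grp_strip:
  assumes p: "p \<in> row_grp (Suc n) T" and x: "x < Suc n" "p x = n"
  shows "p \<circ> transpose x n \<in> row_grp n T" "fst (T x) = fst (T n)"
proof -
  have pS: "p \<in> Sym (Suc n)" and pT: "\<And>k. k < Suc n \<Longrightarrow> fst (T (p k)) = fst (T k)"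
    using p by (simp_all add: row_grp_iff)
  show eq: "fst (T x) = fst (T n)" using pT[OF x(1)] x(2) by simp
  have "p \<circ> transpose x n \<in> Sym (Suc n)"
    by (intro Sym_comp Sym_transpose pS x lessI)
  then have "p \<circ> transpose x n \<in> Sym n"
    by (rule Sym_Suc_fix) (simp add: x)
  moreover have "fst (T ((p \<circ> transpose x n) k)) = fst (T k)" if "k < n" for k
  proof (cases "k = x")
    case True
    then show ?thesis using pT[of n] eq by simp
  next
    case False
    then show ?thesis using pT[of k] that by (simp add: transpose_def)
  qed
  ultimately show "p \<circ> transpose x n \<in> row_grp n T" by (simp only: row_grp_iff) blast
qed

lemma row_grp_extend:
  assumes p: "p \<in> row_grp n T" and x: "x < Suc n" "fst (T x) = fst (T n)"
  shows "p \<circ> transpose x n \<in> row_grp (Suc n) T" "inv (p \<circ> transpose x n) n = x"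
proof -
  have pS: "p \<in> Sym n" using p by (simp only: row_grp_iff)
  have pn: "p n = n" "inv p n = n"
    by (rule Sym_ge[OF pS], simp, rule Sym_ge[OF Sym_inv[OF pS]], simp)
  have S: "p \<circ> transpose x n \<in> Sym (Suc n)"
    by (intro Sym_comp Sym_transpose Sym_Suc[OF pS] x lessI)
  have "(p \<circ> transpose x n) x = n" using pn by simp
  then show "inv (p \<circ> transpose x n) n = x" using Sym_inv_apply(2)[OF S, of x] by simp
  have pT: "fst (T (p k)) = fst (T k)" if "k < Suc n" for k
  proof (cases "k = n")
    case False
    then have "k < n" using that by simp
    then show ?thesis using p unfolding row_grp_iff by blast
  qed (simp add: pn)
  have "fst (T ((p \<circ> transpose x n) k)) = fst (T k)" if "k < Suc n" for k
  proof -
    have "transpose x n k < Suc n" using that x by (simp add: transpose_def)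
    then have "fst (T (p (transpose x n k))) = fst (T (transpose x n k))" by (rule pT)
    also have "\<dots> = fst (T k)" using x by (simp add: transpose_def)
    finally show ?thesis by simp
  qed
  with S show "p \<circ> transpose x n \<in> row_grp (Suc n) T" unfolding row_grp_iff by blast
qed

text \<open>Cosets of the stabilizer of \<open>n\<close> in the row group are represented by the
  transpositions \<open>(x n)\<close> with \<open>x\<close> in the row of \<open>n\<close>; the
  value \<open>x = n\<close> stands for the identity.\<close>

lemma sum_row_grp_Suc:
  "(\<Sum>p\<in>row_grp (Suc n) T. F p) =
   (\<Sum>p\<in>row_grp n T. \<Sum>x | x < Suc n \<and> fst (T x) = fst (T n). F (p \<circ> transpose x n) :: complex)"
proof -
  have inv_n: "inv p n < Suc n" "p (inv p n) = n" if "p \<in> row_grp (Suc n) T" for p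
  proof -
    have pS: "p \<in> Sym (Suc n)" using that by (simp only: row_grp_iff)
    show "inv p n < Suc n" "p (inv p n) = n"
      by (rule Sym_lt[OF Sym_inv[OF pS] lessI], rule Sym_inv_apply(1)[OF pS])
  qed
  have "(\<Sum>p\<in>row_grp (Suc n) T. F p) =
    (\<Sum>a\<in>row_grp n T \<times> {x. x < Suc n \<and> fst (T x) = fst (T n)}. F (fst a \<circ> transpose (snd a) n))"
  proof (rule sum.reindex_bij_witness[of _ "\<lambda>a. fst a \<circ> transpose (snd a) n" "\<lambda>p. (p \<circ> transpose (inv p n) n, inv p n)"])
    fix p assume p: "p \<in> row_grp (Suc n) T"
    note inv_n[OF p]
    from row_grp_strip[OF p this] this
    show "(p \<circ> transpose (inv p n) n, inv p n) \<in> row_grp n T \<times> {x. x < Suc n \<and> fst (T x) = fst (T n)}"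
      by blast
  next
    fix a assume "a \<in> row_grp n T \<times> {x. x < Suc n \<and> fst (T x) = fst (T n)}"
    then have a: "fst a \<in> row_grp n T" "snd a < Suc n" "fst (T (snd a)) = fst (T n)" by auto
    show "fst a \<circ> transpose (snd a) n \<in> row_grp (Suc n) T"
      by (rule row_grp_extend[OF a])
    show "(fst a \<circ> transpose (snd a) n \<circ> transpose (inv (fst a \<circ> transpose (snd a) n) n) n,
        inv (fst a \<circ> transpose (snd a) n) n) = a"
      by (simp only: row_grp_extend(2)[OF a] comp_assoc transpose_comp_involutory comp_id prod.collapse)
  qed (simp_all only: fst_conv snd_conv comp_assoc transpose_comp_involutory comp_id)
  then show ?thesis by (simp only: sum.cartesian_product case_prod_unfold)
qed

lemma col_grp_eq_row_grp: "col_grp n T = row_grp n (prod.swap \<circ> T)"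
  by (auto simp: row_grp_iff col_grp_iff)

lemma sum_col_grp_inv: "(\<Sum>q\<in>col_grp n T. F (inv q)) = (\<Sum>q\<in>col_grp n T. F q)"
proof -
  have "inv (inv q) = q" if "q \<in> col_grp n T" for q
    using that by (intro Sym_inv_inv[of q n]) (simp only: col_grp_iff)
  then show ?thesis
    by (intro sum.reindex_bij_witness[of _ inv inv] group_algebra.col_grp_inv) simp_all
qed

text \<open>Inversion puts the coset representative on the left, so that in a product
  \<open>p \<circ> q\<close> of a row and a column permutation the two representatives meet in the
  middle.\<close>

lemma sum_col_grp_Suc:
  "(\<Sum>q\<in>col_grp (Suc n) T. F q) =
   (\<Sum>q\<in>col_grp n T. \<Sum>y | y < Suc n \<and> snd (T y) = snd (T n). F (transpose y n \<circ> q) :: complex)"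
proof -
  have "(\<Sum>q\<in>col_grp (Suc n) T. F q) = (\<Sum>q\<in>col_grp (Suc n) T. F (inv q))"
    by (rule sum_col_grp_inv[symmetric])
  also have "\<dots> = (\<Sum>q\<in>col_grp n T. \<Sum>y | y < Suc n \<and> snd (T y) = snd (T n). F (inv (q \<circ> transpose y n)))"
    unfolding col_grp_eq_row_grp by (subst sum_row_grp_Suc) (simp only: o_apply prod.swap_def fst_conv)
  also have "\<dots> = (\<Sum>q\<in>col_grp n T. \<Sum>y | y < Suc n \<and> snd (T y) = snd (T n). F (transpose y n \<circ> inv q))"
  proof (intro sum.cong refl)
    fix q y assume "q \<in> col_grp n T" "y \<in> {y. y < Suc n \<and> snd (T y) = snd (T n)}"
    then have "q \<in> Sym (Suc n)" "transpose y n \<in> Sym (Suc n)"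
      by (simp_all add: col_grp_iff Sym_Suc)
    then have "inv (q \<circ> transpose y n) = inv (transpose y n) \<circ> inv q" by (rule Sym_inv_distrib)
    then show "F (inv (q \<circ> transpose y n)) = F (transpose y n \<circ> inv q)" by simp
  qed
  also have "\<dots> = (\<Sum>q\<in>col_grp n T. \<Sum>y | y < Suc n \<and> snd (T y) = snd (T n). F (transpose y n \<circ> q))"
    by (rule sum_col_grp_inv)
  finally show ?thesis .
qed

subsection \<open>The content product\<close>

abbreviation csym where "csym \<equiv> group_algebra.csym"

definition tensor_trace :: "nat \<Rightarrow> nat \<Rightarrow> ((nat \<Rightarrow> nat) \<Rightarrow> complex) \<Rightarrow> complex" where
  "tensor_trace N n x = (\<Sum>s\<in>Sym n. x s * of_nat (chi N n s))"

lemma tensor_trace_conj: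
  assumes g: "g \<in> Sym n"
  shows "tensor_trace N n (galg_mult n (galg_mult n (delta g) x) (delta (inv g))) = tensor_trace N n x"
proof -
  interpret ga: group_algebra n .
  have "tensor_trace N n (galg_mult n (galg_mult n (delta g) x) (delta (inv g))) =
      (\<Sum>s\<in>Sym n. x (inv g \<circ> (s \<circ> g)) * of_nat (chi N n s))"
    unfolding tensor_trace_def
    using g by (intro sum.cong refl) (simp add: ga.mult_delta ga.delta_mult)
  also have "\<dots> = (\<Sum>s\<in>Sym n. x (inv g \<circ> (s \<circ> g)) * of_nat (chi N n (inv g \<circ> (s \<circ> g))))"
  proof (intro sum.cong refl)
    fix s assume s: "s \<in> Sym n"
    have "chi N n (inv g \<circ> (s \<circ> g)) = chi N n (s \<circ> g \<circ> inv g)"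
      by (rule chi_comm) (use g s in simp_all)
    then show "x (inv g \<circ> (s \<circ> g)) * of_nat (chi N n s) = x (inv g \<circ> (s \<circ> g)) * of_nat (chi N n (inv g \<circ> (s \<circ> g)))"
      using g by (simp add: comp_assoc)
  qed
  also have "\<dots> = (\<Sum>s\<in>Sym n. x (inv g \<circ> s) * of_nat (chi N n (inv g \<circ> s)))"
    by (rule sum_Sym_right[OF g])
  also have "\<dots> = (\<Sum>s\<in>Sym n. x s * of_nat (chi N n s))"
    by (rule sum_Sym_left[OF Sym_inv[OF g]])
  finally show ?thesis by (simp add: tensor_trace_def)
qed

lemma tensor_trace_csym:
  "tensor_trace N n (csym n T) =
    (\<Sum>p\<in>row_grp n T. \<Sum>q\<in>col_grp n T. of_int (sign q) * of_nat (chi N n (p \<circ> q)))"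
proof -
  interpret ga: group_algebra n .
  have "tensor_trace N n (csym n T) =
    (\<Sum>s\<in>Sym n. \<Sum>t\<in>Sym n. ga.row_sum T t * ga.col_sum T (inv t \<circ> s) * of_nat (chi N n s))"
    unfolding tensor_trace_def ga.csym_def
    by (intro sum.cong refl) (simp add: ga.mult_apply sum_distrib_right)
  also have "\<dots> = (\<Sum>t\<in>Sym n. \<Sum>s\<in>Sym n. ga.row_sum T t * ga.col_sum T (inv t \<circ> s) * of_nat (chi N n s))"
    by (rule sum.swap)
  also have "\<dots> = (\<Sum>t\<in>Sym n. \<Sum>s\<in>Sym n. ga.row_sum T t * ga.col_sum T (inv t \<circ> (t \<circ> s)) * of_nat (chi N n (t \<circ> s)))"
    by (intro sum.cong refl sum_Sym_left[symmetric])
  also have "\<dots> = (\<Sum>t\<in>Sym n. \<Sum>s\<in>Sym n. ga.row_sum T t * ga.col_sum T s * of_nat (chi N n (t \<circ> s)))"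
    by (intro sum.cong refl) (simp only: Sym_inv_comp')
  also have "\<dots> = (\<Sum>t\<in>row_grp n T. \<Sum>s\<in>Sym n. ga.row_sum T t * ga.col_sum T s * of_nat (chi N n (t \<circ> s)))"
    by (rule sum.mono_neutral_right) (auto simp: ga.row_grp_Sym ga.row_sum_def)
  also have "\<dots> = (\<Sum>t\<in>row_grp n T. \<Sum>s\<in>col_grp n T. of_int (sign s) * of_nat (chi N n (t \<circ> s)))"
  proof (rule sum.cong[OF refl])
    fix t assume t: "t \<in> row_grp n T"
    show "(\<Sum>s\<in>Sym n. ga.row_sum T t * ga.col_sum T s * of_nat (chi N n (t \<circ> s))) =
        (\<Sum>s\<in>col_grp n T. of_int (sign s) * of_nat (chi N n (t \<circ> s)))"
      by (rule sum.mono_neutral_cong_right) (use t in \<open>auto simp: ga.col_grp_Sym ga.row_sum_def ga.col_sum_def\<close>)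
  qed
  finally show ?thesis .
qed

lemma transpose_two: "x \<noteq> y \<Longrightarrow> x \<noteq> n \<Longrightarrow> y \<noteq> n \<Longrightarrow>
    transpose x n \<circ> transpose y n = transpose x y \<circ> transpose x n"
  by (auto simp: fun_eq_iff transpose_def)

lemma transpose_exchange: "x \<noteq> y \<Longrightarrow> x \<noteq> z \<Longrightarrow> y \<noteq> z \<Longrightarrow>
    transpose y z \<circ> transpose x y = transpose x y \<circ> transpose x z"
  by (auto simp: fun_eq_iff transpose_def)

text \<open>By cyclicity the factor \<open>(x n)\<close> can be brought to the end, where
  \<open>chi_Suc_transpose\<close> removes it. Two transpositions with \<open>n\<close> are first
  rewritten as \<open>(x y)(x n)\<close>.\<close>

lemma chi_sandwich:
  assumes p: "p \<in> Sym n" and q: "q \<in> Sym n"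
  shows "chi N (Suc n) (p \<circ> q) = N * chi N n (p \<circ> q)"
    and "x < n \<Longrightarrow> chi N (Suc n) (p \<circ> (transpose x n \<circ> q)) = chi N n (p \<circ> q)"
    and "x < n \<Longrightarrow> y < n \<Longrightarrow> x \<noteq> y \<Longrightarrow>
      chi N (Suc n) (p \<circ> (transpose x n \<circ> (transpose y n \<circ> q))) = chi N n (p \<circ> (transpose x y \<circ> q))"
proof -
  show "chi N (Suc n) (p \<circ> q) = N * chi N n (p \<circ> q)" using p q by (intro chi_Suc) simp
  have gen: "chi N (Suc n) (r \<circ> (transpose x n \<circ> q)) = chi N n (r \<circ> q)" if r: "r \<in> Sym n" and x: "x < n" for r x
  proof -
    have "chi N (Suc n) (r \<circ> transpose x n \<circ> q) = chi N (Suc n) (q \<circ> (r \<circ> transpose x n))"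
      by (rule chi_comm) (use r x q in \<open>simp_all add: Sym_Suc\<close>)
    also have "\<dots> = chi N (Suc n) (q \<circ> r \<circ> transpose x n)" by (simp only: comp_assoc)
    also have "\<dots> = chi N n (q \<circ> r)" by (rule chi_Suc_transpose) (use r x q in simp_all)
    also have "\<dots> = chi N n (r \<circ> q)" by (rule chi_comm[OF q r])
    finally show ?thesis by (simp only: comp_assoc)
  qed
  show "chi N (Suc n) (p \<circ> (transpose x n \<circ> q)) = chi N n (p \<circ> q)" if "x < n"
    by (rule gen[OF p that])
  show "chi N (Suc n) (p \<circ> (transpose x n \<circ> (transpose y n \<circ> q))) = chi N n (p \<circ> (transpose x y \<circ> q))"
    if "x < n" "y < n" "x \<noteq> y"
  proof -
    have "transpose x n \<circ> transpose y n = transpose x y \<circ> transpose x n"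
      by (rule transpose_two) (use that in auto)
    then have "transpose x n \<circ> (transpose y n \<circ> q) = transpose x y \<circ> (transpose x n \<circ> q)"
      by (metis comp_assoc)
    then have "p \<circ> (transpose x n \<circ> (transpose y n \<circ> q)) = (p \<circ> transpose x y) \<circ> (transpose x n \<circ> q)"
      by (simp only: comp_assoc)
    then show ?thesis using gen[of "p \<circ> transpose x y" x] p that by (simp add: comp_assoc)
  qed
qed

text \<open>With \<open>z\<close> the cell in the row of \<open>y\<close> and the column of \<open>x\<close>, one has
  \<open>(y z)(x y) = (x y)(x z)\<close>; absorbing \<open>(y z)\<close> on the left and \<open>(x z)\<close> on the right changes the sign.\<close>
lemma exchange_cancel:
  assumes xyz: "x < n" "y < n" "z < n" "x \<noteq> y" "x \<noteq> z" "y \<noteq> z"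
    and z: "fst (T z) = fst (T y)" "snd (T z) = snd (T x)"
  shows "(\<Sum>p\<in>row_grp n T. \<Sum>q\<in>col_grp n T. of_int (sign q) * of_nat (chi N n (p \<circ> (transpose x y \<circ> q)))) = (0::complex)"
    (is "?S = 0")
proof -
  interpret ga: group_algebra n .
  have yz: "transpose y z \<in> row_grp n T" and xz: "transpose x z \<in> col_grp n T"
    using xyz z by (auto simp: row_grp_iff col_grp_iff transpose_def)
  have "?S = (\<Sum>p\<in>row_grp n T. \<Sum>q\<in>col_grp n T. of_int (sign q) * of_nat (chi N n (p \<circ> transpose y z \<circ> (transpose x y \<circ> q))))"
    by (rule sum.reindex_bij_witness[of _ "\<lambda>p. p \<circ> transpose y z" "\<lambda>p. p \<circ> transpose y z"])
      (simp_all add: ga.row_grp_comp yz comp_assoc)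
  also have "\<dots> = (\<Sum>p\<in>row_grp n T. \<Sum>q\<in>col_grp n T. - (of_int (sign (transpose x z \<circ> q)) * of_nat (chi N n (p \<circ> (transpose x y \<circ> (transpose x z \<circ> q))))))"
  proof (intro sum.cong refl)
    fix p q assume "p \<in> row_grp n T" "q \<in> col_grp n T"
    then have "sign (transpose x z \<circ> q) = - sign q"
      using Sym_sign_comp[OF Sym_transpose[OF xyz(1,3)] ga.col_grp_Sym, of q T] xyz by (simp add: sign_swap_id)
    moreover have "p \<circ> transpose y z \<circ> (transpose x y \<circ> q) = p \<circ> (transpose x y \<circ> (transpose x z \<circ> q))"
      using transpose_exchange[OF xyz(4-6)] by (metis comp_assoc)
    ultimately show "of_int (sign q) * of_nat (chi N n (p \<circ> transpose y z \<circ> (transpose x y \<circ> q))) =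
      - (of_int (sign (transpose x z \<circ> q)) * of_nat (chi N n (p \<circ> (transpose x y \<circ> (transpose x z \<circ> q))))::complex)"
      by simp
  qed
  also have "\<dots> = (\<Sum>p\<in>row_grp n T. \<Sum>q\<in>col_grp n T. - (of_int (sign q) * of_nat (chi N n (p \<circ> (transpose x y \<circ> q)))))"
  proof (rule sum.cong[OF refl])
    fix p
    have inv: "transpose x z \<circ> (transpose x z \<circ> q) = q" for q :: "nat \<Rightarrow> nat"
      by (simp flip: comp_assoc)
    show "(\<Sum>q\<in>col_grp n T. - (of_int (sign (transpose x z \<circ> q)) * of_nat (chi N n (p \<circ> (transpose x y \<circ> (transpose x z \<circ> q)))))) =
      (\<Sum>q\<in>col_grp n T. - (of_int (sign q) * of_nat (chi N n (p \<circ> (transpose x y \<circ> q)))) :: complex)"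
      by (rule sum.reindex_bij_witness[of _ "\<lambda>q. transpose x z \<circ> q" "\<lambda>q. transpose x z \<circ> q"])
        (simp_all add: ga.col_grp_comp xz inv)
  qed
  also have "\<dots> = - ?S" by (simp only: sum_negf)
  finally show ?thesis by simp
qed

text \<open>The coset representatives form pairs: \<open>(n, n)\<close> contributes
  \<open>N\<close>, each of the \<open>L i - 1\<close> cells to the left of the corner contributes
  1, each of the \<open>i\<close> cells above it contributes -1, and the mixed pairs vanish by
  \<open>exchange_cancel\<close>. The total is \<open>N\<close> plus the content of the
  corner.\<close>

lemma tensor_trace_remove_corner:
  assumes L: "decseq L" and i: "i \<in> removable L" and T: "bij_betw T {..<Suc n} (diag L)"
    and Tn: "T n = (i, L i - 1)"
  shows "bij_betw T {..<n} (diag (rem_box L i))"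
    and "tensor_trace N (Suc n) (csym (Suc n) T) =
      of_real (content_wt N 1 (rem_box L i) i) * tensor_trace N n (csym n T)"
proof -
  have inj: "T x \<noteq> T y" if "x < Suc n" "y < Suc n" "x \<noteq> y" for x y
    using bij_betw_imp_inj_on[OF T] that by (auto dest: inj_onD)
  have "T n \<in> diag L" using T by (auto simp: bij_betw_def)
  then have "bij_betw T ({..<Suc n} - {n}) (diag L - {T n})"
    using T by (intro bij_betw_DiffI) auto
  moreover have "{..<Suc n} - {n} = {..<n}" by auto
  moreover have "diag L - {T n} = diag (rem_box L i)"
    using diag_rem_box[OF i] Tn by auto
  ultimately show T': "bij_betw T {..<n} (diag (rem_box L i))" by simp
  define X where "X = {x. x < n \<and> fst (T x) = i}"
  define Y where "Y = {y. y < n \<and> snd (T y) = L i - 1}"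
  have fin: "finite X" "finite Y" by (simp_all add: X_def Y_def)
  have nXY: "n \<notin> X" "n \<notin> Y" by (simp_all add: X_def Y_def)
  have X': "{x. x < Suc n \<and> fst (T x) = fst (T n)} = insert n X"
    by (auto simp: X_def Tn)
  have Y': "{y. y < Suc n \<and> snd (T y) = snd (T n)} = insert n Y"
    by (auto simp: Y_def Tn)
  have XY: "x \<noteq> y" if "x \<in> X" "y \<in> Y" for x y
    using inj[of x n] that by (auto simp: X_def Y_def Tn prod_eq_iff)
  have card_X: "card X = L i - 1"
    using row_card[OF T', of i] by (simp add: X_def rem_box_def)
  have card_Y: "card Y = i"
  proof -
    have "T ` Y = {c \<in> T ` {..<n}. snd c = L i - 1}" by (auto simp: Y_def)
    also have "\<dots> = {c \<in> diag (rem_box L i). snd c = L i - 1}" using T' by (simp add: bij_betw_def)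
    also have "\<dots> = (\<lambda>k. (k, L i - 1)) ` {..<i}"
    proof (intro equalityI subsetI)
      fix c assume "c \<in> {c \<in> diag (rem_box L i). snd c = L i - 1}"
      then obtain k where c: "c = (k, L i - 1)" "L i - 1 < rem_box L i k" by (auto simp: diag_def)
      have "k < i"
      proof (rule ccontr)
        assume "\<not> k < i"
        then have "k = i \<or> L k \<le> L (Suc i)" using decseqD[OF L, of "Suc i" k] by (cases "k = i") auto
        with c(2) i show False by (auto simp: rem_box_def removable_def split: if_splits)
      qed
      with c show "c \<in> (\<lambda>k. (k, L i - 1)) ` {..<i}" by auto
    next
      fix c assume "c \<in> (\<lambda>k. (k, L i - 1)) ` {..<i}"
      then obtain k where c: "c = (k, L i - 1)" "k < i" by auto
      then have "L i \<le> L k" "0 < L i" using decseqD[OF L, of k i] i by (auto simp: removable_def)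
      with c show "c \<in> {c \<in> diag (rem_box L i). snd c = L i - 1}"
        by (auto simp: diag_def rem_box_def)
    qed
    finally have "card (T ` Y) = i" by (simp add: card_image inj_on_def)
    moreover have "inj_on T Y"
      by (rule inj_on_subset[OF bij_betw_imp_inj_on[OF T']]) (auto simp: Y_def)
    ultimately show ?thesis by (simp add: card_image)
  qed
  let ?R = "row_grp n T" and ?C = "col_grp n T"
  let ?f = "\<lambda>p x y q. of_int (sign (transpose y n \<circ> q)) * of_nat (chi N (Suc n) (p \<circ> (transpose x n \<circ> (transpose y n \<circ> q)))) :: complex"
  let ?g = "\<lambda>p q. of_int (sign q) * of_nat (chi N n (p \<circ> q)) :: complex"
  let ?h = "\<lambda>p x y q. of_int (sign q) * of_nat (chi N n (p \<circ> (transpose x y \<circ> q))) :: complex"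
  have step: "(\<Sum>x\<in>insert n X. \<Sum>y\<in>insert n Y. ?f p x y q) =
      (of_nat N + of_nat (card X) - of_nat (card Y)) * ?g p q - (\<Sum>x\<in>X. \<Sum>y\<in>Y. ?h p x y q)"
    if p: "p \<in> ?R" and q: "q \<in> ?C" for p q
  proof -
    have pS: "p \<in> Sym n" and qS: "q \<in> Sym n" using p q by (simp_all add: row_grp_iff col_grp_iff)
    have sgn: "sign (transpose y n \<circ> q) = - sign q" if "y < n" for y
      using Sym_sign_comp[OF Sym_transpose Sym_Suc[OF qS], of y n] that by (simp add: sign_swap_id)
    have "?f p n n q = of_nat N * ?g p q"
      using chi_sandwich(1)[OF pS qS] by simp
    moreover have "?f p n y q = - ?g p q" if "y \<in> Y" for y
      using chi_sandwich(2)[OF pS qS, of y] sgn[of y] that by (simp add: Y_def)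
    moreover have "?f p x n q = ?g p q" if "x \<in> X" for x
      using chi_sandwich(2)[OF pS qS, of x] that by (simp add: X_def)
    moreover have "?f p x y q = - ?h p x y q" if "x \<in> X" "y \<in> Y" for x y
      using chi_sandwich(3)[OF pS qS, of x y] sgn[of y] that XY[OF that] by (simp add: X_def Y_def)
    ultimately have "(\<Sum>x\<in>insert n X. \<Sum>y\<in>insert n Y. ?f p x y q) =
       of_nat N * ?g p q + (\<Sum>y\<in>Y. - ?g p q) + ((\<Sum>x\<in>X. ?g p q) + (\<Sum>x\<in>X. \<Sum>y\<in>Y. - ?h p x y q))"
      using fin nXY by (simp only: sum.insert sum.distrib not_False_eq_True) (simp only: add_ac cong: sum.cong)
    then show ?thesis by (simp only: sum_negf sum_constant) (simp add: algebra_simps)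
  qed
  \<comment> \<open>The entry \<open>y\<close> lies above the corner and \<open>x\<close> to its
    left, so the cell in the row of \<open>y\<close> and the column of \<open>x\<close> belongs to
    the diagram; its entry is the \<open>z\<close> required by
    \<open>exchange_cancel\<close>.\<close>
  have cancel: "(\<Sum>p\<in>?R. \<Sum>q\<in>?C. ?h p x y q) = 0" if x: "x \<in> X" and y: "y \<in> Y" for x y
  proof -
    have "T x \<in> diag (rem_box L i)" "T y \<in> diag (rem_box L i)"
      using T' x y by (auto simp: X_def Y_def bij_betw_def)
    then have *: "snd (T x) < L i - 1" "L i - 1 < rem_box L i (fst (T y))"
      using x y by (auto simp: X_def Y_def diag_def rem_box_def split: if_splits)
    then have "(fst (T y), snd (T x)) \<in> diag (rem_box L i)" by (auto simp: diag_def)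
    then obtain z where z: "z < n" "T z = (fst (T y), snd (T x))"
      using T' by (auto simp: bij_betw_def image_iff set_eq_iff) (metis lessThan_iff)
    have neq: "fst (T y) \<noteq> i" using *(2) by (auto simp: rem_box_def)
    show ?thesis
    proof (rule exchange_cancel)
      show Tz: "fst (T z) = fst (T y)" "snd (T z) = snd (T x)" using z by simp_all
      show "x < n" "y < n" "z < n" using x y z by (simp_all add: X_def Y_def)
      show "x \<noteq> y" by (rule XY[OF x y])
      show "x \<noteq> z" using Tz(1) neq x by (auto simp: X_def)
      show "y \<noteq> z" using Tz(2) *(1) y by (auto simp: Y_def)
    qed
  qed
  have "tensor_trace N (Suc n) (csym (Suc n) T) = (\<Sum>p\<in>?R. \<Sum>x\<in>insert n X. \<Sum>q\<in>?C. \<Sum>y\<in>insert n Y. ?f p x y q)"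
    unfolding tensor_trace_csym sum_row_grp_Suc sum_col_grp_Suc X' Y' by (simp only: comp_assoc)
  also have "\<dots> = (\<Sum>p\<in>?R. \<Sum>q\<in>?C. \<Sum>x\<in>insert n X. \<Sum>y\<in>insert n Y. ?f p x y q)"
    by (intro sum.cong refl sum.swap)
  also have "\<dots> = (\<Sum>p\<in>?R. \<Sum>q\<in>?C. (of_nat N + of_nat (card X) - of_nat (card Y)) * ?g p q - (\<Sum>x\<in>X. \<Sum>y\<in>Y. ?h p x y q))"
    by (intro sum.cong refl step)
  also have "\<dots> = (of_nat N + of_nat (card X) - of_nat (card Y)) * (\<Sum>p\<in>?R. \<Sum>q\<in>?C. ?g p q) -
      (\<Sum>p\<in>?R. \<Sum>q\<in>?C. \<Sum>x\<in>X. \<Sum>y\<in>Y. ?h p x y q)"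
    by (simp only: sum_subtractf sum_distrib_left)
  also have "(\<Sum>p\<in>?R. \<Sum>q\<in>?C. \<Sum>x\<in>X. \<Sum>y\<in>Y. ?h p x y q) = (\<Sum>x\<in>X. \<Sum>y\<in>Y. \<Sum>p\<in>?R. \<Sum>q\<in>?C. ?h p x y q)"
  proof -
    have "(\<Sum>p\<in>?R. \<Sum>q\<in>?C. \<Sum>x\<in>X. \<Sum>y\<in>Y. ?h p x y q) = (\<Sum>p\<in>?R. \<Sum>x\<in>X. \<Sum>y\<in>Y. \<Sum>q\<in>?C. ?h p x y q)"
      by (intro sum.cong refl) (subst sum.swap, intro sum.cong refl, subst sum.swap, rule refl)
    also have "\<dots> = (\<Sum>x\<in>X. \<Sum>y\<in>Y. \<Sum>p\<in>?R. \<Sum>q\<in>?C. ?h p x y q)"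
      by (subst sum.swap, intro sum.cong refl, subst sum.swap, rule refl)
    finally show ?thesis .
  qed
  also have "\<dots> = 0" by (rule sum.neutral, rule ballI, rule sum.neutral, rule ballI, rule cancel)
  also have "(of_nat N + of_nat (card X) - of_nat (card Y)) = complex_of_real (content_wt N 1 (rem_box L i) i)"
    unfolding card_X card_Y content_wt_def rem_box_def by simp
  finally show "tensor_trace N (Suc n) (csym (Suc n) T) =
      of_real (content_wt N 1 (rem_box L i) i) * tensor_trace N n (csym n T)"
    by (simp only: tensor_trace_csym diff_zero)
qed

lemma tensor_trace_content:
  "par n L \<Longrightarrow> bij_betw T {..<n} (diag L) \<Longrightarrow>
    tensor_trace N n (csym n T) = of_real (content_prod N 1 n L)"
proof (induction n arbitrary: L T)
  case 0
  have "Sym 0 = {id}" by (auto simp: Sym_def)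
  moreover have "words N 0 = {[]}" by (auto simp: words_def)
  moreover have "csym 0 T id = 1" by (rule group_algebra.tau_csym) simp
  ultimately show ?case by (simp add: tensor_trace_def chi_def content_prod_def)
next
  case (Suc n)
  note L = Suc.prems(1) and T = Suc.prems(2)
  \<comment> \<open>Positivity of \<open>fd\<close> supplies a removable corner: an empty sum would
    be zero.\<close>
  have "fd (Suc n) L > 0" by (rule group_algebra.fd_eq(2)[OF L T])
  then obtain i where i: "i \<in> removable L" by fastforce
  have "(i, L i - 1) \<in> diag L" using i by (auto simp: diag_def removable_def)
  then obtain x where x: "x < Suc n" "T x = (i, L i - 1)"
    using T by (auto simp: bij_betw_def image_iff set_eq_iff) (metis lessThan_iff)
  \<comment> \<open>Conjugation does not change the trace, so the entry of the corner may be assumed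
    to be the largest one.\<close>
  define g where "g = transpose x n"
  have g: "g \<in> Sym (Suc n)" "inv g = g" using x by (simp_all add: g_def)
  define T' where "T' = T \<circ> inv g"
  have T': "bij_betw T' {..<Suc n} (diag L)" unfolding T'_def
    by (rule bij_betw_trans[OF permutes_imp_bij T]) (use g in \<open>simp add: Sym_def flip: atLeast0LessThan\<close>)
  have Tn: "T' n = (i, L i - 1)" using x g by (simp add: T'_def g_def)
  note step = tensor_trace_remove_corner[OF par_decseq[OF L] i T' Tn]
  have "tensor_trace N (Suc n) (csym (Suc n) T) = tensor_trace N (Suc n) (csym (Suc n) T')"
    unfolding T'_def using tensor_trace_conj[OF g(1), of N "csym (Suc n) T"]
    by (simp only: group_algebra.conj_csym[OF g(1)])
  also have "\<dots> = of_real (content_wt N 1 (rem_box L i) i) * of_real (content_prod N 1 n (rem_box L i))"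
    by (simp only: step(2) Suc.IH[OF par_rem_box[OF L i] step(1)])
  also have "\<dots> = of_real (content_prod N 1 (Suc n) L)"
    using content_prod_add_box[OF par_rem_box[OF L i] addable_rem_box[OF par_decseq[OF L] i], of N 1] i
    by (simp add: mult.commute)
  finally show ?case .
qed

subsection \<open>Isotypic components\<close>

definition tensor_act :: "nat \<Rightarrow> ((nat \<Rightarrow> nat) \<Rightarrow> complex) \<Rightarrow> (nat list \<Rightarrow> complex) \<Rightarrow> nat list \<Rightarrow> complex" where
  "tensor_act n x f w = (\<Sum>s\<in>Sym n. x s * tact n s f w)"

lemma permuted_word_iff:
  assumes s: "s \<in> Sym n" and w: "length w = n"
  shows "map (\<lambda>i. w ! s i) [0..<n] \<in> words N n \<longleftrightarrow> w \<in> words N n"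
proof -
  have "s ` {0..<n} = {0..<n}" using s by (simp add: Sym_def permutes_image)
  have "set (map (\<lambda>i. w ! s i) [0..<n]) = (\<lambda>i. w ! i) ` (s ` {0..<n})"
    by (simp add: image_image)
  also have "\<dots> = (\<lambda>i. w ! i) ` {0..<n}" by (simp only: \<open>s ` {0..<n} = {0..<n}\<close>)
  also have "\<dots> = set w" using w by (auto simp: set_conv_nth)
  finally show ?thesis using w by (simp add: words_def)
qed

lemma tact_tensors:
  assumes "s \<in> Sym n" "f \<in> tensors N n"
  shows "tact n s f \<in> tensors N n"
  unfolding tensors_def
proof clarify
  fix w assume "w \<notin> words N n"
  then show "tact n s f w = 0"
    using assms permuted_word_iff[OF assms(1), of w] by (cases "length w = n") (simp_all add: tact_def tensors_def)
qed

lemma tact_tact: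
  assumes s: "s \<in> Sym n" and t: "t \<in> Sym n"
  shows "tact n s (tact n t f) = tact n (s \<circ> t) f"
proof
  fix w :: "nat list"
  have "map (\<lambda>i. map (\<lambda>i. w ! s i) [0..<n] ! t i) [0..<n] = map (\<lambda>i. w ! (s \<circ> t) i) [0..<n]"
    using t by simp
  then show "tact n s (tact n t f) w = tact n (s \<circ> t) f w"
    by (simp only: tact_def length_map length_upt minus_nat.diff_0 simp_thms if_True)
qed

lemma tensor_act_tensors:
  assumes "f \<in> tensors N n"
  shows "tensor_act n x f \<in> tensors N n"
  using tact_tensors[OF _ assms] by (simp add: tensors_def tensor_act_def)

lemma tensor_act_add_left: "tensor_act n (x + y) f = tensor_act n x f + tensor_act n y f"
  by (simp add: fun_eq_iff tensor_act_def sum.distrib algebra_simps)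

lemma tensor_act_scale_left: "tensor_act n (cscale r x) f = cscale r (tensor_act n x f)"
  by (simp add: fun_eq_iff tensor_act_def cscale_def sum_distrib_left algebra_simps)

lemma tensor_act_add_right: "tensor_act n x (f + g) = tensor_act n x f + tensor_act n x g"
proof
  fix w
  have "tact n s (f + g) w = tact n s f w + tact n s g w" for s by (simp add: tact_def)
  then show "tensor_act n x (f + g) w = (tensor_act n x f + tensor_act n x g) w"
    by (simp add: tensor_act_def sum.distrib distrib_left)
qed

lemma tensor_act_scale_right: "tensor_act n x (cscale r f) = cscale r (tensor_act n x f)"
proof
  fix w
  have "tact n s (cscale r f) w = r * tact n s f w" for s by (simp add: tact_def cscale_def)
  then show "tensor_act n x (cscale r f) w = cscale r (tensor_act n x f) w"
    by (simp add: tensor_act_def cscale_def sum_distrib_left mult.left_commute)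
qed

lemma tensor_act_sum_left:
  "tensor_act n (\<Sum>i\<in>I. x i) f = (\<Sum>i\<in>I. tensor_act n (x i) f)"
proof
  fix w
  have "tensor_act n (\<Sum>i\<in>I. x i) f w = (\<Sum>s\<in>Sym n. \<Sum>i\<in>I. x i s * tact n s f w)"
    by (simp add: tensor_act_def sum_fun_apply sum_distrib_right)
  also have "\<dots> = (\<Sum>i\<in>I. \<Sum>s\<in>Sym n. x i s * tact n s f w)" by (rule sum.swap)
  finally show "tensor_act n (\<Sum>i\<in>I. x i) f w = (\<Sum>i\<in>I. tensor_act n (x i) f) w"
    by (simp add: sum_fun_apply tensor_act_def)
qed

lemma tensor_act_delta: "s \<in> Sym n \<Longrightarrow> tensor_act n (delta s) f = tact n s f"
proof
  fix w assume "s \<in> Sym n"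
  have "(\<Sum>t\<in>Sym n. delta s t * tact n t f w) = (\<Sum>t\<in>Sym n. if t = s then tact n t f w else 0)"
    by (intro sum.cong refl) (simp add: delta_def)
  then show "tensor_act n (delta s) f w = tact n s f w"
    using \<open>s \<in> Sym n\<close> by (simp add: tensor_act_def)
qed

lemma tensor_act_mult:
  "tensor_act n (galg_mult n x y) f = tensor_act n x (tensor_act n y f)"
proof
  fix w
  have "tensor_act n (galg_mult n x y) f w =
      (\<Sum>s\<in>Sym n. \<Sum>t\<in>Sym n. x t * y (inv t \<circ> s) * tact n s f w)"
    unfolding tensor_act_def by (intro sum.cong refl) (simp add: galg_mult_def sum_distrib_right)
  also have "\<dots> = (\<Sum>t\<in>Sym n. \<Sum>s\<in>Sym n. x t * y (inv t \<circ> s) * tact n s f w)"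
    by (rule sum.swap)
  also have "\<dots> = (\<Sum>t\<in>Sym n. \<Sum>s\<in>Sym n. x t * y (inv t \<circ> (t \<circ> s)) * tact n (t \<circ> s) f w)"
    by (intro sum.cong refl sum_Sym_left[symmetric])
  also have "\<dots> = (\<Sum>t\<in>Sym n. \<Sum>s\<in>Sym n. x t * y s * tact n t (tact n s f) w)"
    by (intro sum.cong refl) (simp only: Sym_inv_comp' tact_tact)
  also have "\<dots> = (\<Sum>t\<in>Sym n. x t * tact n t (tensor_act n y f) w)"
    by (intro sum.cong refl) (simp add: tact_def tensor_act_def sum_distrib_left mult.assoc)
  finally show "tensor_act n (galg_mult n x y) f w = tensor_act n x (tensor_act n y f) w"
    by (simp add: tensor_act_def)
qed

text \<open>The diagonal entry of a permutation at the basis word \<open>w\<close> is 1 if the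
  permutation fixes \<open>w\<close> and 0 otherwise, so the sum over words produces
  \<open>chi\<close>.\<close>

lemma dim_tensor_act_idempotent:
  assumes "galg_mult n x x = x"
  shows "of_nat (cs.dim (tensor_act n x ` tensors N n)) = tensor_trace N n x"
proof -
  have "of_nat (cs.dim (tensor_act n x ` tensors N n)) = (\<Sum>w\<in>words N n. tensor_act n x (unit_fun w) w)"
  proof (rule dim_range_idempotent)
    show "tensors N n = {f. \<forall>w. w \<notin> words N n \<longrightarrow> f w = 0}" by (simp add: tensors_def)
    show "tensor_act n x (tensor_act n x f) = tensor_act n x f" for f
      using assms by (simp flip: tensor_act_mult)
  qed (simp_all add: tensor_act_add_right tensor_act_scale_right tensor_act_tensors)
  also have "\<dots> = (\<Sum>w\<in>words N n. \<Sum>s\<in>Sym n. x s * (if \<forall>i<n. w ! s i = w ! i then 1 else 0))"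
  proof (intro sum.cong refl)
    fix w assume w: "w \<in> words N n"
    then have "map (\<lambda>i. w ! s i) [0..<n] = w \<longleftrightarrow> (\<forall>i<n. w ! s i = w ! i)" for s
      by (auto simp: words_def list_eq_iff_nth_eq)
    then show "tensor_act n x (unit_fun w) w = (\<Sum>s\<in>Sym n. x s * (if \<forall>i<n. w ! s i = w ! i then 1 else 0))"
      using w unfolding tensor_act_def
      by (intro sum.cong refl) (simp add: tact_def unit_fun_def words_def)
  qed
  also have "\<dots> = (\<Sum>s\<in>Sym n. x s * (\<Sum>w\<in>words N n. if \<forall>i<n. w ! s i = w ! i then 1 else 0))"
    by (subst sum.swap) (simp only: sum_distrib_left)
  also have "\<dots> = tensor_trace N n x"
    unfolding tensor_trace_def chi_def
    by (intro sum.cong refl arg_cong2[of _ _ _ _ "(*)"]) (simp add: sum.If_cases Int_def)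
  finally show ?thesis .
qed

section \<open>The canonical tableau and the isotypic projection\<close>

definition row_fun :: "nat list \<Rightarrow> nat \<Rightarrow> nat" where
  "row_fun lam i = (if i < length lam then lam ! i else 0)"

definition row_reading :: "nat list \<Rightarrow> nat \<Rightarrow> nat \<times> nat" where
  "row_reading lam k = (row_of lam k, col_of lam k)"

lemma sum_list_take_Suc: "sum_list (take (Suc i) lam) = sum_list (take i lam) + row_fun lam i"
  by (cases "i < length lam") (simp_all add: take_Suc_conv_app_nth row_fun_def)

lemma sum_list_take_mono: "i \<le> j \<Longrightarrow> sum_list (take i lam) \<le> sum_list (take j (lam :: nat list))"
  by (induction j rule: dec_induct) (simp_all add: sum_list_take_Suc)

lemma sum_list_take_le: "sum_list (take i lam) \<le> sum_list (lam :: nat list)"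
  by (metis append_take_drop_id le_add1 sum_list_append)

lemma row_reading_bij: "bij_betw (row_reading lam) {..<sum_list lam} (diag (row_fun lam))"
proof (rule bij_betw_byWitness[where f' = "\<lambda>(i, j). sum_list (take i lam) + j"])
  have *: "sum_list (take (row_of lam k) lam) \<le> k \<and> k < sum_list (take (Suc (row_of lam k)) lam)"
    if "k < sum_list lam" for k
  proof -
    have ex: "k < sum_list (take (Suc (length lam)) lam)" using that by simp
    have "k < sum_list (take (Suc (row_of lam k)) lam)"
      unfolding row_of_def by (rule LeastI[of "\<lambda>i. k < sum_list (take (Suc i) lam)", OF ex])
    moreover have "sum_list (take (row_of lam k) lam) \<le> k"
    proof (cases "row_of lam k")
      case (Suc i)
      then have "i < row_of lam k" by simp
      then have "\<not> k < sum_list (take (Suc i) lam)" unfolding row_of_def by (rule not_less_Least)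
      then show ?thesis by (simp add: Suc)
    qed simp
    ultimately show ?thesis by simp
  qed
  show "\<forall>k\<in>{..<sum_list lam}. (case row_reading lam k of (i, j) \<Rightarrow> sum_list (take i lam) + j) = k"
    using * by (simp add: row_reading_def col_of_def)
  show "row_reading lam ` {..<sum_list lam} \<subseteq> diag (row_fun lam)"
  proof (rule image_subsetI)
    fix k assume "k \<in> {..<sum_list lam}"
    then have "k < sum_list lam" by simp
    from *[OF this] show "row_reading lam k \<in> diag (row_fun lam)"
      by (auto simp: row_reading_def diag_def col_of_def sum_list_take_Suc)
  qed
  show "\<forall>c\<in>diag (row_fun lam). row_reading lam (case c of (i, j) \<Rightarrow> sum_list (take i lam) + j) = c"
  proof
    fix c assume "c \<in> diag (row_fun lam)"
    then obtain i j where c: "c = (i, j)" and j: "j < row_fun lam i" by (auto simp: diag_def)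
    have "row_of lam (sum_list (take i lam) + j) = i"
      unfolding row_of_def
    proof (rule Least_equality)
      show "sum_list (take i lam) + j < sum_list (take (Suc i) lam)" using j by (simp add: sum_list_take_Suc)
    next
      fix i' assume lt: "sum_list (take i lam) + j < sum_list (take (Suc i') lam)"
      show "i \<le> i'"
      proof (rule ccontr)
        assume "\<not> i \<le> i'"
        then have "sum_list (take (Suc i') lam) \<le> sum_list (take i lam)" by (intro sum_list_take_mono) simp
        with lt show False by simp
      qed
    qed
    then show "row_reading lam (case c of (i, j) \<Rightarrow> sum_list (take i lam) + j) = c"
      by (simp add: c row_reading_def col_of_def)
  qed
  show "(\<lambda>(i, j). sum_list (take i lam) + j) ` diag (row_fun lam) \<subseteq> {..<sum_list lam}"
  proof clarify
    fix i j assume "(i, j) \<in> diag (row_fun lam)"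
    then have "sum_list (take i lam) + j < sum_list (take (Suc i) lam)"
      by (simp add: diag_def sum_list_take_Suc)
    then show "sum_list (take i lam) + j < sum_list lam" using sum_list_take_le[of "Suc i" lam] by simp
  qed
qed

lemma young_sym_eq: "young_sym lam = csym (sum_list lam) (row_reading lam)"
proof -
  let ?n = "sum_list lam"
  interpret ga: group_algebra ?n .
  have "row_group lam = row_grp ?n (row_reading lam)" "col_group lam = col_grp ?n (row_reading lam)"
    by (auto simp: row_group_def col_group_def row_grp_iff col_grp_iff row_reading_def)
  then show ?thesis
    by (simp add: young_sym_def ga.csym_def ga.row_sum_def[abs_def] ga.col_sum_def[abs_def])
qed

text \<open>An equivariant map commutes with \<open>e\<close>, and \<open>e\<close> fixes the Specht
  module; this gives one inclusion. Conversely, \<open>e f\<close> is a multiple of the sum of all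
  \<open>g c g^-1 f\<close>, and each summand is the value at \<open>g c\<close> of the equivariant
  map that applies its argument to \<open>g^-1 f\<close>.\<close>

lemma isotypic_eq:
  fixes lam :: "nat list"
  defines "n \<equiv> sum_list lam"
  assumes L: "decseq (row_fun lam)"
  shows "isotypic lam N = tensor_act n (group_algebra.cidem n (row_reading lam)) ` tensors N n"
proof -
  interpret ga: group_algebra n .
  define T where "T = row_reading lam"
  define c where "c = ga.csym T"
  define e where "e = ga.cidem T"
  have T: "bij_betw T {..<n} (diag (row_fun lam))"
    unfolding T_def n_def by (rule row_reading_bij)
  have specht: "specht lam = {galg_mult n x c | x. x \<in> galg n}"
    by (simp add: specht_def young_sym_eq c_def T_def n_def)
  have zero_S: "0 \<in> specht lam"
    unfolding specht using ga.galg_zero by (auto intro!: exI[of _ 0])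
  have add_S: "x + y \<in> specht lam" if S: "x \<in> specht lam" "y \<in> specht lam" for x y
  proof -
    obtain x' y' where "x' \<in> galg n" "y' \<in> galg n" "x = galg_mult n x' c" "y = galg_mult n y' c"
      using S unfolding specht by blast
    then have "x + y = galg_mult n (x' + y') c" "x' + y' \<in> galg n" by (simp_all add: ga.mult_add_left)
    then show ?thesis unfolding specht by blast
  qed
  have scale_S: "cscale r x \<in> specht lam" if S: "x \<in> specht lam" for r x
  proof -
    obtain x' where "x' \<in> galg n" "x = galg_mult n x' c" using S unfolding specht by blast
    then have "cscale r x = galg_mult n (cscale r x') c" "cscale r x' \<in> galg n"
      by (simp_all add: ga.mult_scale_left)
    then show ?thesis unfolding specht by blast
  qed
  have mult_S: "galg_mult n y x \<in> specht lam" if S: "x \<in> specht lam" for x y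
  proof -
    obtain x' where "x' \<in> galg n" "x = galg_mult n x' c" using S unfolding specht by blast
    then have "galg_mult n y x = galg_mult n (galg_mult n y x') c" by (simp add: ga.mult_assoc)
    then show ?thesis unfolding specht using ga.mult_galg by blast
  qed
  have ex: "galg_mult n e x = x" if S: "x \<in> specht lam" for x
  proof -
    obtain y where y: "y \<in> galg n" "x = galg_mult n y c" using S unfolding specht by blast
    have "galg_mult n e y = galg_mult n y e"
      using ga.central_cidem[of T] y by (simp add: ga.central_def e_def)
    then have "galg_mult n e x = galg_mult n y (galg_mult n e c)"
      unfolding y by (simp flip: ga.mult_assoc)
    then show ?thesis using ga.cidem_csym[OF T L] y by (simp add: e_def c_def)
  qed
  have "{phi x | phi x. phi \<in> equiv_maps lam N \<and> x \<in> specht lam} \<subseteq> tensor_act n e ` tensors N n"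
  proof clarify
    fix phi x assume phi: "phi \<in> equiv_maps lam N" and x: "x \<in> specht lam"
    have phiT: "phi x \<in> tensors N n" using phi x by (simp add: equiv_maps_def n_def)
    have phi_add: "phi (u + v) = phi u + phi v" if "u \<in> specht lam" "v \<in> specht lam" for u v
      using phi that by (simp add: equiv_maps_def)
    have phi_scale: "phi (cscale r u) = cscale r (phi u)" if "u \<in> specht lam" for r u
      using phi that by (simp add: equiv_maps_def)
    have phi_act: "phi (galg_mult n (delta s) x) = tact n s (phi x)" if "s \<in> Sym n" for s
      using phi that x by (simp add: equiv_maps_def n_def)
    \<comment> \<open>\<open>phi\<close> is linear only on \<open>specht lam\<close>, so membership
      of the partial sums has to be proved together with the formula.\<close>
    have phi_sum: "(\<Sum>g\<in>I. cscale (e g) (galg_mult n (delta g) x)) \<in> specht lam \<and>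
      phi (\<Sum>g\<in>I. cscale (e g) (galg_mult n (delta g) x)) =
      (\<Sum>g\<in>I. cscale (e g) (tact n g (phi x)))" if "I \<subseteq> Sym n" for I
    proof -
      have "finite I" using that by (rule finite_subset) simp
      then show ?thesis using that
      proof (induction I)
        case empty
        show ?case using phi_scale[OF zero_S, of 0] zero_S
          by (simp only: sum.empty cs.scale_zero_left simp_thms)
      next
        case (insert g I)
        let ?v = "cscale (e g) (galg_mult n (delta g) x)"
        have v: "?v \<in> specht lam" by (intro scale_S mult_S x)
        have phi_v: "phi ?v = cscale (e g) (tact n g (phi x))"
          using phi_scale[OF mult_S[OF x]] phi_act insert.prems by simp
        have "I \<subseteq> Sym n" using insert.prems by simp
        note W = insert.IH[OF this, THEN conjunct1] insert.IH[OF this, THEN conjunct2]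
        show ?case
          unfolding sum.insert[OF insert.hyps(1,2)]
          using add_S[OF v W(1)] phi_add[OF v W(1)] by (simp only: phi_v W(2) simp_thms)
      qed
    qed
    have "x = galg_mult n (\<Sum>g\<in>Sym n. cscale (e g) (delta g)) x"
      using ex[OF x] ga.galg_expansion[of e] by (simp add: e_def)
    also have "\<dots> = (\<Sum>g\<in>Sym n. cscale (e g) (galg_mult n (delta g) x))"
      by (simp only: ga.mult_sum_left ga.mult_scale_left)
    finally have "phi x = (\<Sum>g\<in>Sym n. cscale (e g) (tact n g (phi x)))"
      using phi_sum[of "Sym n"] by simp
    also have "\<dots> = tensor_act n e (phi x)"
      by (simp add: fun_eq_iff sum_fun_apply tensor_act_def cscale_def)
    finally show "phi x \<in> tensor_act n e ` tensors N n" using phiT by (rule image_eqI)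
  qed
  moreover have "cs.subspace (tensor_act n e ` tensors N n)"
  proof (rule cs.subspaceI)
    have "tensor_act n e 0 = 0" by (simp add: fun_eq_iff tensor_act_def tact_def cong: if_cong)
    moreover have "0 \<in> tensors N n" by (simp add: tensors_def)
    ultimately show "0 \<in> tensor_act n e ` tensors N n" by (metis image_eqI)
  next
    fix u v assume "u \<in> tensor_act n e ` tensors N n" "v \<in> tensor_act n e ` tensors N n"
    then obtain f g where fg: "f \<in> tensors N n" "g \<in> tensors N n" "u = tensor_act n e f" "v = tensor_act n e g"
      by blast
    have "f + g \<in> tensors N n" using fg by (simp add: tensors_def)
    then show "u + v \<in> tensor_act n e ` tensors N n"
      unfolding fg(3,4) tensor_act_add_right[symmetric] by (rule imageI)
  next
    fix r u assume "u \<in> tensor_act n e ` tensors N n"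
    then obtain f where f: "f \<in> tensors N n" "u = tensor_act n e f" by blast
    have "cscale r f \<in> tensors N n" using f by (simp add: tensors_def cscale_def)
    then show "cscale r u \<in> tensor_act n e ` tensors N n"
      unfolding f(2) tensor_act_scale_right[symmetric] by (rule imageI)
  qed
  ultimately have sub: "isotypic lam N \<subseteq> tensor_act n e ` tensors N n"
    unfolding isotypic_def by (rule cs.span_minimal)
  have act_equiv: "(\<lambda>x. tensor_act n x u) \<in> equiv_maps lam N" if u: "u \<in> tensors N n" for u
    using u unfolding equiv_maps_def n_def[symmetric]
    by (simp only: mem_Collect_eq tensor_act_tensors tensor_act_add_left tensor_act_scale_left
        tensor_act_mult tensor_act_delta simp_thms refl)
      (simp add: tensor_act_delta)
  have "tensor_act n e f \<in> isotypic lam N" if f: "f \<in> tensors N n" for f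
  proof -
    have "tensor_act n (galg_mult n (galg_mult n (delta g) c) (delta (inv g))) f \<in>
      {phi x | phi x. phi \<in> equiv_maps lam N \<and> x \<in> specht lam}" if g: "g \<in> Sym n" for g
    proof -
      define u where "u = tensor_act n (delta (inv g)) f"
      have "delta g \<in> galg n" using g by simp
      then have "galg_mult n (delta g) c \<in> specht lam" unfolding specht by blast
      moreover have "(\<lambda>x. tensor_act n x u) \<in> equiv_maps lam N"
        unfolding u_def by (rule act_equiv[OF tensor_act_tensors[OF f]])
      ultimately have "\<exists>phi x. tensor_act n (galg_mult n (delta g) c) u = phi x \<and>
          phi \<in> equiv_maps lam N \<and> x \<in> specht lam"
        by (intro exI[of _ "\<lambda>x. tensor_act n x u"] exI[of _ "galg_mult n (delta g) c"] conjI refl)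
      then show ?thesis
        unfolding tensor_act_mult[of n _ "delta (inv g)"] u_def[symmetric] by (simp only: mem_Collect_eq)
    qed
    then have "(\<Sum>g\<in>Sym n. tensor_act n (galg_mult n (galg_mult n (delta g) c) (delta (inv g))) f) \<in> isotypic lam N"
      unfolding isotypic_def by (intro cs.span_sum cs.span_base)
    then have "cscale (1 / (ga.kappa T)\<^sup>2) (\<Sum>g\<in>Sym n. tensor_act n (galg_mult n (galg_mult n (delta g) c) (delta (inv g))) f) \<in> isotypic lam N"
      unfolding isotypic_def by (rule cs.span_scale)
    then show ?thesis
      by (simp only: e_def ga.cidem_def ga.zsym_def c_def tensor_act_scale_left tensor_act_sum_left)
  qed
  with sub show ?thesis unfolding e_def T_def by blast
qed

lemma par_row_fun:
  assumes "lam \<in> young_diagrams N n"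
  shows "par n (row_fun lam)"
proof (rule parI)
  have "sorted_wrt (\<ge>) lam" using assms by (simp add: young_diagrams_def)
  then have "row_fun lam (Suc i) \<le> row_fun lam i" for i
    by (auto simp: row_fun_def sorted_wrt_iff_nth_less)
  then show "decseq (row_fun lam)" by (simp add: decseq_Suc_iff)
  show "row_fun lam i = 0" if "i \<ge> length lam" for i using that by (simp add: row_fun_def)
  show "sum (row_fun lam) {..<length lam} = n"
    using assms by (simp add: young_diagrams_def row_fun_def sum_list_sum_nth atLeast0LessThan)
qed

text \<open>All \<open>n!\<close> conjugates in \<open>zsym\<close> have the same trace, and
  \<open>1 / kappa^2 = f^2 / n!^2\<close>. The result is \<open>f\<close> times the dimension of the
  irreducible general linear group module, as Schur-Weyl duality predicts.\<close>

lemma dimE_eq: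
  assumes lam: "lam \<in> young_diagrams N n"
  shows "real (dimE lam N) = (real (fd n (row_fun lam)))\<^sup>2 / fact n * content_prod N 1 n (row_fun lam)"
proof -
  have n: "sum_list lam = n" using lam by (simp add: young_diagrams_def)
  interpret ga: group_algebra n .
  let ?L = "row_fun lam" and ?T = "row_reading lam"
  have L: "par n ?L" by (rule par_row_fun[OF lam])
  have T: "bij_betw ?T {..<n} (diag ?L)" using row_reading_bij[of lam] by (simp add: n)
  have "complex_of_nat (dimE lam N) = tensor_trace N n (ga.cidem ?T)"
    unfolding dimE_def isotypic_eq[OF par_decseq[OF L]] n
    by (rule dim_tensor_act_idempotent[OF ga.cidem_idem[OF T par_decseq[OF L]]])
  also have "\<dots> = 1 / (ga.kappa ?T)\<^sup>2 * tensor_trace N n (ga.zsym ?T)"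
    by (simp add: ga.cidem_def tensor_trace_def cscale_def sum_distrib_left mult.assoc)
  also have "tensor_trace N n (ga.zsym ?T) =
      (\<Sum>s\<in>Sym n. \<Sum>g\<in>Sym n. galg_mult n (galg_mult n (delta g) (ga.csym ?T)) (delta (inv g)) s * of_nat (chi N n s))"
    unfolding tensor_trace_def ga.zsym_def sum_fun_apply sum_distrib_right ..
  also have "\<dots> = (\<Sum>g\<in>Sym n. tensor_trace N n (galg_mult n (galg_mult n (delta g) (ga.csym ?T)) (delta (inv g))))"
    unfolding tensor_trace_def by (rule sum.swap)
  also have "\<dots> = (\<Sum>g\<in>Sym n. of_real (content_prod N 1 n ?L))"
    by (intro sum.cong refl) (simp only: tensor_trace_conj tensor_trace_content[OF L T])
  also have "\<dots> = fact n * of_real (content_prod N 1 n ?L)"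
    by (simp add: card_Sym)
  also have "1 / (ga.kappa ?T)\<^sup>2 * \<dots> = of_real ((real (fd n ?L))\<^sup>2 / fact n * content_prod N 1 n ?L)"
    by (simp add: ga.fd_eq(1)[OF L T] power2_eq_square)
  finally show ?thesis by (metis of_real_eq_iff of_real_of_nat_eq)
qed

text \<open>The Plancherel weight \<open>f^2 / n!\<close> deformed by contents. It makes sense for
  every partition of \<open>n\<close> and vanishes beyond \<open>N\<close> rows, so sums over
  Young's lattice need no row restriction.\<close>

definition diagram_prob :: "nat \<Rightarrow> nat \<Rightarrow> (nat \<Rightarrow> nat) \<Rightarrow> real" where
  "diagram_prob N n L = (real (fd n L))\<^sup>2 / fact n * content_prod 1 (1 / real N) n L"

lemma content_prod_scale:
  assumes "par n L" "x \<noteq> 0"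
  shows "content_prod x 1 n L = x ^ n * content_prod 1 (1 / x) n L"
proof -
  have "content_prod x 1 n L = (\<Prod>i<n. \<Prod>j<L i. x * (1 + 1 / x * (real j - real i)))"
    unfolding content_prod_def using assms by (intro prod.cong refl) (simp add: algebra_simps)
  also have "\<dots> = (\<Prod>i<n. x ^ L i) * content_prod 1 (1 / x) n L"
    by (simp add: prod.distrib content_prod_def)
  also have "(\<Prod>i<n. x ^ L i) = x ^ n"
    using assms by (simp add: par_def flip: power_sum)
  finally show ?thesis .
qed

lemma PN_eq:
  assumes "lam \<in> young_diagrams N n" "N > 0"
  shows "PN N n lam = diagram_prob N n (row_fun lam)"
  using assms content_prod_scale[OF par_row_fun[OF assms(1)], of "real N"]
  by (simp add: PN_def dimE_eq diagram_prob_def)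

subsection \<open>Exponential decay of the probabilities\<close>

definition pars :: "nat \<Rightarrow> nat \<Rightarrow> (nat \<Rightarrow> nat) set" where
  "pars N n = {L. par n L \<and> (\<forall>i\<ge>N. L i = 0)}"

lemma parsD: "L \<in> pars N n \<Longrightarrow> par n L" "L \<in> pars N n \<Longrightarrow> i \<ge> N \<Longrightarrow> L i = 0"
  by (simp_all add: pars_def)

lemma finite_pars [simp]: "finite (pars N n)"
  by (rule finite_subset[OF _ finite_par[of n]]) (auto simp: pars_def)

lemma par_pos_lt: "par n L \<Longrightarrow> L i > 0 \<Longrightarrow> i < n"
  by (rule ccontr) (simp add: par_def)

text \<open>The cell \<open>(N, 0)\<close> has content \<open>-N\<close>, so its factor is
  zero.\<close>

lemma content_prod_zero:
  assumes N: "N > 0" and L: "par n L" and row: "L N > 0"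
  shows "content_prod 1 (1 / real N) n L = 0"
proof -
  have "(\<Prod>j<L N. 1 + 1 / real N * (real j - real N)) = 0"
    by (rule prod_zero) (use row N in \<open>auto intro: bexI[of _ 0]\<close>)
  moreover have "N < n" by (rule par_pos_lt[OF L row])
  ultimately show ?thesis unfolding content_prod_def by (intro prod_zero) auto
qed

lemma content_prod_pos:
  assumes N: "N > 0" and L: "L \<in> pars N n"
  shows "content_prod 1 (1 / real N) n L > 0"
  unfolding content_prod_def
proof (intro prod_pos)
  fix i j assume "j \<in> {..<L i}"
  then have "i < N" using parsD(2)[OF L, of i] by (cases "i < N") auto
  then show "0 < 1 + 1 / real N * (real j - real i)" using N by (simp add: field_simps)
qed

lemma diagram_prob_pos:
  assumes "N > 0" "L \<in> pars N n"
  shows "diagram_prob N n L > 0"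
  using content_prod_pos[OF assms] group_algebra.fd_eq(2)[OF parsD(1)[OF assms(2)]]
    ex_tableau[OF parsD(1)[OF assms(2)]]
  by (auto simp: diagram_prob_def)

lemma sum_diagram_prob:
  assumes N: "N > 0"
  shows "(\<Sum>L\<in>pars N n. diagram_prob N n L) = 1"
proof -
  have "(\<Sum>L\<in>pars N n. diagram_prob N n L) = (\<Sum>L | par n L. diagram_prob N n L)"
  proof (rule sum.mono_neutral_left)
    show "\<forall>L\<in>{L. par n L} - pars N n. diagram_prob N n L = 0"
    proof
      fix L assume "L \<in> {L. par n L} - pars N n"
      then obtain i where L: "par n L" and i: "i \<ge> N" "L i > 0" by (auto simp: pars_def)
      have "L N > 0" using decseqD[OF par_decseq[OF L] i(1)] i(2) by simp
      then show "diagram_prob N n L = 0" using content_prod_zero[OF N L] by (simp add: diagram_prob_def)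
    qed
  qed (auto simp: pars_def)
  also have "\<dots> = (\<Sum>L | par n L. (real (fd n L))\<^sup>2 * content_prod 1 (1 / real N) n L) / fact n"
    by (simp add: diagram_prob_def sum_divide_distrib)
  finally show ?thesis by (simp add: sum_fd_content_prod)
qed

lemma weighted_Cauchy_Schwarz:
  fixes f w :: "'a \<Rightarrow> real"
  assumes w: "\<And>i. i \<in> I \<Longrightarrow> w i > 0"
  shows "(\<Sum>i\<in>I. f i)\<^sup>2 \<le> (\<Sum>i\<in>I. w i) * (\<Sum>i\<in>I. (f i)\<^sup>2 / w i)"
proof (cases "(\<Sum>i\<in>I. w i) = 0")
  case True
  then have "I = {} \<or> infinite I"
    using w by (metis less_irrefl sum_pos)
  then show ?thesis by auto
next
  case False
  define W F t where "W = (\<Sum>i\<in>I. w i)" and "F = (\<Sum>i\<in>I. f i)" and "t = F / W"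
  have W: "W > 0" using False sum_nonneg[of I w] w less_imp_le unfolding W_def by (metis less_eq_real_def)
  have "0 \<le> (\<Sum>i\<in>I. w i * (f i / w i - t)\<^sup>2)"
    using w by (intro sum_nonneg mult_nonneg_nonneg) (auto intro: less_imp_le)
  also have "\<dots> = (\<Sum>i\<in>I. (f i)\<^sup>2 / w i - 2 * t * f i + t\<^sup>2 * w i)"
    by (intro sum.cong refl) (use w in \<open>force simp: power2_eq_square field_simps\<close>)
  also have "\<dots> = (\<Sum>i\<in>I. (f i)\<^sup>2 / w i) - 2 * t * F + t\<^sup>2 * W"
    by (simp add: sum.distrib sum_subtractf sum_distrib_left F_def W_def)
  also have "\<dots> = (\<Sum>i\<in>I. (f i)\<^sup>2 / w i) - F\<^sup>2 / W"
    using W by (simp add: t_def power2_eq_square field_simps)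
  finally have "F\<^sup>2 / W \<le> (\<Sum>i\<in>I. (f i)\<^sup>2 / w i)" by simp
  then show ?thesis using W by (simp add: F_def W_def field_simps)
qed

text \<open>The weight \<open>w j\<close> is the ratio of the content products of \<open>L\<close>
  and \<open>rem_box L j\<close>, so the division by \<open>w j\<close> in the Cauchy-Schwarz
  inequality turns one into the other. At most \<open>N\<close> rows are removable and their lengths
  sum to at most \<open>Suc n\<close>, which bounds the sum of the weights; the ratio of factorials
  divides it by \<open>Suc n\<close>.\<close>

lemma diagram_prob_step:
  assumes N: "N > 0" and L: "L \<in> pars N (Suc n)"
  shows "diagram_prob N (Suc n) L \<le>
    (real N / real (Suc n) + 1 / real N) * (\<Sum>j\<in>removable L. diagram_prob N n (rem_box L j))"
proof -
  note par = parsD(1)[OF L]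
  let ?C = "content_prod 1 (1 / real N)"
  define w where "w j = content_wt 1 (1 / real N) (rem_box L j) j" for j
  have pos: "0 < L j" "j < N" "j < Suc n" if "j \<in> removable L" for j
  proof -
    show "0 < L j" using that by (simp add: removable_def)
    then show "j < N" using parsD(2)[OF L, of j] by (cases "j < N") auto
    show "j < Suc n" by (rule removable_lt[OF par that])
  qed
  have w_eq: "w j = 1 + (real (L j) - 1 - real j) / real N" if "j \<in> removable L" for j
    using pos[OF that] by (simp add: w_def content_wt_def rem_box_def of_nat_diff)
  have w_pos: "w j > 0" if "j \<in> removable L" for j
    using pos[OF that] N by (simp add: w_eq[OF that] field_simps)
  have C: "?C (Suc n) L = ?C n (rem_box L j) * w j" if "j \<in> removable L" for j
    using content_prod_add_box[OF par_rem_box[OF par that] addable_rem_box[OF par_decseq[OF par] that], of 1 "1 / real N"] that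
    by (simp add: w_def)
  have "(\<Sum>j\<in>removable L. w j) \<le> (\<Sum>j\<in>removable L. 1 + real (L j) / real N)"
    using N by (intro sum_mono) (auto simp: w_eq divide_simps)
  also have "\<dots> = real (card (removable L)) + (\<Sum>j\<in>removable L. real (L j)) / real N"
    by (simp add: sum.distrib sum_divide_distrib)
  also have "real (card (removable L)) \<le> real N"
  proof -
    have "card (removable L) \<le> card {..<N}" by (rule card_mono) (use pos in auto)
    then show ?thesis by simp
  qed
  also have "(\<Sum>j\<in>removable L. real (L j)) \<le> (\<Sum>j<Suc n. real (L j))"
    using pos by (intro sum_mono2) auto
  also have "\<dots> = real (Suc n)" using par_sum[OF par, of "Suc n"] by (metis of_nat_sum order_refl)
  finally have w_sum: "(\<Sum>j\<in>removable L. w j) \<le> real N + real (Suc n) / real N"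
    using N by (simp add: divide_right_mono)
  define S where "S = (\<Sum>j\<in>removable L. (real (fd n (rem_box L j)))\<^sup>2 / w j)"
  have "(real (fd (Suc n) L))\<^sup>2 \<le> (\<Sum>j\<in>removable L. w j) * S"
    unfolding S_def fd.simps of_nat_sum by (rule weighted_Cauchy_Schwarz[OF w_pos])
  also have "\<dots> \<le> (real N + real (Suc n) / real N) * S"
    by (intro mult_right_mono w_sum) (auto simp: S_def intro!: sum_nonneg divide_nonneg_pos w_pos)
  finally have f: "(real (fd (Suc n) L))\<^sup>2 \<le> (real N + real (Suc n) / real N) * S" .
  have "S * ?C (Suc n) L = (\<Sum>j\<in>removable L. (real (fd n (rem_box L j)))\<^sup>2 * ?C n (rem_box L j))"
    unfolding S_def sum_distrib_right
    by (intro sum.cong refl) (use w_pos in \<open>force simp: C\<close>)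
  also have "\<dots> = fact n * (\<Sum>j\<in>removable L. diagram_prob N n (rem_box L j))"
    by (simp add: diagram_prob_def sum_distrib_left)
  finally have S: "S * ?C (Suc n) L = fact n * (\<Sum>j\<in>removable L. diagram_prob N n (rem_box L j))" .
  have "diagram_prob N (Suc n) L = (real (fd (Suc n) L))\<^sup>2 * ?C (Suc n) L / fact (Suc n)"
    by (simp add: diagram_prob_def del: fd.simps)
  also have "\<dots> \<le> (real N + real (Suc n) / real N) * S * ?C (Suc n) L / fact (Suc n)"
    using content_prod_pos[OF N L] by (intro divide_right_mono mult_right_mono f) auto
  also have "\<dots> = (real N + real (Suc n) / real N) * (fact n * (\<Sum>j\<in>removable L. diagram_prob N n (rem_box L j))) / fact (Suc n)"
    by (simp only: S mult.assoc)
  also have "\<dots> = (real N / real (Suc n) + 1 / real N) * (\<Sum>j\<in>removable L. diagram_prob N n (rem_box L j))"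
  proof -
    have "fact (Suc n) = (real (Suc n) * fact n :: real)" by simp
    moreover have "(a + s / b) * (g * P) / (s * g) = (a / s + 1 / b) * P" if "s > 0" "g > 0" "b > 0" for a b s g P :: real
      using that by (simp add: field_simps)
    ultimately show ?thesis using N by (simp only: of_nat_0_less_iff zero_less_Suc fact_gt_zero)
  qed
  finally show ?thesis .
qed

text \<open>The factor \<open>fact m\<close> bounds the number of chains from \<open>M\<close> up to
  \<open>L\<close>. Restricting the sum to \<open>M \<le> L\<close> keeps it this small: a diagram
  with \<open>Suc m\<close> boxes fewer than \<open>L\<close> can be extended inside
  \<open>L\<close> in at most \<open>Suc m\<close> ways, since every added box lies in
  \<open>L\<close> but not in \<open>M\<close>.\<close>

lemma diagram_prob_iterate:
  assumes N: "N > 0" and L: "L \<in> pars N n"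
  shows "m \<le> n \<Longrightarrow> (\<And>k. n - m < k \<Longrightarrow> k \<le> n \<Longrightarrow> real N / real k + 1 / real N \<le> A) \<Longrightarrow>
    diagram_prob N n L \<le> A ^ m * fact m * (\<Sum>M | par (n - m) M \<and> M \<le> L. diagram_prob N (n - m) M)"
proof (induction m)
  case 0
  have "{M. par n M \<and> M \<le> L} = {L}"
  proof -
    have "M = L" if "par n M" "M \<le> L" for M
    proof (rule ccontr)
      assume "M \<noteq> L"
      then obtain i where "M i \<noteq> L i" by auto
      with that have "M i < L i" by (simp add: le_fun_def order_less_le)
      moreover from this have "i < n" using parsD(1)[OF L] by (intro par_pos_lt[of n L]) auto
      ultimately have "sum M {..<n} < sum L {..<n}"
        using that by (intro sum_strict_mono_ex1) (auto simp: le_fun_def)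
      then show False using that parsD(1)[OF L] by (simp add: par_def)
    qed
    then show ?thesis using parsD(1)[OF L] by auto
  qed
  then show ?case by simp
next
  case (Suc m)
  define k where "k = n - Suc m"
  have nm: "n - m = Suc k" using Suc.prems(1) by (simp add: k_def)
  have A: "real N / real (Suc k) + 1 / real N \<le> A"
    using Suc.prems(1) by (intro Suc.prems(2)) (auto simp: k_def)
  have "A > 0" using A N by (smt (verit) divide_nonneg_nonneg of_nat_0_le_iff divide_pos_pos of_nat_0_less_iff)
  have below: "M \<in> pars N l" if "par l M" "M \<le> L" for l M
  proof -
    have "M i = 0" if "i \<ge> N" for i using le_funD[OF \<open>M \<le> L\<close>, of i] parsD(2)[OF L that] by simp
    with that show ?thesis by (simp add: pars_def)
  qed
  have nonneg: "diagram_prob N l M \<ge> 0" if "par l M" "M \<le> L" for l M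
    using diagram_prob_pos[OF N below[OF that]] by simp
  have "(\<Sum>M | par (Suc k) M \<and> M \<le> L. diagram_prob N (Suc k) M) \<le>
      (\<Sum>M | par (Suc k) M \<and> M \<le> L. A * (\<Sum>j\<in>removable M. diagram_prob N k (rem_box M j)))"
  proof (rule sum_mono)
    fix M assume "M \<in> {M. par (Suc k) M \<and> M \<le> L}"
    then have M: "par (Suc k) M" "M \<le> L" by auto
    have "0 \<le> (\<Sum>j\<in>removable M. diagram_prob N k (rem_box M j))"
    proof (rule sum_nonneg)
      fix j assume j: "j \<in> removable M"
      have "rem_box M j \<le> L" using M(2) by (auto simp: le_fun_def rem_box_def intro: order_trans[OF diff_le_self])
      then show "0 \<le> diagram_prob N k (rem_box M j)" by (rule nonneg[OF par_rem_box[OF M(1) j]])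
    qed
    with A have "(real N / real (Suc k) + 1 / real N) * (\<Sum>j\<in>removable M. diagram_prob N k (rem_box M j)) \<le>
       A * (\<Sum>j\<in>removable M. diagram_prob N k (rem_box M j))"
      by (rule mult_right_mono)
    with diagram_prob_step[OF N below[OF M]]
    show "diagram_prob N (Suc k) M \<le> A * (\<Sum>j\<in>removable M. diagram_prob N k (rem_box M j))" by simp
  qed
  also have "\<dots> = A * (\<Sum>M | par (Suc k) M \<and> M \<le> L. \<Sum>j\<in>removable M. diagram_prob N k (rem_box M j))"
    by (simp only: sum_distrib_left)
  also have "(\<Sum>M | par (Suc k) M \<and> M \<le> L. \<Sum>j\<in>removable M. diagram_prob N k (rem_box M j)) =
      (\<Sum>M | par (Suc k) M. \<Sum>j\<in>removable M. if M \<le> L then diagram_prob N k (rem_box M j) else 0)"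
    by (rule sum.mono_neutral_cong_left) auto
  also have "\<dots> = (\<Sum>M | par k M. \<Sum>i\<in>addable M. if add_box M i \<le> L then diagram_prob N k M else 0)"
    by (rule sum_par_Suc)
  also have "\<dots> \<le> (\<Sum>M | par k M. if M \<le> L then real (Suc m) * diagram_prob N k M else 0)"
  proof (rule sum_mono)
    fix M assume "M \<in> {M. par k M}"
    then have M: "par k M" by simp
    define S where "S = {i \<in> addable M. add_box M i \<le> L}"
    have eq: "(\<Sum>i\<in>addable M. if add_box M i \<le> L then diagram_prob N k M else 0) = real (card S) * diagram_prob N k M"
      using M by (simp add: S_def sum.If_cases Int_def)
    have S: "M i < L i" if "i \<in> S" for i
    proof -
      have "add_box M i i \<le> L i" using that by (simp add: S_def le_fun_def)
      then show ?thesis by (simp add: add_box_def)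
    qed
    show "(\<Sum>i\<in>addable M. if add_box M i \<le> L then diagram_prob N k M else 0) \<le>
       (if M \<le> L then real (Suc m) * diagram_prob N k M else 0)"
    proof (cases "M \<le> L")
      case True
      have "S \<subseteq> {..<n}" using S par_pos_lt[OF parsD(1)[OF L]] by fastforce
      have "card S = (\<Sum>i\<in>S. 1)" by simp
      also have "\<dots> \<le> (\<Sum>i\<in>S. L i - M i)" by (intro sum_mono) (use S in fastforce)
      also have "\<dots> \<le> (\<Sum>i<n. L i - M i)" by (rule sum_mono2) (use \<open>S \<subseteq> {..<n}\<close> in auto)
      also have "\<dots> = sum L {..<n} - sum M {..<n}"
        using True by (intro sum_subtractf_nat) (simp add: le_fun_def)
      also have "\<dots> = Suc m"
        using par_sum[OF M, of n] par_sum[OF parsD(1)[OF L], of n] Suc.prems(1) by (simp add: k_def)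
      finally have "card S \<le> Suc m" .
      then have "real (card S) * diagram_prob N k M \<le> real (Suc m) * diagram_prob N k M"
        by (intro mult_right_mono nonneg[OF M True]) simp
      then show ?thesis using True by (simp only: eq if_True)
    next
      case False
      have "S = {}"
      proof (rule ccontr)
        assume "S \<noteq> {}"
        then obtain i where "add_box M i \<le> L" by (auto simp: S_def)
        moreover have "M \<le> add_box M i" by (simp add: le_fun_def add_box_def)
        ultimately show False using False by (meson order_trans)
      qed
      then show ?thesis using False by (simp add: eq)
    qed
  qed
  also have "\<dots> = real (Suc m) * (\<Sum>M | par k M \<and> M \<le> L. diagram_prob N k M)"
    unfolding sum_distrib_left by (rule sum.mono_neutral_cong_right) auto
  finally have bound: "(\<Sum>M | par (Suc k) M \<and> M \<le> L. diagram_prob N (Suc k) M) \<le>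
      A * (real (Suc m) * (\<Sum>M | par k M \<and> M \<le> L. diagram_prob N k M))"
    using \<open>A > 0\<close> by simp
  have "diagram_prob N n L \<le> A ^ m * fact m * (\<Sum>M | par (n - m) M \<and> M \<le> L. diagram_prob N (n - m) M)"
    using Suc.prems by (intro Suc.IH) auto
  also have "\<dots> \<le> A ^ m * fact m * (A * (real (Suc m) * (\<Sum>M | par k M \<and> M \<le> L. diagram_prob N k M)))"
    unfolding nm using \<open>A > 0\<close> by (intro mult_left_mono bound) simp
  also have "\<dots> = A ^ Suc m * fact (Suc m) * (\<Sum>M | par k M \<and> M \<le> L. diagram_prob N k M)"
    by simp
  finally show ?case by (simp only: k_def)
qed

text \<open>The total mass 1 bounds the sum left over after \<open>m\<close> removals, and
  \<open>fact m\<close> is at most \<open>m^m\<close>.\<close>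

lemma diagram_prob_le:
  assumes N: "N > 0" and L: "L \<in> pars N n" and m: "m \<le> n"
    and A: "\<And>k. n - m < k \<Longrightarrow> k \<le> n \<Longrightarrow> real N / real k + 1 / real N \<le> A" "A \<ge> 0"
  shows "diagram_prob N n L \<le> (A * real m) ^ m"
proof -
  have sub: "{M. par (n - m) M \<and> M \<le> L} \<subseteq> pars N (n - m)"
  proof clarify
    fix M assume M: "par (n - m) M" "M \<le> L"
    have "M i = 0" if "i \<ge> N" for i using le_funD[OF M(2), of i] parsD(2)[OF L that] by simp
    with M show "M \<in> pars N (n - m)" by (simp add: pars_def)
  qed
  have "(\<Sum>M | par (n - m) M \<and> M \<le> L. diagram_prob N (n - m) M) \<le> (\<Sum>M\<in>pars N (n - m). diagram_prob N (n - m) M)"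
    using diagram_prob_pos[OF N] by (intro sum_mono2 sub) (auto intro: less_imp_le)
  then have le1: "(\<Sum>M | par (n - m) M \<and> M \<le> L. diagram_prob N (n - m) M) \<le> 1"
    by (simp add: sum_diagram_prob[OF N])
  have "diagram_prob N n L \<le> A ^ m * fact m * (\<Sum>M | par (n - m) M \<and> M \<le> L. diagram_prob N (n - m) M)"
    by (rule diagram_prob_iterate[OF N L m A(1)])
  also have "\<dots> \<le> A ^ m * fact m * 1"
    using A(2) by (intro mult_left_mono le1) simp
  also have "\<dots> \<le> A ^ m * real m ^ m"
    using A(2) fact_le_power[where 'a = real, of m] by (simp add: mult_left_mono)
  finally show ?thesis by (simp add: power_mult_distrib)
qed

subsection \<open>The number of diagrams\<close>

lemma power_div_fact_le_exp: "x \<ge> 0 \<Longrightarrow> x ^ n / fact n \<le> exp (x :: real)"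
proof -
  assume x: "x \<ge> 0"
  have sums: "(\<lambda>k. x ^ k /\<^sub>R fact k) sums exp x" by (rule exp_converges)
  have "(\<Sum>k\<in>{n}. x ^ k /\<^sub>R fact k) \<le> (\<Sum>k. x ^ k /\<^sub>R fact k)"
    by (rule sum_le_suminf[OF sums_summable[OF sums]]) (use x in auto)
  then have "(\<Sum>k\<in>{n}. x ^ k /\<^sub>R fact k) \<le> exp x" using sums_unique[OF sums] by simp
  then show ?thesis by (simp add: divide_inverse mult.commute)
qed

text \<open>Summation by parts: \<open>L k - L (Suc k)\<close> counts the columns of height
  \<open>Suc k\<close>, and \<open>N * L N\<close> is the boundary term.\<close>

lemma weighted_differences_sum:
  fixes L :: "nat \<Rightarrow> nat"
  assumes "decseq L"
  shows "(\<Sum>k<N. Suc k * (L k - L (Suc k))) + N * L N = sum L {..<N}"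
proof (induction N)
  case (Suc N)
  have "L N = (L N - L (Suc N)) + L (Suc N)" using decseq_SucD[OF assms, of N] by simp
  then have "N * L N + (L N) = N * (L N - L (Suc N)) + N * L (Suc N) + L N"
    by (metis distrib_left)
  moreover have "Suc N * (L N - L (Suc N)) + Suc N * L (Suc N) = Suc N * L N"
    using decseq_SucD[OF assms, of N] by (simp flip: distrib_left del: mult_Suc)
  ultimately show ?case using Suc by simp
qed simp

text \<open>A partition with at most \<open>N\<close> parts is determined by the differences of consecutive parts,
  which are the multiplicities of the parts of the conjugate partition.\<close>
lemma card_pars_generating_function:
  fixes x :: real
  assumes x: "0 < x" "x < 1"
  shows "real (card (pars N n)) * x ^ n \<le> (\<Prod>k<N. 1 / (1 - x ^ Suc k))"
proof -
  define d where "d L = restrict (\<lambda>k. L k - L (Suc k)) {..<N}" for L :: "nat \<Rightarrow> nat"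
  have d_PiE: "d L \<in> PiE {..<N} (\<lambda>_. {..n})" if L: "L \<in> pars N n" for L
  proof -
    have "L k \<le> n" for k
    proof (cases "k < n")
      case True
      then show ?thesis using member_le_sum[of k "{..<n}" L] parsD(1)[OF L] by (simp add: par_def)
    next
      case False
      then show ?thesis using parsD(1)[OF L] by (simp add: par_def)
    qed
    then show ?thesis by (auto simp: d_def intro: order_trans[OF diff_le_self])
  qed
  have d_inj: "inj_on d (pars N n)"
  proof (rule inj_onI)
    fix L M assume L: "L \<in> pars N n" and M: "M \<in> pars N n" and eq: "d L = d M"
    \<comment> \<open>The rows are recovered from their differences from below, starting at row
      \<open>N\<close>, where both diagrams are empty.\<close>
    have "L (N - i) = M (N - i)" for i
    proof (induction i)
      case 0
      show ?case using parsD(2)[OF L, of N] parsD(2)[OF M, of N] by simp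
    next
      case (Suc i)
      show ?case
      proof (cases "i < N")
        case True
        define k where "k = N - Suc i"
        have k: "k < N" "Suc k = N - i" using True by (auto simp: k_def)
        have "L k - L (Suc k) = M k - M (Suc k)" using fun_cong[OF eq, of k] k by (simp add: d_def)
        moreover have "L (Suc k) = M (Suc k)" using Suc k by simp
        ultimately have "L k = M k"
          using decseq_SucD[OF par_decseq[OF parsD(1)[OF L]], of k] decseq_SucD[OF par_decseq[OF parsD(1)[OF M]], of k]
          by simp
        then show ?thesis by (simp add: k_def)
      next
        case False
        then show ?thesis using Suc by simp
      qed
    qed
    from this[of "N - i" for i] have "L i = M i" if "i \<le> N" for i
      using that by (metis diff_diff_cancel)
    moreover have "L i = M i" if "\<not> i \<le> N" for i
      using parsD(2)[OF L, of i] parsD(2)[OF M, of i] that by simp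
    ultimately show "L = M" by blast
  qed
  have weight: "x ^ n = (\<Prod>k<N. (x ^ Suc k) ^ d L k)" if L: "L \<in> pars N n" for L
  proof -
    have "n = sum L {..<n}" using parsD(1)[OF L] by (simp add: par_def)
    also have "\<dots> = sum L {..<max n N}"
      using parsD(1)[OF L] by (intro sum_vanish[symmetric]) (auto simp: par_def)
    also have "\<dots> = sum L {..<N}" by (rule sum_vanish) (use parsD(2)[OF L] in auto)
    also have "\<dots> = (\<Sum>k<N. Suc k * (L k - L (Suc k)))"
      using weighted_differences_sum[OF par_decseq[OF parsD(1)[OF L]], of N] parsD(2)[OF L, of N] by simp
    also have "\<dots> = (\<Sum>k<N. Suc k * d L k)" by (simp add: d_def)
    finally have "x ^ n = x ^ (\<Sum>k<N. Suc k * d L k)" by simp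
    also have "\<dots> = (\<Prod>k<N. (x ^ Suc k) ^ d L k)" by (simp only: power_sum power_mult)
    finally show ?thesis .
  qed
  have "real (card (pars N n)) * x ^ n = (\<Sum>L\<in>pars N n. x ^ n)" by simp
  also have "\<dots> = (\<Sum>L\<in>pars N n. \<Prod>k<N. (x ^ Suc k) ^ d L k)"
    by (intro sum.cong refl weight)
  also have "\<dots> = (\<Sum>v\<in>d ` pars N n. \<Prod>k<N. (x ^ Suc k) ^ v k)"
    by (simp add: sum.reindex[OF d_inj])
  also have "\<dots> \<le> (\<Sum>v\<in>PiE {..<N} (\<lambda>_. {..n}). \<Prod>k<N. (x ^ Suc k) ^ v k)"
    using x d_PiE by (intro sum_mono2 prod_nonneg finite_PiE) auto
  also have "\<dots> = (\<Prod>k<N. \<Sum>m\<le>n. (x ^ Suc k) ^ m)"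
    by (rule prod_sum_PiE[symmetric]) auto
  also have "\<dots> \<le> (\<Prod>k<N. 1 / (1 - x ^ Suc k))"
  proof (rule prod_mono)
    fix k
    have y: "0 < x ^ Suc k" "x ^ Suc k < 1" using x by (auto simp: power_less_one_iff simp del: power_Suc)
    have "(\<Sum>m\<le>n. (x ^ Suc k) ^ m) = (1 - (x ^ Suc k) ^ Suc n) / (1 - x ^ Suc k)"
      using y sum_gp0[of "x ^ Suc k" n] by (simp del: power_Suc)
    also have "\<dots> \<le> 1 / (1 - x ^ Suc k)"
      using y by (intro divide_right_mono) (auto simp del: power_Suc)
    finally show "0 \<le> (\<Sum>m\<le>n. (x ^ Suc k) ^ m) \<and> (\<Sum>m\<le>n. (x ^ Suc k) ^ m) \<le> 1 / (1 - x ^ Suc k)"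
      using x by (auto intro!: sum_nonneg)
  qed
  finally show ?thesis .
qed

lemma card_pars_le:
  assumes N: "N > 0"
  shows "real (card (pars N n)) \<le> exp (real n / real N + 2 * real N)"
proof -
  \<comment> \<open>With this choice \<open>x^-n\<close> is \<open>exp (n / N)\<close>, and each
    factor \<open>1 - x^k\<close> with \<open>k \<le> N\<close> is at least
    \<open>k / (2 N)\<close>. The product is then at most \<open>(2 N)^N / N!\<close>, hence at most
    \<open>exp (2 N)\<close>. For \<open>N\<close> of order \<open>sqrt n\<close> both exponents
    have order \<open>sqrt n\<close>.\<close>
  define x where "x = exp (- (1 / real N))"
  have x: "0 < x" "x < 1" using N by (simp_all add: x_def)
  have factor: "1 / (1 - x ^ Suc k) \<le> 2 * real N / real (Suc k)" if "k < N" for k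
  proof -
    define t where "t = real (Suc k) / real N"
    have t: "0 < t" "t \<le> 1" using that N by (simp_all add: t_def)
    have "x ^ Suc k = exp (of_nat (Suc k) * (- (1 / real N)))"
      unfolding x_def by (rule exp_of_nat_mult[symmetric])
    also have "\<dots> = inverse (exp t)" by (simp add: t_def flip: exp_minus)
    also have "\<dots> \<le> inverse (1 + t)"
      using t exp_ge_add_one_self[of t] by (intro le_imp_inverse_le) auto
    finally have "1 - x ^ Suc k \<ge> t / (1 + t)" using t by (simp add: field_simps)
    moreover have "t / (1 + t) \<ge> t / 2" using t by (intro divide_left_mono) auto
    ultimately have "1 - x ^ Suc k \<ge> t / 2" by linarith
    then have "1 / (1 - x ^ Suc k) \<le> 1 / (t / 2)" using t by (intro divide_left_mono) auto
    then show ?thesis by (simp add: t_def mult.commute)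
  qed
  have pos: "0 \<le> 1 / (1 - x ^ Suc k)" for k
    using x power_le_one[of x "Suc k"] by (simp del: power_Suc)
  have "(\<Prod>k<N. 1 / (1 - x ^ Suc k)) \<le> (\<Prod>k<N. 2 * real N / real (Suc k))"
    using factor pos by (intro prod_mono) auto
  also have "\<dots> = 2 ^ N * (real N ^ N / fact N)"
  proof -
    have "(\<Prod>k<N. real (Suc k)) = fact N"
      by (induction N) (simp_all add: mult.commute)
    then show ?thesis by (simp add: prod_dividef power_mult_distrib)
  qed
  also have "\<dots> \<le> exp (real N) * exp (real N)"
  proof (rule mult_mono)
    have "(2::real) \<le> exp 1" using exp_ge_add_one_self[of 1] by simp
    then have "2 ^ N \<le> exp (1::real) ^ N" by (rule power_mono) simp
    then show "2 ^ N \<le> exp (real N)" by (simp flip: exp_of_nat_mult)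
  qed (auto intro: power_div_fact_le_exp)
  finally have bound: "real (card (pars N n)) * x ^ n \<le> exp (real N) * exp (real N)"
    using card_pars_generating_function[OF x, of N n] by linarith
  have xn: "x ^ n = exp (- (real n / real N))"
    by (simp add: x_def flip: exp_of_nat_mult)
  have "real (card (pars N n)) = real (card (pars N n)) * x ^ n * exp (real n / real N)"
    by (simp add: xn exp_minus)
  also have "\<dots> \<le> exp (real N) * exp (real N) * exp (real n / real N)"
    by (intro mult_right_mono bound) simp
  also have "\<dots> = exp (real n / real N + 2 * real N)"
    by (simp flip: exp_add add: algebra_simps)
  finally show ?thesis .
qed

lemma row_fun_bij: "bij_betw row_fun (young_diagrams N n) (pars N n)"
proof (rule bij_betw_imageI)
  have len: "row_fun lam i = 0 \<longleftrightarrow> i \<ge> length lam" if "lam \<in> young_diagrams N n" for lam i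
  proof (cases "i < length lam")
    case True
    then have "lam ! i \<in> set lam" by simp
    then have "lam ! i \<noteq> 0" using that unfolding young_diagrams_def by (metis (mono_tags, lifting) mem_Collect_eq)
    then show ?thesis using True by (simp add: row_fun_def)
  qed (simp add: row_fun_def)
  show "inj_on row_fun (young_diagrams N n)"
  proof (rule inj_onI)
    fix lam mu assume *: "lam \<in> young_diagrams N n" "mu \<in> young_diagrams N n" "row_fun lam = row_fun mu"
    have "i \<ge> length lam \<longleftrightarrow> i \<ge> length mu" for i
      using len[OF *(1), of i] len[OF *(2), of i] *(3) by simp
    from this[of "length lam"] this[of "length mu"] have eq: "length lam = length mu" by simp
    show "lam = mu"
    proof (rule nth_equalityI[OF eq])
      show "lam ! i = mu ! i" if "i < length lam" for i
        using fun_cong[OF *(3), of i] that eq by (simp add: row_fun_def)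
    qed
  qed
  show "row_fun ` young_diagrams N n = pars N n"
  proof (intro equalityI subsetI)
    fix L assume "L \<in> row_fun ` young_diagrams N n"
    then obtain lam where lam: "lam \<in> young_diagrams N n" "L = row_fun lam" by blast
    have "length lam \<le> N" using lam by (simp add: young_diagrams_def)
    then show "L \<in> pars N n"
      unfolding lam(2) pars_def using par_row_fun[OF lam(1)] by (simp add: row_fun_def)
  next
    fix L assume L: "L \<in> pars N n"
    note dec = par_decseq[OF parsD(1)[OF L]]
    define m where "m = (LEAST m. L m = 0)"
    have "L N = 0" by (rule parsD(2)[OF L]) simp
    then have m: "L m = 0" "m \<le> N"
      unfolding m_def by (rule LeastI, rule Least_le)
    have pos: "L i > 0" if "i < m" for i
      using not_less_Least[of i "\<lambda>m. L m = 0"] that by (simp add: m_def)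
    have zero: "L i = 0" if "m \<le> i" for i using decseqD[OF dec that] m by simp
    define lam where "lam = map L [0..<m]"
    have L_eq: "row_fun lam = L" using zero by (auto simp: lam_def row_fun_def fun_eq_iff)
    have "sum L {..<max N n} = n" by (rule par_sum[OF parsD(1)[OF L]]) simp
    moreover have "sum L {..<max N n} = sum L {..<m}" by (rule sum_vanish[OF zero]) (use m in auto)
    ultimately have "sum_list lam = n"
      by (simp add: lam_def interv_sum_list_conv_sum_set_nat atLeast0LessThan)
    moreover have "sorted_wrt (\<ge>) lam"
      unfolding lam_def sorted_wrt_map
      by (rule sorted_wrt_mono_rel[OF _ sorted_wrt_upt]) (simp add: decseqD[OF dec])
    moreover have "0 \<notin> set lam" using pos by (force simp: lam_def)
    ultimately have "lam \<in> young_diagrams N n" using m by (simp add: young_diagrams_def lam_def)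
    then show "L \<in> row_fun ` young_diagrams N n" using L_eq by blast
  qed
qed

lemma sum_PN_eq:
  assumes "N > 0"
  shows "(\<Sum>lam \<in> {lam \<in> young_diagrams N n. Q (PN N n lam)}. PN N n lam) =
    (\<Sum>L \<in> {L \<in> pars N n. Q (diagram_prob N n L)}. diagram_prob N n L)"
proof -
  have "bij_betw row_fun {lam \<in> young_diagrams N n. Q (PN N n lam)} {L \<in> pars N n. Q (diagram_prob N n L)}"
  proof (rule bij_betw_subset[OF row_fun_bij])
    show "row_fun ` {lam \<in> young_diagrams N n. Q (PN N n lam)} = {L \<in> pars N n. Q (diagram_prob N n L)}"
      using PN_eq[OF _ assms] by (auto simp: image_iff simp flip: bij_betw_imp_surj_on[OF row_fun_bij[of N n]])
  qed auto
  then have "(\<Sum>L \<in> {L \<in> pars N n. Q (diagram_prob N n L)}. diagram_prob N n L) =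
      (\<Sum>lam \<in> {lam \<in> young_diagrams N n. Q (PN N n lam)}. diagram_prob N n (row_fun lam))"
    by (rule sum.reindex_bij_betw[symmetric])
  also have "\<dots> = (\<Sum>lam \<in> {lam \<in> young_diagrams N n. Q (PN N n lam)}. PN N n lam)"
    using PN_eq[OF _ assms] by (intro sum.cong) auto
  finally show ?thesis ..
qed

subsection \<open>Concentration\<close>

text \<open>\<open>C\<close> collects the estimates \<open>N / k \<le> 4 / (c sqrt n)\<close> for
  \<open>k \<ge> n / 2\<close> and \<open>1 / N \<le> 2 c / sqrt n\<close>, so one step costs at
  most \<open>C / sqrt n\<close>. The rate \<open>e\<close> is chosen such that
  \<open>m \<le> e sqrt n\<close> steps keep \<open>C m / sqrt n\<close> below
  \<open>exp (-1)\<close>.\<close>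

lemma diagram_prob_upper:
  fixes c :: real
  defines "C \<equiv> 4 / c + 2 * c"
  defines "e \<equiv> 1 / (C * exp 1)"
  assumes c: "c > 0" and N: "N > 0"
    and ratio: "c / 2 \<le> sqrt (real n) / real N" "sqrt (real n) / real N \<le> 2 * c"
    and large: "2 * e \<le> sqrt (real n)" "0 < sqrt (real n)" and L: "L \<in> pars N n"
  shows "diagram_prob N n L \<le> exp (1 - e * sqrt (real n))"
proof -
  define s where "s = sqrt (real n)"
  have s: "s > 0" "s * s = real n" using large by (simp_all add: s_def)
  have "C > 0" using c by (simp add: C_def add_pos_pos)
  then have e: "e > 0" by (simp add: e_def)
  \<comment> \<open>Rounding down loses less than one step; this is the 1 in the exponent of the
    claim.\<close>
  define m where "m = nat \<lfloor>e * s\<rfloor>"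
  have m: "real m \<le> e * s" "e * s < real m + 1"
    using e s by (simp_all add: m_def)
  have n0: "real n > 0" using large(2) by simp
  have large_s: "2 * e \<le> s" using large(1) by (simp only: s_def)
  have "(2 * e) * s \<le> s * s" by (rule mult_right_mono[OF large_s]) (use s(1) in simp)
  \<comment> \<open>At least half of the boxes survive, so every intermediate size \<open>k\<close>
    is at least \<open>n / 2\<close>.\<close>
  then have m_half: "2 * real m \<le> real n" using m(1) s(2) by linarith
  have ratio_s: "c / 2 \<le> s / real N" "s / real N \<le> 2 * c" using ratio by (simp_all only: s_def)
  have N_up: "real N \<le> 2 * s / c" using ratio_s(1) c N by (simp add: field_simps)
  have N_low: "1 / real N \<le> 2 * c / s"
    using ratio_s(2) s(1) N by (simp add: field_simps)
  have A: "real N / real k + 1 / real N \<le> C / s" if "n - m < k" "k \<le> n" for k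
  proof -
    have "n \<le> 2 * k" using that m_half by linarith
    then have k: "real n / 2 \<le> real k" by linarith
    have "real N / real k \<le> real N / (real n / 2)"
      using k n0 by (intro divide_left_mono mult_pos_pos) auto
    also have "\<dots> \<le> (2 * s / c) / (real n / 2)"
      by (intro divide_right_mono N_up) simp
    also have "\<dots> = 4 / c / s" unfolding s(2)[symmetric] using s(1) c by (simp add: field_simps)
    finally have "real N / real k + 1 / real N \<le> 4 / c / s + 2 * c / s" using N_low by linarith
    then show ?thesis by (simp add: C_def add_divide_distrib)
  qed
  have "diagram_prob N n L \<le> (C / s * real m) ^ m"
    using m_half A \<open>C > 0\<close> s(1) by (intro diagram_prob_le[OF N L]) auto
  also have "\<dots> \<le> exp (- 1) ^ m"
  proof (rule power_mono)
    have "C / s * real m \<le> C / s * (e * s)"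
      using m(1) \<open>C > 0\<close> s(1) by (intro mult_left_mono) auto
    also have "\<dots> = C * e" using s(1) by simp
    also have "\<dots> = exp (- 1)" using \<open>C > 0\<close> by (simp add: e_def exp_minus divide_inverse)
    finally show "C / s * real m \<le> exp (- 1)" .
  qed (use \<open>C > 0\<close> s in simp)
  also have "\<dots> = exp (- real m)" by (simp flip: exp_of_nat_mult)
  also have "\<dots> \<le> exp (1 - e * s)" using m(2) by simp
  finally show ?thesis by (simp add: s_def)
qed

text \<open>The lower inequality in \<open>Q\<close> holds for every diagram, by
  \<open>diagram_prob_upper\<close>; only the upper one can fail. A diagram where it fails has
  probability at most \<open>exp (- (2 c + 4 / c + 1) sqrt n)\<close>, while there are at most
  \<open>exp ((2 c + 4 / c) sqrt n)\<close> diagrams. The summand 1 in the constant leaves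
  \<open>exp (- sqrt n)\<close>.\<close>

lemma concentration_bound:
  fixes c :: real
  defines "e \<equiv> 1 / ((4 / c + 2 * c) * exp 1)"
  defines "Q \<equiv> (\<lambda>n P. e / 2 < - (1 / sqrt (real n)) * ln P \<and> - (1 / sqrt (real n)) * ln P < 2 * c + 4 / c + 1)"
  assumes c: "c > 0" and N: "N > 0"
    and ratio: "c / 2 \<le> sqrt (real n) / real N" "sqrt (real n) / real N \<le> 2 * c"
    and large: "2 * e + 3 / e \<le> sqrt (real n)"
  defines "S \<equiv> (\<Sum>L \<in> {L \<in> pars N n. Q n (diagram_prob N n L)}. diagram_prob N n L)"
  shows "1 - exp (- sqrt (real n)) \<le> S" "S \<le> 1"
proof -
  define s where "s = sqrt (real n)"
  have e: "e > 0" using c by (simp add: e_def add_pos_pos)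
  then have "3 / e > 0" by simp
  then have large': "2 * e \<le> s" "3 / e \<le> s" using large e unfolding s_def by linarith+
  then have s: "s > 0" "s * s = real n" using \<open>3 / e > 0\<close> by (linarith, simp add: s_def)
  note pos = diagram_prob_pos[OF N]
  define B where "B = {L \<in> pars N n. \<not> Q n (diagram_prob N n L)}"
  have B: "diagram_prob N n L \<le> exp (- (2 * c + 4 / c + 1) * s)" if "L \<in> B" for L
  proof -
    have L: "L \<in> pars N n" and nQ: "\<not> Q n (diagram_prob N n L)" using that by (auto simp: B_def)
    have "diagram_prob N n L \<le> exp (1 - e * s)"
      using diagram_prob_upper[OF c N ratio _ _ L] large' s(1) by (simp add: e_def s_def)
    then have "ln (diagram_prob N n L) \<le> 1 - e * s"
      using pos[OF L] by (metis ln_exp ln_le_cancel_iff exp_gt_zero)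
    \<comment> \<open>The summand \<open>3 / e\<close> in \<open>large\<close> serves this step:
      \<open>e * s - 1\<close> has to exceed \<open>e / 2 * s\<close>.\<close>
    moreover have "e * s \<ge> 3" using large'(2) e by (simp add: field_simps)
    ultimately have "e / 2 * s < - ln (diagram_prob N n L)" by (simp add: field_simps)
    then have "e / 2 < - (1 / s) * ln (diagram_prob N n L)" using s(1) by (simp add: field_simps)
    with nQ have "2 * c + 4 / c + 1 \<le> - (1 / s) * ln (diagram_prob N n L)"
      by (auto simp: Q_def s_def)
    then have "(2 * c + 4 / c + 1) * s \<le> - (1 / s) * ln (diagram_prob N n L) * s"
      using s(1) by (intro mult_right_mono) auto
    also have "\<dots> = - ln (diagram_prob N n L)" using s(1) by simp
    finally have "ln (diagram_prob N n L) \<le> - (2 * c + 4 / c + 1) * s" unfolding mult_minus_left by linarith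
    then have "exp (ln (diagram_prob N n L)) \<le> exp (- (2 * c + 4 / c + 1) * s)" by (simp only: exp_le_cancel_iff)
    then show ?thesis using pos[OF L] by simp
  qed
  have "(\<Sum>L\<in>B. diagram_prob N n L) \<le> (\<Sum>L\<in>B. exp (- (2 * c + 4 / c + 1) * s))"
    by (intro sum_mono B)
  also have "\<dots> = real (card B) * exp (- (2 * c + 4 / c + 1) * s)" by simp
  also have "\<dots> \<le> exp (real n / real N + 2 * real N) * exp (- (2 * c + 4 / c + 1) * s)"
  proof (rule mult_right_mono)
    have "card B \<le> card (pars N n)" by (rule card_mono) (auto simp: B_def)
    then show "real (card B) \<le> exp (real n / real N + 2 * real N)" using card_pars_le[OF N, of n] by linarith
  qed simp
  also have "\<dots> = exp (real n / real N + 2 * real N - (2 * c + 4 / c + 1) * s)"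
    by (simp only: exp_add[symmetric] mult_minus_left add_uminus_conv_diff)
  also have "\<dots> \<le> exp (- s)"
  proof -
    have "real n / real N = s * (s / real N)" by (simp flip: s(2))
    also have "\<dots> \<le> s * (2 * c)" using ratio(2) s(1) by (intro mult_left_mono) (simp_all add: s_def)
    finally have "real n / real N \<le> 2 * c * s" by (simp only: ac_simps)
    moreover have "2 * real N \<le> 4 / c * s" using ratio(1) c N by (simp add: s_def field_simps)
    ultimately show ?thesis by (simp add: algebra_simps)
  qed
  finally have bad: "(\<Sum>L\<in>B. diagram_prob N n L) \<le> exp (- s)" .
  have "(\<Sum>L\<in>pars N n. diagram_prob N n L) = S + (\<Sum>L\<in>B. diagram_prob N n L)"
    unfolding S_def B_def by (subst sum.union_disjoint[symmetric]) (auto intro!: sum.cong)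
  then have "1 = S + (\<Sum>L\<in>B. diagram_prob N n L)" by (simp add: sum_diagram_prob[OF N])
  moreover have "(\<Sum>L\<in>B. diagram_prob N n L) \<ge> 0"
    using pos by (intro sum_nonneg) (auto simp: B_def intro: less_imp_le)
  ultimately show "1 - exp (- sqrt (real n)) \<le> S" "S \<le> 1"
    using bad by (simp_all add: s_def)
qed

theorem theorem2:
  fixes c :: real
  assumes "c > 0"
  shows "\<exists>\<alpha> \<beta>::real. \<alpha> > 0 \<and> \<beta> > 0 \<and>
    (\<forall>N :: nat \<Rightarrow> nat. (\<forall>n. N n > 0) \<longrightarrow>
       ((\<lambda>n. sqrt (real n) / real (N n)) \<longlonglongrightarrow> c) \<longrightarrow>
       ((\<lambda>n. \<Sum>lam \<in> {lam \<in> young_diagrams (N n) n.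
                 \<alpha> < - (1 / sqrt (real n)) * ln (PN (N n) n lam) \<and>
                 - (1 / sqrt (real n)) * ln (PN (N n) n lam) < \<beta>}.
              PN (N n) n lam) \<longlonglongrightarrow> 1))"
proof -
  define e where "e = 1 / ((4 / c + 2 * c) * exp 1)"
  define b where "b = 2 * c + 4 / c + 1"
  have e: "e > 0" and b: "b > 0" using assms by (simp_all add: e_def b_def add_pos_pos)
  have "(\<lambda>n. \<Sum>lam \<in> {lam \<in> young_diagrams (N n) n.
                 e / 2 < - (1 / sqrt (real n)) * ln (PN (N n) n lam) \<and>
                 - (1 / sqrt (real n)) * ln (PN (N n) n lam) < b}.
              PN (N n) n lam) \<longlonglongrightarrow> 1"
    if N: "\<forall>n. N n > 0" and lim: "(\<lambda>n. sqrt (real n) / real (N n)) \<longlonglongrightarrow> c" for N :: "nat \<Rightarrow> nat"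
  proof -
    let ?S = "\<lambda>n. \<Sum>lam \<in> {lam \<in> young_diagrams (N n) n.
                 e / 2 < - (1 / sqrt (real n)) * ln (PN (N n) n lam) \<and>
                 - (1 / sqrt (real n)) * ln (PN (N n) n lam) < b}.
              PN (N n) n lam"
    have S: "?S n = (\<Sum>L \<in> {L \<in> pars (N n) n.
                 e / 2 < - (1 / sqrt (real n)) * ln (diagram_prob (N n) n L) \<and>
                 - (1 / sqrt (real n)) * ln (diagram_prob (N n) n L) < b}.
              diagram_prob (N n) n L)" for n
      by (rule sum_PN_eq[OF N[rule_format],
            where n = n and Q = "\<lambda>P. e / 2 < - (1 / sqrt (real n)) * ln P \<and> - (1 / sqrt (real n)) * ln P < b"])
    have sqrt_top: "filterlim (\<lambda>n. sqrt (real n)) at_top sequentially"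
      by (rule filterlim_compose[OF sqrt_at_top filterlim_real_sequentially])
    \<comment> \<open>The limit \<open>c\<close> places the ratio eventually in the window from
      \<open>c / 2\<close> to \<open>2 * c\<close> on which \<open>concentration_bound\<close>
      rests.\<close>
    have "eventually (\<lambda>n. c / 2 < sqrt (real n) / real (N n)) sequentially"
      using assms by (intro order_tendstoD(1)[OF lim]) simp
    moreover have "eventually (\<lambda>n. sqrt (real n) / real (N n) < 2 * c) sequentially"
      using assms by (intro order_tendstoD(2)[OF lim]) simp
    moreover have "eventually (\<lambda>n. 2 * e + 3 / e \<le> sqrt (real n)) sequentially"
      using sqrt_top by (simp add: filterlim_at_top)
    ultimately have ev: "eventually (\<lambda>n. 1 - exp (- sqrt (real n)) \<le> ?S n \<and> ?S n \<le> 1) sequentially"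
    proof eventually_elim
      case (elim n)
      have "N n > 0" using N by simp
      from concentration_bound[OF assms this less_imp_le[OF elim(1)] less_imp_le[OF elim(2)]] elim(3)
      show ?case unfolding S unfolding e_def b_def by blast
    qed
    have "((\<lambda>n. exp (- sqrt (real n))) \<longlongrightarrow> 0) sequentially"
      by (rule filterlim_compose[OF exp_at_bot]) (use sqrt_top in \<open>simp add: filterlim_uminus_at_bot\<close>)
    then have "((\<lambda>n. 1 - exp (- sqrt (real n))) \<longlongrightarrow> 1 - 0) sequentially"
      by (intro tendsto_diff tendsto_const)
    then have lower: "((\<lambda>n. 1 - exp (- sqrt (real n))) \<longlongrightarrow> 1) sequentially" by simp
    show ?thesis
      by (rule tendsto_sandwich[OF _ _ lower tendsto_const])
        (use ev in \<open>auto elim: eventually_mono\<close>)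
  qed
  with e b show ?thesis by (intro exI[of _ "e / 2"] exI[of _ b]) auto
qed

end
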